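(* Let $\mu$, $\lambda$, $C_\lambda$, $\alpha$, $(s_t)_{t>0}$ and $(\theta_t)_{t>0}$ be as in the context. Assume that there is a constant $C_0<\infty$ such that $$\iint_{\widehat Q} |\theta_t \chi_Q(x)|^2\,d\mu(x)\,\frac{dt}{t} \le C_0\, \mu(Q)$$ for every cube $Q \subset \mathbb{R}^n$. Then there is a constant $C<\infty$ such that $$\iint_{\mathbb{R}^{n+1}_+} |\theta_t f(x)|^2\,d\mu(x)\,\frac{dt}{t} \le C\, \|f\|_{L^2(\mu)}^2 \qquad \text{for all } f \in L^2(\mu).$$
   Context: $\mathbb{R}^n$ is equipped with the $\ell^\infty$ metric, $|x-y|=\max_i|x_i-y_i|$; $B(x,r)$ denotes the corresponding ball, and $\mathbb{R}^{n+1}_+=\mathbb{R}^n\times(0,\infty)$. Cubes have sides parallel to the coordinate axes; $\ell(Q)$ is the sidelength of a cube $Q$, $\chi_Q$ is its indicator function, and $\widehat Q = Q\times(0,\ell(Q))$ is the Carleson box associated with $Q$. $\mu$ is a Borel measure on $\mathbb{R}^n$ and $\lambda:\mathbb{R}^n\times(0,\infty)\to(0,\infty)$ is a function such that $r\mapsto\lambda(x,r)$ is non-decreasing for each $x$, $\lambda(x,2r)\le C_\lambda\lambda(x,r)$ and $\mu(B(x,r))\le\lambda(x,r)$ for all $x\in\mathbb{R}^n$, $r>0$, where $C_\lambda$ is a constant. For $t>0$, $$\theta_t f(x)=\int_{\mathbb{R}^n}s_t(x,y)f(y)\,d\mu(y),\qquad x\in\mathbb{R}^n,$$ where the kernel $(x,y,t)\mapsto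 s_t(x,y)$ is measurable and, for some $\alpha>0$ and some constant $C_1$, satisfies for all $x,y\in\mathbb{R}^n$ and $t>0$ $$|s_t(x,y)|\le C_1\frac{t^\alpha}{t^\alpha\lambda(x,t)+|x-y|^\alpha\lambda(x,|x-y|)}$$ and $$|s_t(x,y)-s_t(x,z)|\le C_1\frac{|y-z|^\alpha}{t^\alpha\lambda(x,t)+|x-y|^\alpha\lambda(x,|x-y|)}\quad\text{whenever }|y-z|<t/2.$$ The term $|x-y|^\alpha\lambda(x,|x-y|)$ is interpreted as $0$ when $x=y$. *)

theory Defs
  imports "HOL-Analysis.Analysis"
begin

text \<open>The distance on \<open>real ^ 'n\<close> is \<open>infnorm (x - y)\<close>, the maximum of the \<open>\<bar>x $ i - y $ i\<bar>\<close>;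
  the library's \<open>dist\<close> and \<open>ball\<close> are Euclidean and are not used here.\<close>

definition linf_ball :: "real ^ 'n \<Rightarrow> real \<Rightarrow> (real ^ 'n) set"
  where "linf_ball x r = {y. infnorm (x - y) < r}"

text \<open>The closed cube with lower corner \<open>a\<close> and sidelength \<open>l\<close>. For testing conditions of the form
  considered here, the choice between closed, half-open and open cubes is immaterial: each kind of
  cube is a monotone limit of cubes of any other kind, and Fatou's lemma transfers the estimate.\<close>

definition cube :: "real ^ 'n \<Rightarrow> real \<Rightarrow> (real ^ 'n) set"
  where "cube a l = cbox a (a + (\<chi> i. l))"

definition carleson_box :: "real ^ 'n \<Rightarrow> real \<Rightarrow> ((real ^ 'n) \<times> real) set"
  where "carleson_box a l = cube a l \<times> {0<..<l}"

definition upper_half_space :: "((real ^ 'n) \<times> real) set"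
  where "upper_half_space = UNIV \<times> {0<..}"

definition theta ::
  "(real ^ 'n) measure \<Rightarrow> (real \<Rightarrow> real ^ 'n \<Rightarrow> real ^ 'n \<Rightarrow> complex) \<Rightarrow> real
    \<Rightarrow> (real ^ 'n \<Rightarrow> complex) \<Rightarrow> real ^ 'n \<Rightarrow> complex"
  where "theta \<mu> s t f x = (LINT y|\<mu>. s t x y * f y)"

text \<open>The integral of \<open>\<bar>\<theta>\<^sub>t f(x)\<bar>\<^sup>2 d\<mu>(x) dt/t\<close> over \<open>A\<close>; only sets \<open>A\<close> contained in the
  upper half space are meaningful.\<close>

definition square_integral ::
  "(real ^ 'n) measure \<Rightarrow> (real \<Rightarrow> real ^ 'n \<Rightarrow> real ^ 'n \<Rightarrow> complex)
    \<Rightarrow> (real ^ 'n \<Rightarrow> complex) \<Rightarrow> ((real ^ 'n) \<times> real) set \<Rightarrow> ennreal"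
  where "square_integral \<mu> s f A =
    (\<integral>\<^sup>+ (x, t) \<in> A. ennreal ((cmod (theta \<mu> s t f x))\<^sup>2 / t) \<partial>(\<mu> \<Otimes>\<^sub>M lborel))"

definition L2 :: "'a measure \<Rightarrow> ('a \<Rightarrow> complex) set"
  where "L2 \<mu> = {f \<in> borel_measurable \<mu>. integrable \<mu> (\<lambda>x. (cmod (f x))\<^sup>2)}"

definition L2norm :: "'a measure \<Rightarrow> ('a \<Rightarrow> complex) \<Rightarrow> real"
  where "L2norm \<mu> f = sqrt (LINT x|\<mu>. (cmod (f x))\<^sup>2)"

text \<open>The denominator in the kernel estimates. For \<open>x = y\<close> the second summand is \<open>0\<close>, whatever
  the junk value \<open>\<lambda>(x, 0)\<close>, because \<open>0 powr \<alpha> = 0\<close>.\<close>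

definition kernel_denom ::
  "(real ^ 'n \<Rightarrow> real \<Rightarrow> real) \<Rightarrow> real \<Rightarrow> real \<Rightarrow> real ^ 'n \<Rightarrow> real ^ 'n \<Rightarrow> real"
  where "kernel_denom lam \<alpha> t x y =
    t powr \<alpha> * lam x t + infnorm (x - y) powr \<alpha> * lam x (infnorm (x - y))"

end

theory Submission
  imports Defs
begin

text \<open>On the scale \<open>t \<in> [l/2, l)\<close> the operator \<open>\<theta>\<^sub>t\<close> is compared with multiplication of a conditional
expectation by \<open>\<theta>\<^sub>t 1\<close>:
\<open>\<theta>\<^sub>t f = (\<theta>\<^sub>t f - \<theta>\<^sub>t 1 \<cdot> E\<^sub>k f) + \<theta>\<^sub>t 1 \<cdot> E\<^sub>k f\<close>, where \<open>E\<^sub>k\<close> averages over the half-open cubes of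
sidelength \<open>l = L/2\<^sup>k\<close> of a dyadic grid. Averages over grid cubes replace the usual convolutions
because \<open>\<mu>\<close> need not be doubling. What a grid spoils is the neighbourhood of the cell boundaries:
the kernel decays with the distance of \<open>x\<close> to the complement of its cell, and \<open>\<mu>\<close> may concentrate
where that distance is small. This is cured by translating the grid by \<open>(w, \<dots>, w)\<close> with \<open>w \<in> [0, L]\<close>.
A point \<open>(x, t)\<close> of scale \<open>k\<close> is good for \<open>w\<close> if for every \<open>i \<le> k\<close> the distance of \<open>x\<close> to the
complement of its cell of generation \<open>i\<close> is at least \<open>c (3/4)\<^bsup>k-i\<^esup> L/2\<^sup>i\<close>. Each \<open>(x, t)\<close> is good for at least
half of the shifts (\<open>good_measure\<close>). Since \<open>\<theta>\<^sub>t f(x)\<close> does not depend on the grid, the whole square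
integral is at most twice the average over \<open>w\<close> of its part over the good points
(\<open>all_scales_bound\<close>), and it suffices to bound that part uniformly in \<open>w\<close>, \<open>L\<close> and the
number \<open>N\<close> of generations (\<open>good_part_bound\<close>).

For the remainder, \<open>f\<close> is written as the finite sum of \<open>g\<^sub>0 = E\<^sub>0 f\<close>, \<open>g\<^sub>i = E\<^sub>i f - E\<^bsub>i-1\<^esub> f\<close> and
\<open>g\<^bsub>N+1\<^esub> = f - E\<^sub>N f\<close>, whose squared norms add up to that of \<open>f\<close>. Keeping the two end pieces makes
convergence of martingales irrelevant. If \<open>i > k\<close>, then \<open>g\<^sub>i\<close> has mean zero on cells
of sidelength comparable with \<open>2\<^bsup>k-i\<^esup> t\<close>, and the regularity of the kernel gains a factor \<open>2\<^bsup>-\<alpha>(i-k)\<^esup>\<close>. If \<open>i \<le> k\<close>, then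
\<open>g\<^sub>i\<close> is constant on the cell of \<open>x\<close>, so only \<open>y\<close> outside of this cell contribute to
\<open>\<theta>\<^sub>t g\<^sub>i(x) - \<theta>\<^sub>t 1(x) g\<^sub>i(x)\<close>, and at a good point the size of the kernel gains a power of \<open>(2/3)\<^bsup>k-i\<^esup>\<close>.
Geometric decay in the distance of \<open>i\<close> and \<open>k\<close> then sums over all scales (\<open>term_at_L2_bound\<close>,
\<open>sum_remainder_bound\<close>). Both gains are turned into \<open>L\<^sup>2\<close> bounds by Schur's test.

The term \<open>\<theta>\<^sub>t 1 \<cdot> E\<^sub>k f\<close> is a paraproduct, controlled by the Carleson embedding theorem
(\<open>carleson_embedding\<close>). Its packing condition for a cell \<open>Q\<close> asks for the integral of
\<open>\<bar>\<theta>\<^sub>t 1\<bar>\<^sup>2\<close> over the good points of the Carleson box of \<open>Q\<close>. There \<open>\<theta>\<^sub>t 1\<close> may be replaced by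
\<open>\<theta>\<^sub>t \<chi>\<^sub>Q\<close>, which the hypothesis bounds, because at good points the contribution of the complement
of \<open>Q\<close> is at most a power of \<open>t/l\<close>, with \<open>l\<close> the sidelength of \<open>Q\<close> (\<open>packing\<close>). Thus no dilate of \<open>Q\<close> ever enters.\<close>

section \<open>Averages over the cells of a countable partition\<close>

abbreviation (input) sq :: "complex \<Rightarrow> ennreal"
  where "sq z \<equiv> ennreal ((cmod z)\<^sup>2)"

text \<open>On null cells the value is \<open>0\<close>, by division by zero.\<close>

definition cell_avg :: "'a measure \<Rightarrow> ('a \<Rightarrow> 'i) \<Rightarrow> ('a \<Rightarrow> complex) \<Rightarrow> 'a \<Rightarrow> complex"
  where "cell_avg M p f x =
    (LINT y|M. indicator {y. p y = p x} y *\<^sub>R f y) / of_real (measure M {y \<in> space M. p y = p x})"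

definition nn_cell_avg :: "'a measure \<Rightarrow> ('a \<Rightarrow> 'i) \<Rightarrow> ('a \<Rightarrow> ennreal) \<Rightarrow> 'a \<Rightarrow> ennreal"
  where "nn_cell_avg M p g x =
    (\<integral>\<^sup>+y. g y * indicator {y. p y = p x} y \<partial>M) / emeasure M {y \<in> space M. p y = p x}"

lemma le_one_plus_square: "(a::real) \<le> 1 + a\<^sup>2"
  using zero_le_power2[of "a - 1/2"] by (simp add: power2_eq_square algebra_simps)

lemma power2_sum_le: "(a + b)\<^sup>2 \<le> 2 * a\<^sup>2 + 2 * (b::real)\<^sup>2"
  using zero_le_power2[of "a - b"] by (simp add: power2_eq_square algebra_simps)

locale countable_partition =
  fixes M :: "'a measure" and p :: "'a \<Rightarrow> 'i::countable"
  assumes p_measurable [measurable]: "p \<in> measurable M (count_space UNIV)"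
    and cell_finite: "\<And>z. emeasure M {x \<in> space M. p x = z} < \<infinity>"
begin

lemma nn_integral_cells:
  assumes [measurable]: "F \<in> borel_measurable M"
  shows "(\<integral>\<^sup>+x. F x \<partial>M) = (\<integral>\<^sup>+z. (\<integral>\<^sup>+x. F x * indicator {x. p x = z} x \<partial>M) \<partial>count_space UNIV)"
proof -
  have "(\<integral>\<^sup>+x. F x \<partial>M) = (\<integral>\<^sup>+x. (\<integral>\<^sup>+z. F x * indicator {x. p x = z} x \<partial>count_space UNIV) \<partial>M)"
  proof (rule nn_integral_cong)
    fix x
    have "(\<integral>\<^sup>+z. F x * indicator {x. p x = z} x \<partial>count_space UNIV)
        = (\<integral>\<^sup>+z. F x * indicator {p x} z \<partial>count_space UNIV)"
      by (intro nn_integral_cong) (auto simp: indicator_def)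
    also have "\<dots> = F x"
      by (subst nn_integral_cmult_indicator) auto
    finally show "F x = (\<integral>\<^sup>+z. F x * indicator {x. p x = z} x \<partial>count_space UNIV)" by simp
  qed
  also have "\<dots> = (\<integral>\<^sup>+z. (\<integral>\<^sup>+x. F x * indicator {x. p x = z} x \<partial>M) \<partial>count_space UNIV)"
    by (rule nn_integral_count_space_nn_integral) auto
  finally show ?thesis .
qed

lemma nn_integral_mono_cells:
  assumes "F \<in> borel_measurable M" "G \<in> borel_measurable M"
    and "\<And>z. (\<integral>\<^sup>+x. F x * indicator {x. p x = z} x \<partial>M) \<le> (\<integral>\<^sup>+x. G x * indicator {x. p x = z} x \<partial>M)"
  shows "(\<integral>\<^sup>+x. F x \<partial>M) \<le> (\<integral>\<^sup>+x. G x \<partial>M)"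
  unfolding nn_integral_cells[OF assms(1)] nn_integral_cells[OF assms(2)]
  by (intro nn_integral_mono assms(3))

lemma nn_integral_cong_cells:
  assumes "F \<in> borel_measurable M" "G \<in> borel_measurable M"
    and "\<And>z. (\<integral>\<^sup>+x. F x * indicator {x. p x = z} x \<partial>M) = (\<integral>\<^sup>+x. G x * indicator {x. p x = z} x \<partial>M)"
  shows "(\<integral>\<^sup>+x. F x \<partial>M) = (\<integral>\<^sup>+x. G x \<partial>M)"
  unfolding nn_integral_cells[OF assms(1)] nn_integral_cells[OF assms(2)] assms(3) ..

lemma measurable_cell_function:
  "(\<lambda>x. G (p x)) \<in> borel_measurable M"
  by measurable

lemma cell_avg_measurable [measurable]: "cell_avg M p f \<in> borel_measurable M"
  unfolding cell_avg_def[abs_def]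
  by (rule measurable_cell_function[where G="\<lambda>z. (LINT y|M. indicator {y. p y = z} y *\<^sub>R f y) / of_real (measure M {y \<in> space M. p y = z})"])

lemma nn_cell_avg_measurable [measurable]: "nn_cell_avg M p g \<in> borel_measurable M"
  unfolding nn_cell_avg_def[abs_def]
  by (rule measurable_cell_function[where G="\<lambda>z. (\<integral>\<^sup>+y. g y * indicator {y. p y = z} y \<partial>M) / emeasure M {y \<in> space M. p y = z}"])

lemma nn_integral_const_cell:
  "(\<integral>\<^sup>+x. c * indicator {x. p x = z} x \<partial>M) = c * emeasure M {x \<in> space M. p x = z}"
proof -
  have "(\<integral>\<^sup>+x. c * indicator {x. p x = z} x \<partial>M) = (\<integral>\<^sup>+x. c * indicator {x \<in> space M. p x = z} x \<partial>M)"
    by (intro nn_integral_cong) (auto simp: indicator_def)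
  also have "\<dots> = c * emeasure M {x \<in> space M. p x = z}"
    by (rule nn_integral_cmult_indicator) measurable
  finally show ?thesis .
qed

lemma nn_integral_null_cell:
  assumes "emeasure M {x \<in> space M. p x = z} = 0" and [measurable]: "F \<in> borel_measurable M"
  shows "(\<integral>\<^sup>+x. F x * indicator {x. p x = z} x \<partial>M) = 0"
proof -
  have "{x \<in> space M. p x = z} \<in> null_sets M" using assms(1) by (intro null_setsI) measurable
  then have "AE x in M. x \<notin> {x \<in> space M. p x = z}" by (rule AE_not_in)
  then have "AE x in M. F x * indicator {x. p x = z} x = 0"
    by (rule AE_mp) (auto intro!: AE_I2 simp: indicator_def)
  then show ?thesis by (simp add: nn_integral_0_iff_AE)
qed

text \<open>Taking for \<open>w\<close> the indicator of a union of cells, this says that averaging preserves the integral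
over every cell of a coarser partition.\<close>

lemma nn_integral_weighted_avg:
  assumes [measurable]: "g \<in> borel_measurable M" "w \<in> borel_measurable M"
    and w: "\<And>x y. p x = p y \<Longrightarrow> w x = w y"
  shows "(\<integral>\<^sup>+x. nn_cell_avg M p g x * w x \<partial>M) = (\<integral>\<^sup>+x. g x * w x \<partial>M)"
proof (rule nn_integral_cong_cells)
  fix z
  define m where "m = emeasure M {x \<in> space M. p x = z}"
  define I where "I = (\<integral>\<^sup>+y. g y * indicator {y. p y = z} y \<partial>M)"
  have Im: "I / m * m = I"
  proof (cases "m = 0")
    case True
    then have "I = 0" unfolding I_def m_def by (rule nn_integral_null_cell) simp
    then show ?thesis by simp
  next
    case False
    then have "m / m = 1" using cell_finite[of z] unfolding m_def by (intro ennreal_divide_self) auto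
    then show ?thesis by (simp only: ennreal_divide_times mult_1_right)
  qed
  show "(\<integral>\<^sup>+x. nn_cell_avg M p g x * w x * indicator {x. p x = z} x \<partial>M)
      = (\<integral>\<^sup>+x. g x * w x * indicator {x. p x = z} x \<partial>M)"
  proof (cases "\<exists>x0. p x0 = z")
    case True
    then obtain x0 where x0: "p x0 = z" by auto
    define c where "c = w x0"
    have c: "w x = c" if "p x = z" for x using w[of x x0] that x0 by (simp add: c_def)
    have "(\<integral>\<^sup>+x. nn_cell_avg M p g x * w x * indicator {x. p x = z} x \<partial>M)
        = (\<integral>\<^sup>+x. (I / m * c) * indicator {x. p x = z} x \<partial>M)"
            by (intro nn_integral_cong) (auto simp: indicator_def c nn_cell_avg_def I_def m_def)
    also have "\<dots> = I / m * c * m"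
      by (subst nn_integral_const_cell) (simp add: m_def)
    also have "\<dots> = c * I" using Im by (simp add: mult.commute mult.left_commute)
    also have "\<dots> = (\<integral>\<^sup>+x. c * (g x * indicator {x. p x = z} x) \<partial>M)"
      unfolding I_def by (subst nn_integral_cmult) auto
    also have "\<dots> = (\<integral>\<^sup>+x. g x * w x * indicator {x. p x = z} x \<partial>M)"
      by (intro nn_integral_cong) (auto simp: indicator_def c mult.commute)
    finally show ?thesis .
  next
    case False
    then have "{x. p x = z} = {}" by auto
    then show ?thesis by simp
  qed
qed measurable

lemma square_integrable_cell:
  assumes [measurable]: "f \<in> borel_measurable M" and f: "integrable M (\<lambda>x. (cmod (f x))\<^sup>2)"
  shows "integrable M (\<lambda>y. indicator {y. p y = z} y *\<^sub>R f y)"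
    "integrable M (\<lambda>y. indicator {y. p y = z} y :: real)"
proof -
  have [measurable]: "Measurable.pred M (\<lambda>y. p y = z)" by measurable
  have "integrable M (indicator {y \<in> space M. p y = z} :: _ \<Rightarrow> real)"
    using cell_finite[of z] by (intro integrable_real_indicator) auto
  then show 1: "integrable M (\<lambda>y. indicator {y. p y = z} y :: real)"
    by (rule Bochner_Integration.integrable_cong[THEN iffD1, rotated -1]) (auto simp: indicator_def)
  have b: "cmod (f y) \<le> 1 + (cmod (f y))\<^sup>2" for y
    by (rule le_one_plus_square)
  show "integrable M (\<lambda>y. indicator {y. p y = z} y *\<^sub>R f y)"
    by (rule Bochner_Integration.integrable_bound[OF Bochner_Integration.integrable_add[OF 1 f]])
      (auto simp: indicator_def b)
qed

lemma cmod_cell_avg_le: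
  assumes [measurable]: "f \<in> borel_measurable M" and f: "integrable M (\<lambda>x. (cmod (f x))\<^sup>2)"
  shows "ennreal (cmod (cell_avg M p f x)) \<le> nn_cell_avg M p (\<lambda>y. ennreal (cmod (f y))) x"
proof -
  define m where "m = measure M {y \<in> space M. p y = p x}"
  have em: "emeasure M {y \<in> space M. p y = p x} = ennreal m"
    unfolding m_def using cell_finite[of "p x"] by (intro emeasure_eq_ennreal_measure) auto
  have a: "ennreal (cmod (LINT y|M. indicator {y. p y = p x} y *\<^sub>R f y))
      \<le> (\<integral>\<^sup>+y. ennreal (cmod (f y)) * indicator {y. p y = p x} y \<partial>M)"
  proof -
    have "ennreal (cmod (LINT y|M. indicator {y. p y = p x} y *\<^sub>R f y))
        \<le> (\<integral>\<^sup>+y. ennreal (cmod (indicator {y. p y = p x} y *\<^sub>R f y)) \<partial>M)"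
      by (rule integral_norm_bound_ennreal[OF square_integrable_cell(1)[OF assms]])
    also have "\<dots> = (\<integral>\<^sup>+y. ennreal (cmod (f y)) * indicator {y. p y = p x} y \<partial>M)"
      by (intro nn_integral_cong) (auto simp: indicator_def)
    finally show ?thesis .
  qed
  show ?thesis
  proof (cases "m = 0")
    case True
    then show ?thesis by (simp add: cell_avg_def m_def[symmetric])
  next
    case False
    then have m: "m > 0" by (simp add: m_def less_le)
    have "ennreal (cmod (cell_avg M p f x))
        = ennreal (cmod (LINT y|M. indicator {y. p y = p x} y *\<^sub>R f y)) / ennreal m"
      using m by (simp add: cell_avg_def m_def[symmetric] norm_divide divide_ennreal)
    also have "\<dots> \<le> nn_cell_avg M p (\<lambda>y. ennreal (cmod (f y))) x"
      unfolding nn_cell_avg_def em by (intro divide_right_mono_ennreal a)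
    finally show ?thesis .
  qed
qed

text \<open>The quotient in the definition of the average loses nothing on null cells, where the integral
vanishes as well.\<close>

lemma measure_scaleR_avg:
  assumes [measurable]: "f \<in> borel_measurable M" and f: "integrable M (\<lambda>x. (cmod (f x))\<^sup>2)"
  shows "measure M {y \<in> space M. p y = z} *\<^sub>R ((LINT y|M. indicator {y. p y = z} y *\<^sub>R f y)
      / of_real (measure M {y \<in> space M. p y = z}))
    = (LINT y|M. indicator {y. p y = z} y *\<^sub>R f y)"
proof (cases "measure M {y \<in> space M. p y = z} = 0")
  case True
  have [measurable]: "Measurable.pred M (\<lambda>y. p y = z)" by measurable
  have "emeasure M {y \<in> space M. p y = z} = ennreal (measure M {y \<in> space M. p y = z})"
    using cell_finite[of z] by (intro emeasure_eq_ennreal_measure) auto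
  then have "{x \<in> space M. p x = z} \<in> null_sets M" using True by (intro null_setsI) auto
  then have "AE x in M. x \<notin> {x \<in> space M. p x = z}" by (rule AE_not_in)
  then have "AE x in M. indicator {y. p y = z} x *\<^sub>R f x = 0"
    by (rule AE_mp) (auto simp: indicator_def)
  then have "(LINT y|M. indicator {y. p y = z} y *\<^sub>R f y) = 0"
    by (subst integral_cong_AE[where g="\<lambda>x. 0"]) auto
  then show ?thesis using True by simp
qed (simp add: scaleR_conv_of_real)

text \<open>On each cell the average is the constant closest to \<open>f\<close> in \<open>L\<^sup>2\<close>; summing the orthogonal
decompositions over the cells gives the global one.\<close>

lemma cell_avg_pythagoras:
  assumes [measurable]: "f \<in> borel_measurable M" and f: "integrable M (\<lambda>x. (cmod (f x))\<^sup>2)"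
  shows "(\<integral>\<^sup>+x. sq (f x) \<partial>M) =
    (\<integral>\<^sup>+x. sq (cell_avg M p f x) \<partial>M)
    + (\<integral>\<^sup>+x. sq (f x - cell_avg M p f x) \<partial>M)"
proof -
  have "(\<integral>\<^sup>+x. sq (f x) \<partial>M)
    = (\<integral>\<^sup>+x. ennreal ((cmod (cell_avg M p f x))\<^sup>2 + (cmod (f x - cell_avg M p f x))\<^sup>2) \<partial>M)"
  proof (rule nn_integral_cong_cells)
    fix z
    define I where "I = (LINT y|M. indicator {y. p y = z} y *\<^sub>R f y)"
    define m where "m = measure M {y \<in> space M. p y = z}"
    define c where "c = I / of_real m"
    have em: "emeasure M {y \<in> space M. p y = z} = ennreal m"
      unfolding m_def using cell_finite[of z] by (intro emeasure_eq_ennreal_measure) auto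
    have [measurable]: "Measurable.pred M (\<lambda>y. p y = z)" by measurable
    have c: "cell_avg M p f x = c" if "p x = z" for x
      using that by (simp add: cell_avg_def c_def I_def m_def)
    have i1: "integrable M (\<lambda>y. indicator {y. p y = z} y *\<^sub>R f y)"
      and i2: "integrable M (\<lambda>y. indicator {y. p y = z} y :: real)"
      using square_integrable_cell[OF assms] by auto
    have i3: "integrable M (\<lambda>y. indicator {y. p y = z} y * (cmod (f y))\<^sup>2)"
      by (rule Bochner_Integration.integrable_bound[OF f]) (auto simp: indicator_def)
    have i4: "integrable M (\<lambda>y. Re (cnj c * (indicator {y. p y = z} y *\<^sub>R f y)))"
      using i1 by (intro integrable_Re integrable_mult_right)
    have mi: "(LINT y|M. indicator {y. p y = z} y) = m"
    proof -
      have "(LINT y|M. indicator {y. p y = z} y) = (LINT y|M. indicator {y \<in> space M. p y = z} y :: real)"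
        by (intro Bochner_Integration.integral_cong) (auto simp: indicator_def)
      then show ?thesis by (simp add: m_def)
    qed
    have mc: "m *\<^sub>R c = I"
      using measure_scaleR_avg[OF assms] by (simp add: m_def c_def I_def)
    have rc: "Re (cnj c * I) = m * (cmod c)\<^sup>2"
      unfolding mc[symmetric] cmod_power2 by (simp add: algebra_simps power2_eq_square)
    have ri: "(LINT y|M. Re (cnj c * (indicator {y. p y = z} y *\<^sub>R f y))) = Re (cnj c * I)"
    proof -
      have "(LINT y|M. Re (cnj c * (indicator {y. p y = z} y *\<^sub>R f y)))
          = Re (LINT y|M. cnj c * (indicator {y. p y = z} y *\<^sub>R f y))"
        by (rule integral_Re) (intro integrable_mult_right i1)
      also have "\<dots> = Re (cnj c * I)" unfolding I_def by (simp only: integral_mult_right_zero)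
      finally show ?thesis .
    qed
    have pw: "indicator {y. p y = z} y * ((cmod c)\<^sup>2 + (cmod (f y - c))\<^sup>2)
      = 2 * (cmod c)\<^sup>2 * indicator {y. p y = z} y + indicator {y. p y = z} y * (cmod (f y))\<^sup>2
        - 2 * Re (cnj c * (indicator {y. p y = z} y *\<^sub>R f y))" for y
      unfolding cmod_power2 by (auto simp: indicator_def power2_eq_square algebra_simps)
    have i5: "integrable M (\<lambda>y. indicator {y. p y = z} y * ((cmod c)\<^sup>2 + (cmod (f y - c))\<^sup>2))"
      unfolding pw
      by (intro Bochner_Integration.integrable_diff Bochner_Integration.integrable_add integrable_mult_right i2 i3 i4)
    have "(LINT y|M. indicator {y. p y = z} y * ((cmod c)\<^sup>2 + (cmod (f y - c))\<^sup>2))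
      = 2 * (cmod c)\<^sup>2 * m + (LINT y|M. indicator {y. p y = z} y * (cmod (f y))\<^sup>2) - 2 * Re (cnj c * I)"
      unfolding pw
      by (simp only: Bochner_Integration.integral_diff Bochner_Integration.integral_add
          Bochner_Integration.integrable_add integrable_mult_right i2 i3 i4
          integral_mult_right_zero mi ri)
    then have eq: "(LINT y|M. indicator {y. p y = z} y * ((cmod c)\<^sup>2 + (cmod (f y - c))\<^sup>2))
      = (LINT y|M. indicator {y. p y = z} y * (cmod (f y))\<^sup>2)"
      unfolding rc by (simp add: algebra_simps)
    have "(\<integral>\<^sup>+x. sq (f x) * indicator {x. p x = z} x \<partial>M)
      = (\<integral>\<^sup>+y. ennreal (indicator {y. p y = z} y * (cmod (f y))\<^sup>2) \<partial>M)"
      by (intro nn_integral_cong) (auto simp: indicator_def)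
    also have "\<dots> = ennreal (LINT y|M. indicator {y. p y = z} y * (cmod (f y))\<^sup>2)"
      by (rule nn_integral_eq_integral[OF i3]) auto
    also have "\<dots> = (\<integral>\<^sup>+y. ennreal (indicator {y. p y = z} y * ((cmod c)\<^sup>2 + (cmod (f y - c))\<^sup>2)) \<partial>M)"
      unfolding eq[symmetric] by (rule nn_integral_eq_integral[OF i5, symmetric]) auto
    also have "\<dots> = (\<integral>\<^sup>+x. ennreal ((cmod (cell_avg M p f x))\<^sup>2 + (cmod (f x - cell_avg M p f x))\<^sup>2)
        * indicator {x. p x = z} x \<partial>M)"
      by (intro nn_integral_cong) (auto simp: indicator_def c)
    finally show "(\<integral>\<^sup>+x. sq (f x) * indicator {x. p x = z} x \<partial>M)
      = (\<integral>\<^sup>+x. ennreal ((cmod (cell_avg M p f x))\<^sup>2 + (cmod (f x - cell_avg M p f x))\<^sup>2)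
        * indicator {x. p x = z} x \<partial>M)" .
  qed measurable
  also have "\<dots> = (\<integral>\<^sup>+x. sq (cell_avg M p f x) + sq (f x - cell_avg M p f x) \<partial>M)"
    by simp
  also have "\<dots> = (\<integral>\<^sup>+x. sq (cell_avg M p f x) \<partial>M)
    + (\<integral>\<^sup>+x. sq (f x - cell_avg M p f x) \<partial>M)"
    by (rule nn_integral_add) measurable
  finally show ?thesis .
qed

lemma integrable_cell_avg:
  assumes [measurable]: "f \<in> borel_measurable M" and f: "integrable M (\<lambda>x. (cmod (f x))\<^sup>2)"
  shows "integrable M (\<lambda>x. (cmod (cell_avg M p f x))\<^sup>2)"
proof (rule integrableI_nonneg)
  have "(\<integral>\<^sup>+x. sq (cell_avg M p f x) \<partial>M) \<le> (\<integral>\<^sup>+x. sq (f x) \<partial>M)"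
    using cell_avg_pythagoras[OF assms] by simp
  also have "\<dots> < \<infinity>" using f by (auto simp: nn_integral_eq_integral)
  finally show "(\<integral>\<^sup>+x. sq (cell_avg M p f x) \<partial>M) < \<infinity>" .
qed auto

lemma integral_cell_avg_cell:
  assumes "f \<in> borel_measurable M" and "integrable M (\<lambda>x. (cmod (f x))\<^sup>2)"
  shows "(LINT y|M. indicator {y. p y = z} y *\<^sub>R cell_avg M p f y)
    = (LINT y|M. indicator {y. p y = z} y *\<^sub>R f y)"
proof -
  define c where "c = (LINT y|M. indicator {y. p y = z} y *\<^sub>R f y)
      / complex_of_real (measure M {y \<in> space M. p y = z})"
  have "(LINT y|M. indicator {y. p y = z} y *\<^sub>R cell_avg M p f y)
    = (LINT y|M. indicator {y \<in> space M. p y = z} y *\<^sub>R c)"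
    by (intro Bochner_Integration.integral_cong) (auto simp: indicator_def cell_avg_def c_def)
  also have "\<dots> = measure M {y \<in> space M. p y = z} *\<^sub>R c"
  proof -
    have "integrable M (indicator {y \<in> space M. p y = z} :: _ \<Rightarrow> real)"
      using cell_finite[of z] by (intro integrable_real_indicator) auto
    then show ?thesis by simp
  qed
  also have "\<dots> = (LINT y|M. indicator {y. p y = z} y *\<^sub>R f y)"
    unfolding c_def by (rule measure_scaleR_avg[OF assms])
  finally show ?thesis .
qed

lemma integral_eq_0_of_cells:
  assumes f: "integrable M (f :: 'a \<Rightarrow> complex)"
    and 0: "\<And>z. (LINT y|M. indicator {y. p y = z} y *\<^sub>R f y) = 0"
  shows "(LINT y|M. f y) = 0"
proof -
  define B where "B n = {y \<in> space M. to_nat (p y) = n}" for n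
  have [measurable]: "B n \<in> sets M" for n unfolding B_def by measurable
  have U: "(\<Union>n. B n) = space M" by (auto simp: B_def)
  have "set_integrable M (\<Union>n. B n) f"
    unfolding set_integrable_def U
    by (rule Bochner_Integration.integrable_cong[THEN iffD1, OF refl _ f]) auto
  then have "(LINT y:(\<Union>n. B n)|M. f y) = (\<Sum>n. (LINT y:B n|M. f y))"
    by (intro lebesgue_integral_countable_add) (auto simp: B_def)
  moreover have "(LINT y:B n|M. f y) = 0" for n
  proof (cases "B n = {}")
    case False
    then obtain y0 where y0: "y0 \<in> B n" by auto
    then have "B n = {y \<in> space M. p y = p y0}" by (auto simp: B_def)
    then have "(LINT y:B n|M. f y) = (LINT y|M. indicator {y. p y = p y0} y *\<^sub>R f y)"
      unfolding set_lebesgue_integral_def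
      by (intro Bochner_Integration.integral_cong) (auto simp: indicator_def)
    then show ?thesis by (simp add: 0)
  qed (simp add: set_lebesgue_integral_def)
  ultimately have "(LINT y:(\<Union>n. B n)|M. f y) = 0" by simp
  moreover have "(LINT y:(\<Union>n. B n)|M. f y) = (LINT y|M. f y)"
    unfolding set_lebesgue_integral_def U by (intro Bochner_Integration.integral_cong) auto
  ultimately show ?thesis by simp
qed

text \<open>A set of finite measure that is a union of cells, for instance a cell of a coarser partition, does
not notice the averaging. This yields both the tower property and the vanishing means of martingale
differences.\<close>

lemma integral_cell_avg_saturated:
  assumes [measurable]: "f \<in> borel_measurable M" and f: "integrable M (\<lambda>x. (cmod (f x))\<^sup>2)"
    and [measurable]: "Measurable.pred M (\<lambda>x. x \<in> Q)" and fin: "emeasure M {x \<in> space M. x \<in> Q} < \<infinity>"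
    and sat: "\<And>x y. p x = p y \<Longrightarrow> x \<in> Q \<longleftrightarrow> y \<in> Q"
  shows "(LINT y|M. indicator Q y *\<^sub>R cell_avg M p f y) = (LINT y|M. indicator Q y *\<^sub>R f y)"
proof -
  have int: "integrable M (\<lambda>y. indicator Q y *\<^sub>R g y)"
    if [measurable]: "g \<in> borel_measurable M" and g: "integrable M (\<lambda>x. (cmod (g x))\<^sup>2)" for g :: "'a \<Rightarrow> complex"
  proof -
    have 1: "integrable M (indicator {x \<in> space M. x \<in> Q} :: _ \<Rightarrow> real)"
      using fin by (intro integrable_real_indicator) auto
    show ?thesis
      by (rule Bochner_Integration.integrable_bound[OF Bochner_Integration.integrable_add[OF 1 g]])
        (auto simp: indicator_def le_one_plus_square)
  qed
  note i1 = int[OF cell_avg_measurable integrable_cell_avg[OF assms(1,2)]]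
  note i2 = int[OF assms(1,2)]
  have "(LINT y|M. indicator Q y *\<^sub>R cell_avg M p f y - indicator Q y *\<^sub>R f y) = 0"
  proof (rule integral_eq_0_of_cells)
    fix z
    let ?J = "indicator {y. p y = z} :: 'a \<Rightarrow> real"
    have split: "(LINT y|M. ?J y *\<^sub>R (cell_avg M p f y - f y)) = 0"
      using square_integrable_cell(1)[OF cell_avg_measurable integrable_cell_avg[OF assms(1,2)], of z]
        square_integrable_cell(1)[OF assms(1,2), of z] integral_cell_avg_cell[OF assms(1,2), of z]
      by (simp add: scaleR_diff_right)
    consider "\<And>y. p y = z \<Longrightarrow> y \<in> Q" | "\<And>y. p y = z \<Longrightarrow> y \<notin> Q"
      using sat by metis
    then show "(LINT y|M. ?J y *\<^sub>R (indicator Q y *\<^sub>R cell_avg M p f y - indicator Q y *\<^sub>R f y)) = 0"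
    proof cases
      case 1
      then have eq: "?J y *\<^sub>R (indicator Q y *\<^sub>R cell_avg M p f y - indicator Q y *\<^sub>R f y)
        = ?J y *\<^sub>R (cell_avg M p f y - f y)" for y by (auto simp: indicator_def)
      show ?thesis unfolding eq by (rule split)
    next
      case 2
      then have eq: "?J y *\<^sub>R (indicator Q y *\<^sub>R cell_avg M p f y - indicator Q y *\<^sub>R f y) = 0" for y
        by (auto simp: indicator_def)
      show ?thesis unfolding eq by simp
    qed
  qed (intro Bochner_Integration.integrable_diff i1 i2)
  then show ?thesis using i1 i2 by simp
qed

end

section \<open>The Carleson embedding theorem\<close>

text \<open>The function \<open>e\<^sup>2 / (1 + \<beta>)\<close> of \<open>(e, \<beta>)\<close> is convex, and \<open>2 s e - s\<^sup>2 (1 + \<beta>)\<close> is its linearization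
along the ray \<open>e = s (1 + \<beta>)\<close>. With \<open>s\<close> free until after integration this serves as the
Cauchy--Schwarz inequality, without square roots.\<close>

lemma ennreal_tangent_line_bound:
  fixes e \<beta> :: ennreal
  assumes "\<beta> < \<infinity>" and s: "s \<ge> 0"
  shows "ennreal (2 * s) * e \<le> e\<^sup>2 / (1 + \<beta>) + ennreal (s\<^sup>2) * (1 + \<beta>)"
proof -
  obtain b where b: "b \<ge> 0" "\<beta> = ennreal b" using assms(1) by (cases \<beta>) auto
  have b1: "1 + \<beta> = ennreal (1 + b)" using b ennreal_plus[of 1 b] by simp
  show ?thesis
  proof (cases e)
    case (real r)
    have "2 * s * r \<le> r\<^sup>2 / (1 + b) + s\<^sup>2 * (1 + b)"
    proof -
      have "0 \<le> (r - s * (1 + b))\<^sup>2 / (1 + b)" using b by simp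
      also have "\<dots> = r\<^sup>2 / (1 + b) + s\<^sup>2 * (1 + b) - 2 * s * r"
        using b by (simp add: field_simps power2_eq_square)
      finally show ?thesis by simp
    qed
    then have "ennreal (2 * s * r) \<le> ennreal (r\<^sup>2 / (1 + b) + s\<^sup>2 * (1 + b))" by (rule ennreal_leI)
    moreover have "ennreal (2 * s * r) = ennreal (2 * s) * e" using real s by (simp add: ennreal_mult)
    moreover have "ennreal (r\<^sup>2 / (1 + b) + s\<^sup>2 * (1 + b)) = e\<^sup>2 / (1 + \<beta>) + ennreal (s\<^sup>2) * (1 + \<beta>)"
      unfolding b1 using real s b
      by (subst ennreal_plus) (simp_all add: ennreal_power divide_ennreal ennreal_mult del: ennreal_plus)
    ultimately show ?thesis by simp
  next
    case top
    then show ?thesis unfolding b1 by (simp add: ennreal_top_divide power2_eq_square ennreal_mult_top)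
  qed
qed

text \<open>The one-step inequality of the Bellman function \<open>F\<^sup>2 / (m + A)\<close> on a cell of mass \<open>m\<close>, where \<open>F\<close> is the
integral of the function, \<open>a\<close> the Carleson coefficient of the cell and \<open>A'\<close> the total coefficient of
its descendants. Optimizing the hypothesis in \<open>s\<close> gives \<open>U \<ge> F\<^sup>2 / (m + A')\<close>, and passing from
\<open>A'\<close> to \<open>a + A'\<close> costs at least \<open>a F\<^sup>2 / (4 m\<^sup>2)\<close> because both denominators are at most \<open>2 m\<close>.\<close>

lemma bellman_cell_inequality:
  fixes m F a A' :: real and U :: ennreal
  assumes m: "m > 0" and F: "F \<ge> 0" and a: "a \<ge> 0" and A': "A' \<ge> 0" and aA: "a + A' \<le> m"
    and hyp: "\<And>s. s \<ge> 0 \<Longrightarrow> ennreal (2 * s * F) \<le> U + ennreal (s\<^sup>2 * (m + A'))"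
  shows "ennreal (a * (F / m)\<^sup>2 + 4 * (m * ((F / m)\<^sup>2 / (1 + (a + A') / m)))) \<le> 4 * U"
proof (cases U)
  case (real u)
  \<comment> \<open>the maximizer of \<open>2 s F - s\<^sup>2 (m + A')\<close>\<close>
  define s where "s = F / (m + A')"
  have mA: "m + A' > 0" using m A' by simp
  have s: "s \<ge> 0" using F mA by (simp add: s_def)
  have "ennreal (2 * s * F) \<le> ennreal (u + s\<^sup>2 * (m + A'))"
    using hyp[OF s] real mA by (simp add: ennreal_plus)
  then have "2 * s * F \<le> u + s\<^sup>2 * (m + A')"
    using real mA by (subst (asm) ennreal_le_iff) auto
  moreover have "2 * s * F = 2 * (F\<^sup>2 / (m + A'))" "s\<^sup>2 * (m + A') = F\<^sup>2 / (m + A')"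
  proof -
    have "2 * (F / x) * F = 2 * (F\<^sup>2 / x)" "(F / x)\<^sup>2 * x = F\<^sup>2 / x" if "x > 0" for x
      using that by (simp_all add: power2_eq_square)
    then show "2 * s * F = 2 * (F\<^sup>2 / (m + A'))" "s\<^sup>2 * (m + A') = F\<^sup>2 / (m + A')"
      using mA unfolding s_def by blast+
  qed
  ultimately have u: "F\<^sup>2 / (m + A') \<le> u" by simp
  have e: "m * ((F / m)\<^sup>2 / (1 + (a + A') / m)) = F\<^sup>2 / (m + A' + a)"
  proof -
    have "1 + (a + A') / m = (m + A' + a) / m" using m by (simp add: field_simps)
    moreover have "m * ((F / m)\<^sup>2 / (Y / m)) = F\<^sup>2 / Y" for Y using m by (simp add: power2_eq_square)
    ultimately show ?thesis by simp
  qed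
  have "a * (F / m)\<^sup>2 \<le> 4 * a * F\<^sup>2 / ((m + A') * (m + A' + a))"
  proof -
    have "(m + A') * (m + A' + a) \<le> (2 * m) * (2 * m)"
      using assms by (intro mult_mono) auto
    then have "4 * a * F\<^sup>2 / ((2 * m) * (2 * m)) \<le> 4 * a * F\<^sup>2 / ((m + A') * (m + A' + a))"
      using m a A' by (intro divide_left_mono mult_pos_pos mult_nonneg_nonneg) auto
    then show ?thesis using m by (simp add: power2_eq_square field_simps)
  qed
  also have "\<dots> = 4 * (F\<^sup>2 / (m + A')) - 4 * (F\<^sup>2 / (m + A' + a))"
  proof -
    have "m + A' + a > 0" using mA a by simp
    then show ?thesis using mA by (simp add: divide_simps) (simp add: algebra_simps)
  qed
  finally have "a * (F / m)\<^sup>2 + 4 * (m * ((F / m)\<^sup>2 / (1 + (a + A') / m))) \<le> 4 * u"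
    unfolding e using u by simp
  then show ?thesis using real ennreal_leI[of _ "4 * u"] by (simp add: ennreal_mult)
qed simp

text \<open>The functions \<open>u i\<close> in the proof are the densities of the Bellman function
\<open>F\<^sup>2 / (m + A)\<close> on the cells of generation \<open>i\<close>. By the one-step inequality the integral of
\<open>4 * u i\<close> increases with \<open>i\<close>, by at least the contribution of generation \<open>i\<close> to the left-hand
side, and after the last generation it is the right-hand side.\<close>

lemma carleson_embedding:
  fixes p :: "nat \<Rightarrow> 'a \<Rightarrow> 'i::countable" and h :: "nat \<Rightarrow> 'a \<Rightarrow> ennreal"
    and \<phi> :: "'a \<Rightarrow> ennreal"
  assumes part: "\<And>i. i \<le> N \<Longrightarrow> countable_partition M (p i)"
    and refine: "\<And>i x y. i < N \<Longrightarrow> p (Suc i) x = p (Suc i) y \<Longrightarrow> p i x = p i y"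
    and h [measurable]: "\<And>i. h i \<in> borel_measurable M"
    and \<phi> [measurable]: "\<phi> \<in> borel_measurable M"
    and pack: "\<And>i z. i \<le> N \<Longrightarrow>
      (\<integral>\<^sup>+x. (\<Sum>k=i..N. h k x) * indicator {x. p i x = z} x \<partial>M) \<le> emeasure M {x \<in> space M. p i x = z}"
    and fin: "(\<integral>\<^sup>+x. (\<phi> x)\<^sup>2 \<partial>M) < \<infinity>"
  shows "(\<Sum>k\<le>N. \<integral>\<^sup>+x. h k x * (nn_cell_avg M (p k) \<phi> x)\<^sup>2 \<partial>M) \<le> 4 * (\<integral>\<^sup>+x. (\<phi> x)\<^sup>2 \<partial>M)"
proof -
  define H where "H i x = (\<Sum>k=i..N. h k x)" for i x
  define e where "e i = nn_cell_avg M (p i) \<phi>" for i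
  define al where "al i = nn_cell_avg M (p i) (H i)" for i
  define u where "u i x = (if i \<le> N then (e i x)\<^sup>2 / (1 + al i x) else (\<phi> x)\<^sup>2)" for i x
  have H [measurable]: "H i \<in> borel_measurable M" for i unfolding H_def[abs_def] by measurable
  have em [measurable]: "e i \<in> borel_measurable M" if "i \<le> N" for i
    unfolding e_def by (rule countable_partition.nn_cell_avg_measurable[OF part[OF that]])
  have alm [measurable]: "al i \<in> borel_measurable M" if "i \<le> N" for i
    unfolding al_def by (rule countable_partition.nn_cell_avg_measurable[OF part[OF that]])
  have um: "u i \<in> borel_measurable M" for i
    using em[of i] alm[of i] unfolding u_def[abs_def] by (cases "i \<le> N") auto
  have self_le: "x / x \<le> 1" for x :: ennreal
    by (cases "x = 0 \<or> x = top") (auto simp: ennreal_divide_self less_top)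
  have al1: "al i x \<le> 1" if "i \<le> N" for i x
    unfolding al_def nn_cell_avg_def H_def
    by (rule order_trans[OF divide_right_mono_ennreal[OF pack[OF that]]]) (rule self_le)
  have level_step: "(\<integral>\<^sup>+x. h i x * (e i x)\<^sup>2 \<partial>M) + 4 * (\<integral>\<^sup>+x. u i x \<partial>M) \<le> 4 * (\<integral>\<^sup>+x. u (Suc i) x \<partial>M)"
    if i: "i \<le> N" for i
  proof -
    interpret countable_partition M "p i" by (rule part[OF i])
    note [measurable] = em[OF i] alm[OF i] um
    have "(\<integral>\<^sup>+x. h i x * (e i x)\<^sup>2 + 4 * u i x \<partial>M) \<le> (\<integral>\<^sup>+x. 4 * u (Suc i) x \<partial>M)"
    proof (rule nn_integral_mono_cells)
      fix z
      let ?I = "indicator {x. p i x = z} :: 'a \<Rightarrow> ennreal"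
      show "(\<integral>\<^sup>+x. (h i x * (e i x)\<^sup>2 + 4 * u i x) * ?I x \<partial>M) \<le> (\<integral>\<^sup>+x. 4 * u (Suc i) x * ?I x \<partial>M)"
      proof (cases "emeasure M {x \<in> space M. p i x = z} = 0")
        case True
        then show ?thesis by (subst nn_integral_null_cell) auto
      next
        case False
        have Im [measurable]: "?I \<in> borel_measurable M" by measurable
        define m where "m = measure M {x \<in> space M. p i x = z}"
        have emm: "emeasure M {x \<in> space M. p i x = z} = ennreal m"
          unfolding m_def using cell_finite[of z] by (intro emeasure_eq_ennreal_measure) auto
        with False have m: "m > 0" by (simp add: m_def zero_less_measure_iff)
        have "(\<integral>\<^sup>+x. \<phi> x * ?I x \<partial>M) \<le> (\<integral>\<^sup>+x. 1 * ?I x + (\<phi> x)\<^sup>2 \<partial>M)"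
        proof (rule nn_integral_mono)
          fix x
          have "\<phi> x \<le> 1 + (\<phi> x)\<^sup>2"
          proof (cases "\<phi> x")
            case (real r)
            then show ?thesis
              using ennreal_leI[OF le_one_plus_square[of r]] by (simp add: ennreal_power)
          qed (simp add: power2_eq_square ennreal_mult_top)
          then show "\<phi> x * ?I x \<le> 1 * ?I x + (\<phi> x)\<^sup>2" by (auto simp: indicator_def)
        qed
        also have "\<dots> = ennreal m + (\<integral>\<^sup>+x. (\<phi> x)\<^sup>2 \<partial>M)"
          using emm by (subst nn_integral_add) (auto simp only: nn_integral_const_cell, auto)
        also have "\<dots> < \<infinity>" using fin by simp
        finally obtain F where F: "F \<ge> 0" "(\<integral>\<^sup>+x. \<phi> x * ?I x \<partial>M) = ennreal F"
          by (cases "\<integral>\<^sup>+x. \<phi> x * ?I x \<partial>M") auto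
        have split: "(\<integral>\<^sup>+x. H i x * ?I x \<partial>M) = (\<integral>\<^sup>+x. h i x * ?I x \<partial>M) + (\<integral>\<^sup>+x. H (Suc i) x * ?I x \<partial>M)"
          unfolding H_def using i by (subst nn_integral_add[symmetric])
            (auto simp: sum.atLeast_Suc_atMost[of i N] distrib_right)
        have le: "(\<integral>\<^sup>+x. H i x * ?I x \<partial>M) \<le> ennreal m"
          using pack[OF i, of z] unfolding H_def emm .
        obtain a where a: "a \<ge> 0" "(\<integral>\<^sup>+x. h i x * ?I x \<partial>M) = ennreal a"
          using le unfolding split by (cases "\<integral>\<^sup>+x. h i x * ?I x \<partial>M") (auto simp: top_unique)
        obtain A' where A': "A' \<ge> 0" "(\<integral>\<^sup>+x. H (Suc i) x * ?I x \<partial>M) = ennreal A'"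
          using le unfolding split by (cases "\<integral>\<^sup>+x. H (Suc i) x * ?I x \<partial>M") (auto simp: top_unique)
        have aA: "a + A' \<le> m"
        proof -
          have "ennreal (a + A') \<le> ennreal m" using le a A' by (simp add: split)
          then show ?thesis using m by simp
        qed
        have eQ: "e i x = ennreal (F / m)" if "p i x = z" for x
          using that m F emm by (simp add: e_def nn_cell_avg_def divide_ennreal)
        have alQ: "al i x = ennreal ((a + A') / m)" if "p i x = z" for x
          using that m a A' emm split by (simp add: al_def nn_cell_avg_def divide_ennreal flip: ennreal_plus)
        define c where "c = (F / m)\<^sup>2 / (1 + (a + A') / m)"
        have c0: "c \<ge> 0" using m a A' by (simp add: c_def)
        have uQ: "u i x = ennreal c" if "p i x = z" for x
        proof -
          have "1 + ennreal ((a + A') / m) = ennreal (1 + (a + A') / m)"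
            using a A' m by (subst ennreal_plus) auto
          then show ?thesis
            using i m a A' F eQ[OF that] alQ[OF that]
            by (simp add: u_def c_def ennreal_power divide_ennreal add_pos_nonneg del: ennreal_plus)
        qed
        have hyp: "ennreal (2 * s * F) \<le> (\<integral>\<^sup>+x. u (Suc i) x * ?I x \<partial>M) + ennreal (s\<^sup>2 * (m + A'))"
          if s: "s \<ge> 0" for s
        proof -
          have main: "ennreal (2 * s * F) \<le> (\<integral>\<^sup>+x. u (Suc i) x * ?I x \<partial>M) + ennreal (s\<^sup>2 * (m + A'))"
            if [measurable]: "w \<in> borel_measurable M" "be \<in> borel_measurable M"
              and w: "(\<integral>\<^sup>+x. w x * ?I x \<partial>M) = ennreal F"
              and be: "(\<integral>\<^sup>+x. be x * ?I x \<partial>M) = ennreal A'"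
              and uw: "\<And>x. u (Suc i) x = (w x)\<^sup>2 / (1 + be x)"
              and be1: "\<And>x. be x < \<infinity>"
            for w be :: "'a \<Rightarrow> ennreal"
          proof -
            have "ennreal (2 * s * F) = (\<integral>\<^sup>+x. ennreal (2 * s) * (w x * ?I x) \<partial>M)"
              using s F by (subst nn_integral_cmult) (auto simp: w ennreal_mult)
            also have "\<dots> \<le> (\<integral>\<^sup>+x. u (Suc i) x * ?I x + ennreal (s\<^sup>2) * (1 * ?I x + be x * ?I x) \<partial>M)"
            proof (rule nn_integral_mono)
              fix x
              show "ennreal (2 * s) * (w x * ?I x)
                \<le> u (Suc i) x * ?I x + ennreal (s\<^sup>2) * (1 * ?I x + be x * ?I x)"
                using ennreal_tangent_line_bound[OF be1[of x] s, of "w x"]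
                by (auto simp: indicator_def uw)
            qed
            also have "\<dots> = (\<integral>\<^sup>+x. u (Suc i) x * ?I x \<partial>M)
                + ennreal (s\<^sup>2) * ((\<integral>\<^sup>+x. 1 * ?I x \<partial>M) + (\<integral>\<^sup>+x. be x * ?I x \<partial>M))"
              by (subst nn_integral_add; (subst nn_integral_cmult)?; (subst nn_integral_add)?) auto
            also have "\<dots> = (\<integral>\<^sup>+x. u (Suc i) x * ?I x \<partial>M) + ennreal (s\<^sup>2 * (m + A'))"
              unfolding nn_integral_const_cell be emm using m A'
              by (simp add: ennreal_mult)
            finally show ?thesis .
          qed
          show ?thesis
          proof (cases "i < N")
            case True
            then have i': "Suc i \<le> N" by simp
            note [measurable] = em[OF i'] alm[OF i']
            have W: "(\<integral>\<^sup>+x. nn_cell_avg M (p (Suc i)) g x * ?I x \<partial>M) = (\<integral>\<^sup>+x. g x * ?I x \<partial>M)"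
              if "g \<in> borel_measurable M" for g
              by (rule countable_partition.nn_integral_weighted_avg[OF part[OF i'] that Im])
                (auto simp: indicator_def dest: refine[OF True])
            show ?thesis
            proof (rule main[of "e (Suc i)" "al (Suc i)"])
              show "(\<integral>\<^sup>+x. e (Suc i) x * ?I x \<partial>M) = ennreal F" unfolding e_def W[OF \<phi>] by (rule F(2))
              show "(\<integral>\<^sup>+x. al (Suc i) x * ?I x \<partial>M) = ennreal A'" unfolding al_def W[OF H] by (rule A'(2))
              show "al (Suc i) x < \<infinity>" for x using al1[OF i', of x] by (rule order.strict_trans1) simp
            qed (use i' in \<open>auto simp: u_def\<close>)
          next
            case False
            then have "H (Suc i) x = 0" for x using i by (simp add: H_def)
            then have "A' = 0" using A' by simp
            then show ?thesis
              using False F(2) by (intro main[of \<phi> "\<lambda>x. 0"]) (auto simp: u_def divide_ennreal_def)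
          qed
        qed
        have four: "ennreal (4 * c) = 4 * ennreal c" using c0 by (simp add: ennreal_mult)
        have "(\<integral>\<^sup>+x. (h i x * (e i x)\<^sup>2 + 4 * u i x) * ?I x \<partial>M)
            = (\<integral>\<^sup>+x. ennreal ((F / m)\<^sup>2) * (h i x * ?I x) + ennreal (4 * c) * ?I x \<partial>M)"
          using m F by (intro nn_integral_cong)
            (auto simp: indicator_def eQ uQ ennreal_power four mult.commute[of "h i _"])
        also have "\<dots> = ennreal ((F / m)\<^sup>2) * ennreal a + ennreal (4 * c) * ennreal m"
          by (subst nn_integral_add; (subst nn_integral_cmult)?) (auto simp: a(2) nn_integral_const_cell emm)
        also have "\<dots> = ennreal (a * (F / m)\<^sup>2 + 4 * (m * ((F / m)\<^sup>2 / (1 + (a + A') / m))))"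
          unfolding c_def[symmetric] using m a c0
          by (simp add: ennreal_mult mult.commute mult.left_commute)
        also have "\<dots> \<le> 4 * (\<integral>\<^sup>+x. u (Suc i) x * ?I x \<partial>M)"
          by (rule bellman_cell_inequality[OF m F(1) a(1) A'(1) aA hyp])
        also have "\<dots> = (\<integral>\<^sup>+x. 4 * u (Suc i) x * ?I x \<partial>M)"
          by (subst nn_integral_cmult[symmetric]) (auto simp: mult.assoc)
        finally show ?thesis .
      qed
    qed measurable
    then show ?thesis by (simp add: nn_integral_add nn_integral_cmult)
  qed
  have "(\<Sum>k=i..N. \<integral>\<^sup>+x. h k x * (e k x)\<^sup>2 \<partial>M) + 4 * (\<integral>\<^sup>+x. u i x \<partial>M) \<le> 4 * (\<integral>\<^sup>+x. u (Suc N) x \<partial>M)"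
    if "i \<le> N" for i
    using that
  proof (induction i rule: inc_induct)
    case base
    then show ?case using level_step[of N] by simp
  next
    case (step i)
    have "(\<Sum>k=i..N. \<integral>\<^sup>+x. h k x * (e k x)\<^sup>2 \<partial>M) + 4 * (\<integral>\<^sup>+x. u i x \<partial>M)
      = (\<Sum>k=Suc i..N. \<integral>\<^sup>+x. h k x * (e k x)\<^sup>2 \<partial>M)
        + ((\<integral>\<^sup>+x. h i x * (e i x)\<^sup>2 \<partial>M) + 4 * (\<integral>\<^sup>+x. u i x \<partial>M))"
      using \<open>i < N\<close> by (simp add: sum.atLeast_Suc_atMost[of i N] add.commute add.left_commute)
    also have "\<dots> \<le> (\<Sum>k=Suc i..N. \<integral>\<^sup>+x. h k x * (e k x)\<^sup>2 \<partial>M) + 4 * (\<integral>\<^sup>+x. u (Suc i) x \<partial>M)"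
      using \<open>i < N\<close> by (intro add_left_mono level_step) simp
    also have "\<dots> \<le> 4 * (\<integral>\<^sup>+x. u (Suc N) x \<partial>M)" by (rule step.IH)
    finally show ?case .
  qed
  from this[of 0] have "(\<Sum>k\<le>N. \<integral>\<^sup>+x. h k x * (e k x)\<^sup>2 \<partial>M) + 4 * (\<integral>\<^sup>+x. u 0 x \<partial>M) \<le> 4 * (\<integral>\<^sup>+x. u (Suc N) x \<partial>M)"
    by (simp add: atMost_atLeast0)
  then have "(\<Sum>k\<le>N. \<integral>\<^sup>+x. h k x * (e k x)\<^sup>2 \<partial>M) \<le> 4 * (\<integral>\<^sup>+x. u (Suc N) x \<partial>M)"
    by (rule order_trans[rotated]) simp
  then show ?thesis by (simp add: e_def u_def)
qed

section \<open>A measurable majorant of the kernel\<close>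

lemma infnorm_triangle_sub: "infnorm (x - z) \<le> infnorm (x - y) + infnorm (y - z)"
  using infnorm_triangle[of "x - y" "y - z"] by simp

lemma infnorm_borel_measurable [measurable]: "infnorm \<in> borel_measurable (borel :: 'a::euclidean_space measure)"
  by (intro borel_measurable_continuous_onI continuous_on_infnorm continuous_on_id)

lemma power_powr_swap: "(x::real) > 0 \<Longrightarrow> (x powr a) ^ p = (x ^ p) powr a"
  by (induction p) (auto simp: powr_mult)

lemma ennreal_inverse_antimono: "(a::ennreal) \<le> b \<Longrightarrow> inverse b \<le> inverse a"
proof (cases "a = 0 \<or> b = top")
  case False
  then show "a \<le> b \<Longrightarrow> inverse b \<le> inverse a"
    by (cases a; cases b) (auto simp: inverse_ennreal top_unique intro!: ennreal_leI)
qed auto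

lemma divide_left_mono_ennreal: "(a::ennreal) \<le> b \<Longrightarrow> c / b \<le> c / a"
  unfolding divide_ennreal_def
  by (rule mult_left_mono[OF ennreal_inverse_antimono]) auto

lemma ennreal_le_inverse_of_le:
  assumes "0 < l" "L \<le> ennreal l" "0 \<le> c"
  shows "ennreal (c / l) \<le> ennreal c / L"
proof -
  have "ennreal (c / l) = ennreal c / ennreal l" using assms by (simp add: divide_ennreal)
  also have "\<dots> \<le> ennreal c / L" by (intro divide_left_mono_ennreal assms)
  finally show ?thesis .
qed

locale upper_doubling =
  fixes \<mu> :: "(real ^ 'n) measure" and lam :: "real ^ 'n \<Rightarrow> real \<Rightarrow> real" and \<alpha> C_lam :: real
  assumes borel_measure: "sets \<mu> = sets borel"
    and lam_pos: "\<And>x r. r > 0 \<Longrightarrow> lam x r > 0"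
    and lam_mono: "\<And>x r r'. 0 < r \<Longrightarrow> r \<le> r' \<Longrightarrow> lam x r \<le> lam x r'"
    and lam_doubling: "\<And>x r. r > 0 \<Longrightarrow> lam x (2 * r) \<le> C_lam * lam x r"
    and upper_doubling: "\<And>x r. r > 0 \<Longrightarrow> emeasure \<mu> (linf_ball x r) \<le> ennreal (lam x r)"
    and alpha_pos: "\<alpha> > 0"
begin

lemma space_mu [simp]: "space \<mu> = UNIV"
  using sets_eq_imp_space_eq[OF borel_measure] by simp

lemma measurable_mu1 [measurable_cong, simp]: "sets \<mu> = sets borel" by (rule borel_measure)

lemma sets_linf_ball [measurable]: "linf_ball x r \<in> sets borel"
proof -
  have "linf_ball x r = {y \<in> space borel. infnorm (x - y) < r}" by (simp add: linf_ball_def)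
  also have "\<dots> \<in> sets borel" by measurable
  finally show ?thesis .
qed

lemma emeasure_linf_ball_finite: "emeasure \<mu> (linf_ball x r) < \<infinity>"
proof (cases "r > 0")
  case True
  then show ?thesis using upper_doubling[OF True, of x] by (rule_tac order.strict_trans1) auto
next
  case False
  then have "linf_ball x r = {}"
    using infnorm_pos_le[of "x - y" for y] by (auto simp: linf_ball_def dest: order.strict_trans1)
  then show ?thesis by simp
qed

lemma sigma_finite_mu: "sigma_finite_measure \<mu>"
proof (rule sigma_finite_measure.intro, intro exI[of _ "range (\<lambda>n::nat. linf_ball 0 (real n))"] conjI ballI)
  show "\<Union> (range (\<lambda>n::nat. linf_ball 0 (real n))) = space \<mu>"
  proof (intro set_eqI iffI)
    fix x :: "real ^ 'n"
    obtain n :: nat where "infnorm (0 - x) < real n" using reals_Archimedean2 by auto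
    then show "x \<in> \<Union> (range (\<lambda>n::nat. linf_ball 0 (real n)))" by (auto simp: linf_ball_def)
  qed auto
qed (use emeasure_linf_ball_finite in \<open>auto simp: less_top\<close>)

sublocale mu: sigma_finite_measure \<mu> by (rule sigma_finite_mu)

lemma C_lam_ge_1: "C_lam \<ge> 1"
proof -
  have "lam 0 1 \<le> lam 0 (2 * 1)" by (rule lam_mono) auto
  also have "\<dots> \<le> C_lam * lam 0 1" by (rule lam_doubling) simp
  finally show ?thesis using lam_pos[of 1 0] by simp
qed

text \<open>The smallest function above the measures of balls with doubling constant \<open>C_lam\<close>. It may replace
\<open>lam\<close> in all upper bounds for the kernel, and it is measurable in \<open>x\<close> and comparable at points of
distance at most \<open>r\<close>. Neither is assumed of \<open>lam\<close>, and integration of the kernel in \<open>x\<close> depends on both.\<close>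

definition Lam :: "real ^ 'n \<Rightarrow> real \<Rightarrow> ennreal"
  where "Lam x r = (SUP j. emeasure \<mu> (linf_ball x (2 ^ j * r)) / ennreal (C_lam ^ j))"

lemma emeasure_le_Lam: "emeasure \<mu> (linf_ball x r) \<le> Lam x r"
  unfolding Lam_def by (rule SUP_upper2[of 0]) (auto simp: divide_ennreal_def)

lemma lam_doubling_pow: "r > 0 \<Longrightarrow> lam x (2 ^ j * r) \<le> C_lam ^ j * lam x r"
proof (induction j)
  case (Suc j)
  have "lam x (2 ^ Suc j * r) \<le> C_lam * lam x (2 ^ j * r)"
    using lam_doubling[of "2 ^ j * r" x] Suc by (simp add: mult.assoc)
  also have "\<dots> \<le> C_lam * (C_lam ^ j * lam x r)"
    using Suc C_lam_ge_1 by (intro mult_left_mono) auto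
  finally show ?case by (simp add: mult.assoc)
qed simp

lemma Lam_le_lam: "r > 0 \<Longrightarrow> Lam x r \<le> ennreal (lam x r)"
  unfolding Lam_def
proof (rule SUP_least)
  fix j assume r: "r > 0"
  have C: "C_lam ^ j > 0" using C_lam_ge_1 by simp
  have "emeasure \<mu> (linf_ball x (2 ^ j * r)) \<le> ennreal (lam x (2 ^ j * r))"
    using r by (intro upper_doubling) simp
  also have "\<dots> \<le> ennreal (C_lam ^ j * lam x r)" by (intro ennreal_leI lam_doubling_pow r)
  finally have "emeasure \<mu> (linf_ball x (2 ^ j * r)) / ennreal (C_lam ^ j)
      \<le> ennreal (C_lam ^ j * lam x r) / ennreal (C_lam ^ j)"
    by (rule divide_right_mono_ennreal)
  also have "\<dots> = ennreal (lam x r)"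
    using C lam_pos[OF r, of x] C_lam_ge_1 by (subst divide_ennreal) auto
  finally show "emeasure \<mu> (linf_ball x (2 ^ j * r)) / ennreal (C_lam ^ j) \<le> ennreal (lam x r)" .
qed

lemma Lam_shift:
  assumes "\<And>j. linf_ball x (2 ^ j * r) \<subseteq> linf_ball y (2 ^ Suc j * s)"
  shows "Lam x r \<le> ennreal C_lam * Lam y s"
  unfolding Lam_def
proof (rule SUP_least)
  fix j
  have C: "C_lam > 0" using C_lam_ge_1 by simp
  have "emeasure \<mu> (linf_ball x (2 ^ j * r)) / ennreal (C_lam ^ j)
      \<le> emeasure \<mu> (linf_ball y (2 ^ Suc j * s)) / ennreal (C_lam ^ j)"
    by (intro divide_right_mono_ennreal emeasure_mono assms) auto
  also have "\<dots> = ennreal C_lam * (emeasure \<mu> (linf_ball y (2 ^ Suc j * s)) / ennreal (C_lam ^ Suc j))"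
  proof (cases "emeasure \<mu> (linf_ball y (2 ^ Suc j * s))")
    case (real m)
    then show ?thesis using C by (simp add: divide_ennreal ennreal_mult[symmetric])
  next
    case top
    then show ?thesis using emeasure_linf_ball_finite[of y "2 ^ Suc j * s"] by simp
  qed
  also have "\<dots> \<le> ennreal C_lam * (SUP j. emeasure \<mu> (linf_ball y (2 ^ j * s)) / ennreal (C_lam ^ j))"
    by (intro mult_left_mono SUP_upper) auto
  finally show "emeasure \<mu> (linf_ball x (2 ^ j * r)) / ennreal (C_lam ^ j)
      \<le> ennreal C_lam * (SUP j. emeasure \<mu> (linf_ball y (2 ^ j * s)) / ennreal (C_lam ^ j))" .
qed

lemma Lam_doubling: "Lam x (2 * r) \<le> ennreal C_lam * Lam x r"
  by (rule Lam_shift) (auto simp: linf_ball_def mult.assoc mult.left_commute)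

lemma Lam_move:
  assumes "infnorm (x - y) \<le> r" "r > 0"
  shows "Lam x r \<le> ennreal C_lam * Lam y r"
proof (rule Lam_shift)
  fix j
  show "linf_ball x (2 ^ j * r) \<subseteq> linf_ball y (2 ^ Suc j * r)"
  proof
    fix z assume "z \<in> linf_ball x (2 ^ j * r)"
    then have "infnorm (x - z) < 2 ^ j * r" by (simp add: linf_ball_def)
    moreover have "infnorm (y - x) \<le> 2 ^ j * r"
    proof -
      have "1 * r \<le> 2 ^ j * r" using assms(2) by (intro mult_right_mono) auto
      then show ?thesis using assms(1) by (simp add: infnorm_sub)
    qed
    ultimately show "z \<in> linf_ball y (2 ^ Suc j * r)"
      using infnorm_triangle_sub[of y z x] by (simp add: linf_ball_def)
  qed
qed

lemma Lam_measurable [measurable]: "(\<lambda>x. Lam x r) \<in> borel_measurable borel"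
proof -
  have "(\<lambda>x. emeasure \<mu> (linf_ball x R)) \<in> borel_measurable borel" for R
  proof -
    have "(\<lambda>x. \<integral>\<^sup>+y. (if infnorm (x - y) < R then 1 else 0) \<partial>\<mu>) \<in> borel_measurable borel"
      by measurable
    moreover have "(\<integral>\<^sup>+y. (if infnorm (x - y) < R then 1 else 0) \<partial>\<mu>) = emeasure \<mu> (linf_ball x R)" for x
    proof -
      have "(\<integral>\<^sup>+y. (if infnorm (x - y) < R then 1 else 0) \<partial>\<mu>) = (\<integral>\<^sup>+y. indicator (linf_ball x R) y \<partial>\<mu>)"
        by (intro nn_integral_cong) (auto simp: linf_ball_def indicator_def)
      then show ?thesis by simp
    qed
    ultimately show ?thesis by simp
  qed
  note [measurable] = this
  show ?thesis unfolding Lam_def by measurable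
qed

abbreviation (input) ring_term :: "nat \<Rightarrow> real \<Rightarrow> real ^ 'n \<Rightarrow> real ^ 'n \<Rightarrow> ennreal"
  where "ring_term p t x y \<equiv> (if infnorm (x - y) < 2 ^ Suc p * t then 1 else 0) / Lam x (2 ^ p * t)"

abbreviation (input) gain :: "real \<Rightarrow> real \<Rightarrow> real"
  where "gain t d \<equiv> (2 * t / d) powr (\<alpha> / 2)"

text \<open>The kernel bound \<open>t\<^sup>\<alpha> / kernel_denom\<close>, decomposed over dyadic rings around \<open>x\<close>. Where \<open>Lam\<close>
vanishes the quotient is infinite, but then the ball in the numerator is a null set, so that integrals
of the majorant are not affected.\<close>

definition majorant :: "real \<Rightarrow> real ^ 'n \<Rightarrow> real ^ 'n \<Rightarrow> ennreal"
  where "majorant t x y = (\<Sum>p. ennreal ((2 powr - \<alpha>) ^ p)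
    * (ring_term p t x y))"

lemma majorant_measurable [measurable]: "(\<lambda>(x, y). majorant t x y) \<in> borel_measurable (borel \<Otimes>\<^sub>M borel)"
  unfolding majorant_def by measurable

lemma majorant_ge_term: "ennreal ((2 powr - \<alpha>) ^ p)
    * (ring_term p t x y) \<le> majorant t x y"
  unfolding majorant_def
  using sum_le_suminf[of "\<lambda>p. ennreal ((2 powr - \<alpha>) ^ p)
    * (ring_term p t x y)" "{p}"] by simp

lemma kernel_denom_pos: "t > 0 \<Longrightarrow> kernel_denom lam \<alpha> t x y > 0"
proof -
  assume t: "t > 0"
  have "infnorm (x - y) powr \<alpha> * lam x (infnorm (x - y)) \<ge> 0"
  proof (cases "infnorm (x - y) = 0")
    case False
    then have "infnorm (x - y) > 0" using infnorm_pos_le[of "x - y"] by simp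
    then show ?thesis using lam_pos[of "infnorm (x - y)" x] by simp
  qed simp
  moreover have "t powr \<alpha> * lam x t > 0" using t lam_pos[OF t] by simp
  ultimately show ?thesis unfolding kernel_denom_def by linarith
qed

lemma kernel_le_inverse_lam:
  assumes t: "t > 0"
  shows "t powr \<alpha> / kernel_denom lam \<alpha> t x y \<le> 1 / lam x t"
proof -
  have "infnorm (x - y) powr \<alpha> * lam x (infnorm (x - y)) \<ge> 0"
    using lam_pos[of "infnorm (x - y)" x] infnorm_pos_le[of "x - y"] by (cases "infnorm (x - y) = 0") auto
  then have "t powr \<alpha> * lam x t \<le> kernel_denom lam \<alpha> t x y" by (simp add: kernel_denom_def)
  then have "t powr \<alpha> / kernel_denom lam \<alpha> t x y \<le> t powr \<alpha> / (t powr \<alpha> * lam x t)"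
    using t lam_pos[OF t, of x] kernel_denom_pos[OF t, of x y] by (intro divide_left_mono mult_pos_pos) auto
  then show ?thesis using t by simp
qed

text \<open>Only the ring that contains \<open>y\<close> is used: for \<open>\<bar>x - y\<bar> < t\<close> the first term of the sum, otherwise the
term with \<open>2\<^sup>p t \<le> \<bar>x - y\<bar> < 2\<^bsup>p+1\<^esup> t\<close>.\<close>

lemma kernel_le_majorant:
  assumes t: "t > 0"
  shows "ennreal (t powr \<alpha> / kernel_denom lam \<alpha> t x y) \<le> majorant t x y"
proof -
  define D where "D = infnorm (x - y)"
  have D0: "D \<ge> 0" by (simp add: D_def infnorm_pos_le)
  have main: "ennreal (t powr \<alpha> / kernel_denom lam \<alpha> t x y) \<le> majorant t x y"
    if p: "D < 2 ^ Suc p * t"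
      and dl: "t powr \<alpha> * (2 powr \<alpha>) ^ p * lam x (2 ^ p * t) \<le> kernel_denom lam \<alpha> t x y" for p
  proof -
    have l: "lam x (2 ^ p * t) > 0" using t by (intro lam_pos) simp
    have q: "(2 powr - \<alpha>) ^ p = 1 / (2 powr \<alpha>) ^ p"
      by (simp add: powr_minus_divide power_one_over)
    have "t powr \<alpha> / kernel_denom lam \<alpha> t x y \<le> t powr \<alpha> / (t powr \<alpha> * (2 powr \<alpha>) ^ p * lam x (2 ^ p * t))"
      using t l kernel_denom_pos[OF t] by (intro divide_left_mono dl mult_pos_pos) auto
    also have "\<dots> = (2 powr - \<alpha>) ^ p / lam x (2 ^ p * t)"
      unfolding q using t by simp
    finally have "ennreal (t powr \<alpha> / kernel_denom lam \<alpha> t x y) \<le> ennreal ((2 powr - \<alpha>) ^ p / lam x (2 ^ p * t))"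
      by (rule ennreal_leI)
    also have "\<dots> \<le> ennreal ((2 powr - \<alpha>) ^ p) / Lam x (2 ^ p * t)"
      using t by (intro ennreal_le_inverse_of_le l Lam_le_lam) auto
    also have "\<dots> = ennreal ((2 powr - \<alpha>) ^ p)
        * (ring_term p t x y)"
      using p by (simp add: D_def ennreal_times_divide)
    also have "\<dots> \<le> majorant t x y" by (rule majorant_ge_term)
    finally show ?thesis .
  qed
  show ?thesis
  proof (cases "D < t")
    case True
    have "0 \<le> D powr \<alpha> * lam x D" using lam_pos[of D x] D0 by (cases "D = 0") auto
    then show ?thesis using True t by (intro main[of 0]) (auto simp: kernel_denom_def D_def)
  next
    case False
    then have Dt: "D \<ge> t" by simp
    have "\<exists>n. D < 2 ^ n * t"
    proof -
      obtain n where "D / t < 2 ^ n" using real_arch_pow[of 2 "D / t"] by auto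
      then show ?thesis using t by (auto simp: field_simps)
    qed
    define n where "n = (LEAST n. D < 2 ^ n * t)"
    have n: "D < 2 ^ n * t" unfolding n_def by (rule LeastI_ex) fact
    have "n \<noteq> 0" using n Dt by (auto intro!: gr0I)
    then obtain p where p: "n = Suc p" by (cases n) auto
    have "\<not> D < 2 ^ p * t" using not_less_Least[of p "\<lambda>n. D < 2 ^ n * t"] p n_def by simp
    then have pD: "2 ^ p * t \<le> D" by simp
    show ?thesis
    proof (rule main[of p])
      show "D < 2 ^ Suc p * t" using n p by simp
      have "t powr \<alpha> * (2 powr \<alpha>) ^ p * lam x (2 ^ p * t) = (2 ^ p * t) powr \<alpha> * lam x (2 ^ p * t)"
        using t by (simp add: powr_mult power_powr_swap mult.commute)
      also have "\<dots> \<le> D powr \<alpha> * lam x D"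
        using pD t alpha_pos lam_pos[of "2 ^ p * t" x] by (intro mult_mono powr_mono2 lam_mono) auto
      also have "\<dots> \<le> kernel_denom lam \<alpha> t x y"
        using t lam_pos[OF t, of x] by (simp add: kernel_denom_def D_def)
      finally show "t powr \<alpha> * (2 powr \<alpha>) ^ p * lam x (2 ^ p * t) \<le> kernel_denom lam \<alpha> t x y" .
    qed
  qed
qed

text \<open>The exponent \<open>\<alpha> / 2\<close> in place of \<open>\<alpha>\<close> leaves half of the decay for the truncated kernel.\<close>

definition schur_const :: ennreal where "schur_const = ennreal (C_lam\<^sup>2) * (\<Sum>p. ennreal ((2 powr - (\<alpha> / 2)) ^ p))"

lemma geometric_finite:
  assumes "a > 0" shows "(\<Sum>p. ennreal ((2 powr - a) ^ p)) < \<infinity>"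
proof -
  have "summable (\<lambda>p. (2 powr - a) ^ p)"
    using assms by (intro summable_geometric) (simp add: powr_less_one)
  then show ?thesis by (subst suminf_ennreal2) auto
qed

lemma schur_const_finite: "schur_const < \<infinity>"
proof -
  have "(\<Sum>p. ennreal ((2 powr - (\<alpha> / 2)) ^ p)) < \<infinity>"
    by (rule geometric_finite) (use alpha_pos in simp)
  then show ?thesis
    unfolding schur_const_def infinity_ennreal_def ennreal_mult_less_top by (simp only: ennreal_less_top simp_thms)
qed

lemma ball_over_Lam:
  assumes "emeasure \<mu> (linf_ball y R) \<le> ennreal c * L"
  shows "(\<integral>\<^sup>+x. (if infnorm (y - x) < R then 1 else 0) / L \<partial>\<mu>) \<le> ennreal c"
proof -
  have "(\<integral>\<^sup>+x. (if infnorm (y - x) < R then 1 else 0) / L \<partial>\<mu>)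
      = (\<integral>\<^sup>+x. inverse L * indicator (linf_ball y R) x \<partial>\<mu>)"
    by (intro nn_integral_cong) (auto simp: linf_ball_def divide_ennreal_def)
  also have "\<dots> = emeasure \<mu> (linf_ball y R) / L"
    by (subst nn_integral_cmult_indicator) (auto simp: divide_ennreal_def mult.commute)
  also have "\<dots> \<le> ennreal c * L / L" by (intro divide_right_mono_ennreal assms)
  also have "\<dots> \<le> ennreal c"
  proof (cases "L = 0 \<or> L = top")
    case True then show ?thesis by auto
  next
    case False then show ?thesis by (subst ennreal_mult_divide_eq) auto
  qed
  finally show ?thesis .
qed

text \<open>The common form of the full row integral (\<open>\<phi> = 1\<close>) and of the truncated one: a weight that costs
at most half of the decay of every ring that it meets gives a bounded integral.\<close>

lemma majorant_row_weighted:
  assumes t: "t > 0"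
    and \<phi>: "\<And>y p. infnorm (x - y) < 2 ^ Suc p * t \<Longrightarrow>
      (2 powr - \<alpha>) ^ p * \<phi> y \<le> c * (2 powr - (\<alpha> / 2)) ^ p"
    and c: "c \<ge> 0" and [measurable]: "\<phi> \<in> borel_measurable borel"
  shows "(\<integral>\<^sup>+y. majorant t x y * ennreal (\<phi> y) \<partial>\<mu>) \<le> ennreal c * schur_const"
proof -
  let ?r = "\<lambda>p y. ring_term p t x y"
  let ?q = "\<lambda>p. ennreal ((2 powr - (\<alpha> / 2)) ^ p)"
  have "(\<integral>\<^sup>+y. majorant t x y * ennreal (\<phi> y) \<partial>\<mu>) \<le> (\<integral>\<^sup>+y. (\<Sum>p. ennreal c * (?q p * ?r p y)) \<partial>\<mu>)"
    unfolding majorant_def ennreal_suminf_multc[symmetric]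
  proof (intro nn_integral_mono suminf_le summableI)
    fix y p
    show "ennreal ((2 powr - \<alpha>) ^ p) * ?r p y * ennreal (\<phi> y) \<le> ennreal c * (?q p * ?r p y)"
    proof (cases "infnorm (x - y) < 2 ^ Suc p * t")
      case True
      have "ennreal ((2 powr - \<alpha>) ^ p) * ennreal (\<phi> y) \<le> ennreal c * ?q p"
        using \<phi>[OF True] c by (simp add: ennreal_mult'[symmetric] ennreal_leI)
      then have "ennreal ((2 powr - \<alpha>) ^ p) * ennreal (\<phi> y) * ?r p y \<le> ennreal c * ?q p * ?r p y"
        by (rule mult_right_mono) simp
      then show ?thesis by (simp only: mult_ac)
    qed simp
  qed
  also have "\<dots> = (\<Sum>p. ennreal c * (?q p * (\<integral>\<^sup>+y. ?r p y \<partial>\<mu>)))"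
    by (subst nn_integral_suminf) (auto simp: nn_integral_cmult)
  also have "\<dots> \<le> (\<Sum>p. ennreal c * (?q p * ennreal (C_lam\<^sup>2)))"
  proof (intro suminf_le summableI mult_left_mono ball_over_Lam)
    fix p
    have "emeasure \<mu> (linf_ball x (2 ^ Suc p * t)) \<le> Lam x (2 * (2 ^ p * t))"
      using emeasure_le_Lam[of x "2 ^ Suc p * t"] by (simp add: mult.assoc)
    also have "\<dots> \<le> ennreal C_lam * Lam x (2 ^ p * t)" by (rule Lam_doubling)
    also have "\<dots> \<le> ennreal (C_lam\<^sup>2) * Lam x (2 ^ p * t)"
      using C_lam_ge_1 by (intro mult_right_mono ennreal_leI) (auto simp: power2_eq_square)
    finally show "emeasure \<mu> (linf_ball x (2 ^ Suc p * t)) \<le> ennreal (C_lam\<^sup>2) * Lam x (2 ^ p * t)" .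
  qed auto
  also have "\<dots> = ennreal c * schur_const"
    unfolding schur_const_def by (simp add: ennreal_suminf_cmult ennreal_suminf_multc mult.commute)
  finally show ?thesis .
qed

text \<open>Only rings with \<open>d < 2\<^bsup>p+1\<^esup> t\<close> meet the region of integration; on those, half of the decay
\<open>2\<^bsup>-p\<alpha>\<^esup>\<close> is traded for the power of \<open>t / d\<close>.\<close>

lemma majorant_row_truncated:
  assumes t: "t > 0" and d: "d > 0"
  shows "(\<integral>\<^sup>+y. majorant t x y * (if infnorm (x - y) < d then 0 else 1) \<partial>\<mu>) \<le> ennreal (gain t d) * schur_const"
proof -
  define \<phi> :: "real ^ 'n \<Rightarrow> real" where "\<phi> y = (if infnorm (x - y) < d then 0 else 1)" for y
  have "(\<integral>\<^sup>+y. majorant t x y * ennreal (\<phi> y) \<partial>\<mu>) \<le> ennreal (gain t d) * schur_const"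
  proof (rule majorant_row_weighted[OF t])
    fix y p assume dp: "infnorm (x - y) < 2 ^ Suc p * t"
    show "(2 powr - \<alpha>) ^ p * \<phi> y \<le> gain t d * (2 powr - (\<alpha> / 2)) ^ p"
    proof (cases "infnorm (x - y) < d")
      case False
      then have "d < 2 ^ Suc p * t" using dp by simp
      then have "(1 / 2 ^ p) powr (\<alpha> / 2) \<le> gain t d"
        using d t alpha_pos by (intro powr_mono2) (auto simp: field_simps)
      moreover have "(2 powr - (\<alpha> / 2)) ^ p = (1 / 2 ^ p) powr (\<alpha> / 2)"
        by (simp add: powr_minus_divide power_one_over power_powr_swap powr_divide)
      moreover have "(2 powr - \<alpha>) ^ p = (2 powr - (\<alpha> / 2)) ^ p * (2 powr - (\<alpha> / 2)) ^ p"
        by (simp add: power_mult_distrib[symmetric] powr_add[symmetric])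
      ultimately show ?thesis using False by (simp add: \<phi>_def mult_right_mono)
    qed (simp add: \<phi>_def)
  qed (auto simp: \<phi>_def)
  moreover have "ennreal (\<phi> y) = (if infnorm (x - y) < d then 0 else 1)" for y by (simp add: \<phi>_def)
  ultimately show ?thesis by simp
qed

lemma ring_decay_le: "(2 powr - \<alpha>) ^ p \<le> (2 powr - (\<alpha> / 2)) ^ p"
  using alpha_pos by (intro power_mono) auto

lemma majorant_row: "t > 0 \<Longrightarrow> (\<integral>\<^sup>+y. majorant t x y \<partial>\<mu>) \<le> schur_const"
  using majorant_row_weighted[of t x "\<lambda>_. 1" 1] ring_decay_le by simp

text \<open>Here \<open>Lam x\<close> is exchanged for \<open>Lam y\<close> on each ring, after which the estimate is the one for rows.\<close>

lemma majorant_column: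
  assumes t: "t > 0"
  shows "(\<integral>\<^sup>+x. majorant t x y \<partial>\<mu>) \<le> schur_const"
proof -
  have "(\<integral>\<^sup>+x. majorant t x y \<partial>\<mu>) \<le> (\<integral>\<^sup>+x. (\<Sum>p. ennreal ((2 powr - (\<alpha> / 2)) ^ p)
        * (ennreal (C_lam\<^sup>2) * ((if infnorm (y - x) < 2 ^ Suc p * t then 1 else 0) / Lam y (2 ^ Suc p * t)))) \<partial>\<mu>)"
    unfolding majorant_def
  proof (intro nn_integral_mono suminf_le summableI mult_mono ennreal_leI ring_decay_le)
    fix x p
    show "ring_term p t x y
        \<le> ennreal (C_lam\<^sup>2) * ((if infnorm (y - x) < 2 ^ Suc p * t then 1 else 0) / Lam y (2 ^ Suc p * t))"
    proof (cases "infnorm (x - y) < 2 ^ Suc p * t")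
      case True
      have "Lam y (2 ^ Suc p * t) \<le> ennreal C_lam * Lam x (2 ^ Suc p * t)"
        using True t by (intro Lam_move) (auto simp: infnorm_sub)
      also have "\<dots> \<le> ennreal C_lam * (ennreal C_lam * Lam x (2 ^ p * t))"
        using Lam_doubling[of x "2 ^ p * t"] by (intro mult_left_mono) (auto simp: mult.assoc)
      also have "\<dots> = ennreal (C_lam\<^sup>2) * Lam x (2 ^ p * t)"
        using C_lam_ge_1 by (simp add: power2_eq_square ennreal_mult mult.assoc)
      finally have le: "Lam y (2 ^ Suc p * t) \<le> ennreal (C_lam\<^sup>2) * Lam x (2 ^ p * t)" .
      have C: "C_lam\<^sup>2 > 0" using C_lam_ge_1 by simp
      have "1 / Lam x (2 ^ p * t) = ennreal (C_lam\<^sup>2) * (1 / (ennreal (C_lam\<^sup>2) * Lam x (2 ^ p * t)))"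
      proof (cases "Lam x (2 ^ p * t)")
        case (real l)
        then show ?thesis
          using C by (cases "l = 0") (auto simp: ennreal_mult[symmetric] divide_ennreal ennreal_1[symmetric]
            ennreal_mult_top ennreal_divide_zero simp del: ennreal_1)
      next
        case top
        then show ?thesis using C by (simp add: ennreal_mult_top)
      qed
      also have "\<dots> \<le> ennreal (C_lam\<^sup>2) * (1 / Lam y (2 ^ Suc p * t))"
        by (intro mult_left_mono divide_left_mono_ennreal le) auto
      finally show ?thesis using True by (simp add: infnorm_sub)
    qed simp
  qed auto
  also have "\<dots> = (\<Sum>p. ennreal ((2 powr - (\<alpha> / 2)) ^ p) * (ennreal (C_lam\<^sup>2)
        * (\<integral>\<^sup>+x. (if infnorm (y - x) < 2 ^ Suc p * t then 1 else 0) / Lam y (2 ^ Suc p * t) \<partial>\<mu>)))"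
    by (subst nn_integral_suminf) (auto simp: nn_integral_cmult)
  also have "\<dots> \<le> (\<Sum>p. ennreal ((2 powr - (\<alpha> / 2)) ^ p) * (ennreal (C_lam\<^sup>2) * ennreal 1))"
    by (intro suminf_le summableI mult_left_mono ball_over_Lam) (auto intro!: emeasure_le_Lam)
  also have "\<dots> = schur_const" unfolding schur_const_def by (simp add: ennreal_suminf_multc mult.commute)
  finally show ?thesis .
qed

end

section \<open>Schur estimates for the operators\<close>

lemma weighted_Cauchy_Schwarz:
  assumes [measurable]: "w \<in> borel_measurable M" "a \<in> borel_measurable M"
  shows "(\<integral>\<^sup>+x. w x * a x \<partial>M)\<^sup>2 \<le> (\<integral>\<^sup>+x. w x \<partial>M) * (\<integral>\<^sup>+x. w x * (a x)\<^sup>2 \<partial>M)"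
  using Cauchy_Schwarz_nn_integral[of "\<lambda>x. 1" "density M w" a]
  by (simp add: nn_integral_density del: nn_integral_const)

lemma L2D:
  assumes "f \<in> L2 M"
  shows "f \<in> borel_measurable M" "integrable M (\<lambda>x. (cmod (f x))\<^sup>2)"
  using assms by (auto simp: L2_def)

definition sqnorm :: "'a measure \<Rightarrow> ('a \<Rightarrow> complex) \<Rightarrow> ennreal"
  where "sqnorm M f = (\<integral>\<^sup>+x. sq (f x) \<partial>M)"

lemma sqnorm_eq_L2norm:
  assumes "f \<in> L2 M" shows "sqnorm M f = ennreal ((L2norm M f)\<^sup>2)"
  using L2D[OF assms] by (simp add: sqnorm_def L2norm_def nn_integral_eq_integral)

lemma integrable_bounded_mult_L2:
  fixes k g :: "'a \<Rightarrow> complex"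
  assumes k: "integrable M k" and b: "\<And>x. cmod (k x) \<le> b" and g: "g \<in> L2 M"
  shows "integrable M (\<lambda>x. k x * g x)"
proof (rule Bochner_Integration.integrable_bound)
  note [measurable] = L2D(1)[OF g] borel_measurable_integrable[OF k]
  show "(\<lambda>x. k x * g x) \<in> borel_measurable M" by measurable
  show "integrable M (\<lambda>x. cmod (k x) + b * (cmod (g x))\<^sup>2)"
    using k L2D(2)[OF g] by auto
  have "cmod (k x * g x) \<le> cmod (k x) + b * (cmod (g x))\<^sup>2" for x
  proof -
    have "cmod (k x * g x) \<le> cmod (k x) * (1 + (cmod (g x))\<^sup>2)"
      unfolding norm_mult by (intro mult_left_mono le_one_plus_square) auto
    also have "\<dots> = cmod (k x) + cmod (k x) * (cmod (g x))\<^sup>2" by (simp add: algebra_simps)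
    also have "\<dots> \<le> cmod (k x) + b * (cmod (g x))\<^sup>2"
      by (intro add_left_mono mult_right_mono b) auto
    finally show ?thesis .
  qed
  moreover have "b \<ge> 0" if "x \<in> space M" for x :: 'a using b[of x] norm_ge_zero[of "k x"] by linarith
  ultimately show "AE x in M. norm (k x * g x) \<le> norm (cmod (k x) + b * (cmod (g x))\<^sup>2)"
    by (intro AE_I2) (simp add: abs_of_nonneg)
qed

locale square_function_kernel = upper_doubling \<mu> lam \<alpha> C_lam
  for \<mu> :: "(real ^ 'n) measure" and lam \<alpha> C_lam +
  fixes s :: "real \<Rightarrow> real ^ 'n \<Rightarrow> real ^ 'n \<Rightarrow> complex" and C1 :: real
  assumes kernel_measurable:
      "(\<lambda>(x, y, t). s t x y) \<in> borel_measurable (borel \<Otimes>\<^sub>M borel \<Otimes>\<^sub>M restrict_space borel {0<..})"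
    and kernel_size: "\<And>x y t. t > 0 \<Longrightarrow>
      cmod (s t x y) \<le> C1 * (t powr \<alpha> / kernel_denom lam \<alpha> t x y)"
    and kernel_holder: "\<And>x y z t. t > 0 \<Longrightarrow> infnorm (y - z) < t / 2 \<Longrightarrow>
      cmod (s t x y - s t x z) \<le> C1 * (infnorm (y - z) powr \<alpha> / kernel_denom lam \<alpha> t x y)"
begin

lemma C1_nonneg: "C1 \<ge> 0"
proof -
  have "0 \<le> C1 * (1 powr \<alpha> / kernel_denom lam \<alpha> 1 0 0)"
    using order_trans[OF norm_ge_zero kernel_size[of 1 0 0]] by simp
  moreover have "1 powr \<alpha> / kernel_denom lam \<alpha> 1 0 0 > 0" using kernel_denom_pos[of 1 0 0] by simp
  ultimately show ?thesis by (simp add: zero_le_mult_iff zero_le_divide_iff)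
qed

lemma kernel_joint_measurable:
  "(\<lambda>((t, x), y). s (if t > 0 then t else 1) x y) \<in> borel_measurable ((borel \<Otimes>\<^sub>M borel) \<Otimes>\<^sub>M borel)"
proof -
  have [measurable]: "(\<lambda>t::real. if t > 0 then t else 1) \<in> measurable borel (restrict_space borel {0<..})"
    by (rule measurable_restrict_space2) auto
  have "(\<lambda>z. (snd (fst z), snd z, if fst (fst z) > 0 then fst (fst z) else 1)) \<in> measurable
     ((borel \<Otimes>\<^sub>M borel) \<Otimes>\<^sub>M borel) (borel \<Otimes>\<^sub>M (borel \<Otimes>\<^sub>M restrict_space borel {0::real<..}))"
    by measurable
  from measurable_compose[OF this kernel_measurable] show ?thesis
    by (simp add: case_prod_beta')
qed

lemma kernel_slice_measurable:
  assumes "t > 0" shows "(\<lambda>(x, y). s t x y) \<in> borel_measurable (borel \<Otimes>\<^sub>M borel)"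
proof -
  have "(\<lambda>(x, y). ((t, x), y)) \<in> measurable (borel \<Otimes>\<^sub>M borel) ((borel \<Otimes>\<^sub>M borel) \<Otimes>\<^sub>M borel)"
    by measurable
  from measurable_compose[OF this kernel_joint_measurable] show ?thesis
    using assms by (simp add: case_prod_beta')
qed

lemma kernel_section_measurable:
  assumes "t > 0" shows "s t x \<in> borel_measurable borel"
  using measurable_Pair2[OF kernel_slice_measurable[OF assms], of x] by simp

lemma theta_joint_measurable:
  assumes [measurable]: "g \<in> borel_measurable borel"
  shows "(\<lambda>(t, x). theta \<mu> s (if t > 0 then t else 1) g x) \<in> borel_measurable (borel \<Otimes>\<^sub>M borel)"
proof -
  have "(\<lambda>(tx, y). s (if fst tx > 0 then fst tx else 1) (snd tx) y) \<in> borel_measurable ((borel \<Otimes>\<^sub>M borel) \<Otimes>\<^sub>M \<mu>)"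
    using kernel_joint_measurable by (simp add: case_prod_beta' cong: measurable_cong_sets)
  then have [measurable]: "(\<lambda>(tx, y). s (if fst tx > 0 then fst tx else 1) (snd tx) y * g y)
      \<in> borel_measurable ((borel \<Otimes>\<^sub>M borel) \<Otimes>\<^sub>M \<mu>)"
    by measurable
  have "(\<lambda>tx. LINT y|\<mu>. s (if fst tx > 0 then fst tx else 1) (snd tx) y * g y) \<in> borel_measurable (borel \<Otimes>\<^sub>M borel)"
    by measurable
  then show ?thesis by (simp add: theta_def case_prod_beta')
qed

lemma theta_slice_measurable:
  assumes "g \<in> borel_measurable borel" and t: "t > 0"
  shows "theta \<mu> s t g \<in> borel_measurable borel"
  using measurable_Pair2[OF theta_joint_measurable[OF assms(1)], of t] t by simp

lemma kernel_le_C1_majorant: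
  assumes t: "t > 0"
  shows "ennreal (cmod (s t x y)) \<le> ennreal C1 * majorant t x y"
proof -
  have "ennreal (cmod (s t x y)) \<le> ennreal (C1 * (t powr \<alpha> / kernel_denom lam \<alpha> t x y))"
    by (intro ennreal_leI kernel_size t)
  also have "\<dots> = ennreal C1 * ennreal (t powr \<alpha> / kernel_denom lam \<alpha> t x y)"
    using C1_nonneg kernel_denom_pos[OF t, of x y] by (intro ennreal_mult) auto
  also have "\<dots> \<le> ennreal C1 * majorant t x y" by (intro mult_left_mono kernel_le_majorant t) auto
  finally show ?thesis .
qed

lemma kernel_diff_bounds:
  assumes t: "t > 0" and yz: "infnorm (y - z) < t / 2" "infnorm (y - z) \<le> l"
  shows "ennreal (cmod (s t x y - s t x z)) \<le> ennreal (C1 * (l / t) powr \<alpha>) * majorant t x y"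
    "cmod (s t x y - s t x z) \<le> C1 * (l / t) powr \<alpha> * (1 / lam x t)"
proof -
  have l: "l \<ge> 0" using yz(2) infnorm_pos_le[of "y - z"] by linarith
  have D: "kernel_denom lam \<alpha> t x y > 0" by (rule kernel_denom_pos[OF t])
  have a: "cmod (s t x y - s t x z) \<le> C1 * (l / t) powr \<alpha> * (t powr \<alpha> / kernel_denom lam \<alpha> t x y)"
  proof -
    have "cmod (s t x y - s t x z) \<le> C1 * (infnorm (y - z) powr \<alpha> / kernel_denom lam \<alpha> t x y)"
      by (rule kernel_holder[OF t yz(1)])
    also have "\<dots> \<le> C1 * (l powr \<alpha> / kernel_denom lam \<alpha> t x y)"
      using alpha_pos yz(2) D infnorm_pos_le[of "y - z"]
      by (intro mult_left_mono divide_right_mono powr_mono2 C1_nonneg) auto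
    also have "l powr \<alpha> = (l / t) powr \<alpha> * t powr \<alpha>"
      using t l by (simp add: powr_divide)
    finally show ?thesis by simp
  qed
  then have "ennreal (cmod (s t x y - s t x z))
      \<le> ennreal (C1 * (l / t) powr \<alpha> * (t powr \<alpha> / kernel_denom lam \<alpha> t x y))"
    by (rule ennreal_leI)
  also have "\<dots> = ennreal (C1 * (l / t) powr \<alpha>) * ennreal (t powr \<alpha> / kernel_denom lam \<alpha> t x y)"
    using C1_nonneg D by (intro ennreal_mult) (auto intro: less_imp_le)
  also have "\<dots> \<le> ennreal (C1 * (l / t) powr \<alpha>) * majorant t x y" by (intro mult_left_mono kernel_le_majorant t) auto
  finally show "ennreal (cmod (s t x y - s t x z)) \<le> ennreal (C1 * (l / t) powr \<alpha>) * majorant t x y" .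
  show "cmod (s t x y - s t x z) \<le> C1 * (l / t) powr \<alpha> * (1 / lam x t)"
    by (rule order_trans[OF a]) (intro mult_left_mono kernel_le_inverse_lam t mult_nonneg_nonneg C1_nonneg, auto)
qed

lemma kernel_bounded: "t > 0 \<Longrightarrow> cmod (s t x y) \<le> C1 * (1 / lam x t)"
  by (rule order_trans[OF kernel_size], assumption)
    (intro mult_left_mono kernel_le_inverse_lam C1_nonneg)

lemma majorant_section_measurable [measurable]: "majorant t x \<in> borel_measurable borel"
  using measurable_Pair2[OF majorant_measurable, of x t] by simp

lemma integrable_of_majorant_bound:
  fixes k :: "real ^ 'n \<Rightarrow> complex"
  assumes t: "t > 0" and [measurable]: "k \<in> borel_measurable borel"
    and k: "\<And>y. ennreal (cmod (k y)) \<le> ennreal c * majorant t x y"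
  shows "integrable \<mu> k"
proof (rule integrableI_bounded)
  have "(\<integral>\<^sup>+y. ennreal (cmod (k y)) \<partial>\<mu>) \<le> (\<integral>\<^sup>+y. ennreal c * majorant t x y \<partial>\<mu>)" by (intro nn_integral_mono k)
  also have "\<dots> = ennreal c * (\<integral>\<^sup>+y. majorant t x y \<partial>\<mu>)" by (rule nn_integral_cmult) measurable
  also have "\<dots> \<le> ennreal c * schur_const" by (intro mult_left_mono majorant_row t) auto
  also have "\<dots> < \<infinity>" using schur_const_finite by (simp add: ennreal_mult_less_top)
  finally show "(\<integral>\<^sup>+y. ennreal (norm (k y)) \<partial>\<mu>) < \<infinity>" .
qed measurable

lemma integrable_kernel: "t > 0 \<Longrightarrow> integrable \<mu> (s t x)"
  by (rule integrable_of_majorant_bound) (auto intro: kernel_section_measurable kernel_le_C1_majorant)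

lemma integrable_kernel_L2: "t > 0 \<Longrightarrow> g \<in> L2 \<mu> \<Longrightarrow> integrable \<mu> (\<lambda>y. s t x y * g y)"
  by (rule integrable_bounded_mult_L2[OF integrable_kernel kernel_bounded])

lemma L2_borel: "g \<in> L2 \<mu> \<Longrightarrow> g \<in> borel_measurable borel"
  using L2D(1)[of g \<mu>] by (simp cong: measurable_cong_sets)

lemma Schur_majorant:
  assumes t: "t > 0" and [measurable]: "a \<in> borel_measurable borel"
  shows "(\<integral>\<^sup>+x. (\<integral>\<^sup>+y. majorant t x y * a y \<partial>\<mu>) \<partial>\<mu>) \<le> schur_const * (\<integral>\<^sup>+y. a y \<partial>\<mu>)"
proof -
  interpret PP: pair_sigma_finite \<mu> \<mu> by unfold_locales
  have [measurable]: "(\<lambda>(x, y). majorant t x y) \<in> borel_measurable (\<mu> \<Otimes>\<^sub>M \<mu>)"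
    using majorant_measurable[of t] by (simp cong: measurable_cong_sets)
  have "(\<integral>\<^sup>+x. (\<integral>\<^sup>+y. majorant t x y * a y \<partial>\<mu>) \<partial>\<mu>) = (\<integral>\<^sup>+y. (\<integral>\<^sup>+x. majorant t x y * a y \<partial>\<mu>) \<partial>\<mu>)"
    by (rule PP.Fubini'[symmetric]) measurable
  also have "\<dots> = (\<integral>\<^sup>+y. (\<integral>\<^sup>+x. majorant t x y \<partial>\<mu>) * a y \<partial>\<mu>)"
    by (intro nn_integral_cong nn_integral_multc) measurable
  also have "\<dots> \<le> (\<integral>\<^sup>+y. schur_const * a y \<partial>\<mu>)"
    by (intro nn_integral_mono mult_right_mono majorant_column t) auto
  also have "\<dots> = schur_const * (\<integral>\<^sup>+y. a y \<partial>\<mu>)" by (rule nn_integral_cmult) measurable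
  finally show ?thesis .
qed

lemma smoothing_L2_bound:
  assumes t: "t > 0" and g: "g \<in> L2 \<mu>"
    and pw: "\<And>x. ennreal (cmod (u x)) \<le> \<eta> * (\<integral>\<^sup>+y. majorant t x y * ennreal (cmod (g y)) \<partial>\<mu>)"
  shows "(\<integral>\<^sup>+x. sq (u x) \<partial>\<mu>) \<le> \<eta>\<^sup>2 * schur_const\<^sup>2 * sqnorm \<mu> g"
proof -
  note [measurable] = L2_borel[OF g]
  have [measurable]: "(\<lambda>(x, y). majorant t x y) \<in> borel_measurable (\<mu> \<Otimes>\<^sub>M \<mu>)"
    using majorant_measurable[of t] by (simp cong: measurable_cong_sets)
  have "sq (u x) \<le> \<eta>\<^sup>2 * (schur_const * (\<integral>\<^sup>+y. majorant t x y * sq (g y) \<partial>\<mu>))" for x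
  proof -
    have "sq (u x) = (ennreal (cmod (u x)))\<^sup>2" by (simp add: ennreal_power)
    also have "\<dots> \<le> (\<eta> * (\<integral>\<^sup>+y. majorant t x y * ennreal (cmod (g y)) \<partial>\<mu>))\<^sup>2"
      by (intro power_mono pw) auto
    also have "\<dots> \<le> \<eta>\<^sup>2 * ((\<integral>\<^sup>+y. majorant t x y \<partial>\<mu>) * (\<integral>\<^sup>+y. majorant t x y * (ennreal (cmod (g y)))\<^sup>2 \<partial>\<mu>))"
      unfolding power_mult_distrib by (intro mult_left_mono weighted_Cauchy_Schwarz) auto
    also have "\<dots> \<le> \<eta>\<^sup>2 * (schur_const * (\<integral>\<^sup>+y. majorant t x y * (ennreal (cmod (g y)))\<^sup>2 \<partial>\<mu>))"
      by (intro mult_left_mono mult_right_mono majorant_row t) auto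
    finally show ?thesis by (simp add: ennreal_power)
  qed
  then have "(\<integral>\<^sup>+x. sq (u x) \<partial>\<mu>)
      \<le> (\<integral>\<^sup>+x. \<eta>\<^sup>2 * (schur_const * (\<integral>\<^sup>+y. majorant t x y * sq (g y) \<partial>\<mu>)) \<partial>\<mu>)"
    by (rule nn_integral_mono)
  also have "\<dots> = \<eta>\<^sup>2 * schur_const * (\<integral>\<^sup>+x. (\<integral>\<^sup>+y. majorant t x y * sq (g y) \<partial>\<mu>) \<partial>\<mu>)"
    by (subst nn_integral_cmult nn_integral_cmult, measurable)+ (simp add: mult.assoc)
  also have "\<dots> \<le> \<eta>\<^sup>2 * schur_const * (schur_const * sqnorm \<mu> g)"
    unfolding sqnorm_def by (intro mult_left_mono Schur_majorant t) auto
  finally show ?thesis by (simp add: power2_eq_square mult.assoc mult.left_commute)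
qed

lemma kernel_integral_bound:
  fixes k g :: "real ^ 'n \<Rightarrow> complex"
  assumes i: "integrable \<mu> (\<lambda>y. k y * g y)"
    and [measurable]: "w \<in> borel_measurable borel" "g \<in> borel_measurable borel"
    and k: "\<And>y. g y \<noteq> 0 \<Longrightarrow> ennreal (cmod (k y)) \<le> c * w y"
  shows "ennreal (cmod (LINT y|\<mu>. k y * g y)) \<le> c * (\<integral>\<^sup>+y. w y * ennreal (cmod (g y)) \<partial>\<mu>)"
proof -
  have "ennreal (cmod (LINT y|\<mu>. k y * g y)) \<le> (\<integral>\<^sup>+y. ennreal (cmod (k y * g y)) \<partial>\<mu>)"
    by (rule integral_norm_bound_ennreal[OF i])
  also have "\<dots> \<le> (\<integral>\<^sup>+y. c * (w y * ennreal (cmod (g y))) \<partial>\<mu>)"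
  proof (rule nn_integral_mono)
    fix y
    show "ennreal (cmod (k y * g y)) \<le> c * (w y * ennreal (cmod (g y)))"
      unfolding norm_mult mult.assoc[symmetric]
      by (cases "g y = 0") (auto simp: ennreal_mult intro!: mult_right_mono k)
  qed
  also have "\<dots> = c * (\<integral>\<^sup>+y. w y * ennreal (cmod (g y)) \<partial>\<mu>)"
    by (rule nn_integral_cmult) measurable
  finally show ?thesis .
qed

lemma theta_pointwise:
  assumes t: "t > 0" and g: "g \<in> L2 \<mu>"
  shows "ennreal (cmod (theta \<mu> s t g x)) \<le> ennreal C1 * (\<integral>\<^sup>+y. majorant t x y * ennreal (cmod (g y)) \<partial>\<mu>)"
  unfolding theta_def
  by (rule kernel_integral_bound[OF integrable_kernel_L2[OF t g] majorant_section_measurable L2_borel[OF g] kernel_le_C1_majorant[OF t]])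

text \<open>Since \<open>g\<close> has mean zero on each cell, the kernel may be diminished by its value at a point of the
cell of \<open>y\<close>; the difference is controlled by the regularity of the kernel.\<close>

lemma theta_mean_zero_pointwise:
  fixes p :: "real ^ 'n \<Rightarrow> 'i::countable"
  assumes t: "t > 0" and g: "g \<in> L2 \<mu>" and p: "countable_partition \<mu> p"
    and small: "\<And>y z. p y = p z \<Longrightarrow> infnorm (y - z) < l" and l: "l \<le> t / 2"
    and mean: "\<And>z. (LINT y|\<mu>. indicator {y. p y = z} y *\<^sub>R g y) = 0"
  shows "ennreal (cmod (theta \<mu> s t g x))
    \<le> ennreal (C1 * (l / t) powr \<alpha>) * (\<integral>\<^sup>+y. majorant t x y * ennreal (cmod (g y)) \<partial>\<mu>)"
proof -
  interpret countable_partition \<mu> p by (rule p)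
  note [measurable] = L2_borel[OF g] kernel_section_measurable[OF t]
  \<comment> \<open>the kernel at a representative of the cell of \<open>y\<close>\<close>
  define F where "F y = s t x (SOME y'. p y' = p y)" for y
  have Fm [measurable]: "F \<in> borel_measurable borel"
    using measurable_cell_function[of "\<lambda>z. s t x (SOME y'. p y' = z)"]
    unfolding F_def[abs_def] by (simp cong: measurable_cong_sets)
  have rep: "p (SOME y'. p y' = p y) = p y" for y by (rule someI[of _ y]) simp
  have near: "infnorm (y - (SOME y'. p y' = p y)) < t / 2"
      "infnorm (y - (SOME y'. p y' = p y)) \<le> l" for y
    using small[OF rep[of y, symmetric]] l by auto
  have d1: "ennreal (cmod (s t x y - F y)) \<le> ennreal (C1 * (l / t) powr \<alpha>) * majorant t x y"
    and d2: "cmod (s t x y - F y) \<le> C1 * (l / t) powr \<alpha> * (1 / lam x t)" for y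
    unfolding F_def by (rule kernel_diff_bounds[OF t near])+
  have "integrable \<mu> (\<lambda>y. s t x y - F y)"
    by (rule integrable_of_majorant_bound[OF t _ d1]) measurable
  then have i1: "integrable \<mu> (\<lambda>y. (s t x y - F y) * g y)"
    by (rule integrable_bounded_mult_L2[OF _ d2 g])
  note i2 = integrable_kernel_L2[OF t g, of x]
  have i3: "integrable \<mu> (\<lambda>y. F y * g y)"
    using Bochner_Integration.integrable_diff[OF i2 i1] by (simp add: algebra_simps)
  have "(LINT y|\<mu>. F y * g y) = 0"
  proof (rule integral_eq_0_of_cells[OF i3])
    fix z
    have "(LINT y|\<mu>. indicator {y. p y = z} y *\<^sub>R (F y * g y))
        = (LINT y|\<mu>. s t x (SOME y'. p y' = z) * (indicator {y. p y = z} y *\<^sub>R g y))"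
      by (intro Bochner_Integration.integral_cong) (auto simp: indicator_def F_def)
    also have "\<dots> = 0" unfolding integral_mult_right_zero mean by simp
    finally show "(LINT y|\<mu>. indicator {y. p y = z} y *\<^sub>R (F y * g y)) = 0" .
  qed
  then have "theta \<mu> s t g x = (LINT y|\<mu>. (s t x y - F y) * g y)"
    using i2 i3 by (simp add: theta_def left_diff_distrib)
  then show ?thesis
    using kernel_integral_bound[OF i1 majorant_section_measurable L2_borel[OF g] d1] by simp
qed

lemma theta_tail_bound:
  assumes t: "t > 0" and d: "d > 0" and [measurable]: "g \<in> borel_measurable borel"
    and g: "\<And>y. cmod (g y) \<le> 1" "\<And>y. infnorm (x - y) < d \<Longrightarrow> g y = 0"
  shows "ennreal (cmod (theta \<mu> s t g x)) \<le> ennreal C1 * (ennreal (gain t d) * schur_const)"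
proof -
  define w where "w y = majorant t x y * (if infnorm (x - y) < d then 0 else 1)" for y
  have w [measurable]: "w \<in> borel_measurable borel" unfolding w_def by measurable
  have i: "integrable \<mu> (\<lambda>y. s t x y * g y)"
  proof (rule Bochner_Integration.integrable_bound[OF integrable_kernel[OF t, of x]])
    note [measurable] = kernel_section_measurable[OF t]
    show "(\<lambda>y. s t x y * g y) \<in> borel_measurable \<mu>" by measurable
    show "AE y in \<mu>. norm (s t x y * g y) \<le> norm (s t x y)"
      using g(1) by (intro AE_I2) (simp add: norm_mult mult_left_le)
  qed
  have "ennreal (cmod (s t x y)) \<le> ennreal C1 * w y" if "g y \<noteq> 0" for y
    using g(2)[of y] that kernel_le_C1_majorant[OF t, of x y] by (auto simp: w_def)
  then have "ennreal (cmod (theta \<mu> s t g x)) \<le> ennreal C1 * (\<integral>\<^sup>+y. w y * ennreal (cmod (g y)) \<partial>\<mu>)"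
    unfolding theta_def by (rule kernel_integral_bound[OF i w assms(3)])
  also have "\<dots> \<le> ennreal C1 * (\<integral>\<^sup>+y. w y * 1 \<partial>\<mu>)"
    using g(1) by (intro mult_left_mono nn_integral_mono) auto
  also have "\<dots> \<le> ennreal C1 * (ennreal (gain t d) * schur_const)"
    unfolding w_def mult_1_right by (intro mult_left_mono majorant_row_truncated t d) auto
  finally show ?thesis .
qed

text \<open>The left-hand side is the square of \<open>\<integral> s\<^sub>t(x, y) (g y - g x) d\<mu>(y)\<close>, in which the ball of radius \<open>d\<close>
around \<open>x\<close> does not contribute. Cauchy--Schwarz with respect to the kernel gains the truncated row
integral once.\<close>

lemma theta_coarse_pointwise:
  assumes t: "t > 0" and d: "d > 0" and g: "g \<in> L2 \<mu>"
    and const: "\<And>y. infnorm (x - y) < d \<Longrightarrow> g y = g x"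
  shows "sq (theta \<mu> s t g x - theta \<mu> s t (\<lambda>_. 1) x * g x)
    \<le> (ennreal C1)\<^sup>2 * (ennreal (gain t d) * schur_const
        * (2 * (\<integral>\<^sup>+y. majorant t x y * sq (g y) \<partial>\<mu>) + 2 * schur_const * sq (g x)))"
proof -
  note [measurable] = L2_borel[OF g] kernel_section_measurable[OF t]
  define w where "w y = majorant t x y * (if infnorm (x - y) < d then 0 else 1)" for y
  define a where "a y = ennreal (cmod (g y - g x))" for y
  have [measurable]: "w \<in> borel_measurable borel" "a \<in> borel_measurable borel"
    unfolding w_def a_def by measurable
  have i0: "integrable \<mu> (\<lambda>y. s t x y * g x)"
    using integrable_kernel[OF t, of x] by simp
  note i1 = integrable_kernel_L2[OF t g, of x]
  have i: "integrable \<mu> (\<lambda>y. s t x y * (g y - g x))"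
    using Bochner_Integration.integrable_diff[OF i1 i0] by (simp add: right_diff_distrib)
  have "theta \<mu> s t g x - theta \<mu> s t (\<lambda>_. 1) x * g x = (LINT y|\<mu>. s t x y * (g y - g x))"
    using i0 i1 by (simp add: theta_def right_diff_distrib)
  moreover have "ennreal (cmod (s t x y)) \<le> ennreal C1 * w y" if "g y - g x \<noteq> 0" for y
    using const[of y] that kernel_le_C1_majorant[OF t, of x y] by (auto simp: w_def)
  ultimately have 1: "ennreal (cmod (theta \<mu> s t g x - theta \<mu> s t (\<lambda>_. 1) x * g x))
      \<le> ennreal C1 * (\<integral>\<^sup>+y. w y * a y \<partial>\<mu>)"
    using kernel_integral_bound[OF i, of w "ennreal C1"] unfolding a_def by simp
  have 2: "(\<integral>\<^sup>+y. w y * (a y)\<^sup>2 \<partial>\<mu>)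
      \<le> 2 * (\<integral>\<^sup>+y. majorant t x y * sq (g y) \<partial>\<mu>) + 2 * schur_const * sq (g x)"
  proof -
    have "(\<integral>\<^sup>+y. w y * (a y)\<^sup>2 \<partial>\<mu>) \<le> (\<integral>\<^sup>+y. 2 * (majorant t x y * sq (g y))
        + majorant t x y * (2 * sq (g x)) \<partial>\<mu>)"
    proof (rule nn_integral_mono)
      fix y
      have "(cmod (g y - g x))\<^sup>2 \<le> (cmod (g y) + cmod (g x))\<^sup>2"
        by (intro power_mono norm_triangle_ineq4) auto
      also have "\<dots> \<le> 2 * (cmod (g y))\<^sup>2 + 2 * (cmod (g x))\<^sup>2"
        by (rule power2_sum_le)
      finally have "sq (g y - g x) \<le> ennreal (2 * (cmod (g y))\<^sup>2 + 2 * (cmod (g x))\<^sup>2)"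
        by (rule ennreal_leI)
      then have "(a y)\<^sup>2 \<le> 2 * sq (g y) + 2 * sq (g x)"
        by (simp add: a_def ennreal_power ennreal_mult)
      then have "w y * (a y)\<^sup>2 \<le> majorant t x y * (2 * sq (g y) + 2 * sq (g x))"
        by (intro mult_mono) (auto simp: w_def)
      then show "w y * (a y)\<^sup>2 \<le> 2 * (majorant t x y * sq (g y)) + majorant t x y * (2 * sq (g x))"
        by (simp add: distrib_left mult.left_commute)
    qed
    also have "\<dots> = 2 * (\<integral>\<^sup>+y. majorant t x y * sq (g y) \<partial>\<mu>)
        + (\<integral>\<^sup>+y. majorant t x y \<partial>\<mu>) * (2 * sq (g x))"
      by (subst nn_integral_add; (subst nn_integral_cmult)?; (subst nn_integral_multc)?) auto
    also have "\<dots> \<le> 2 * (\<integral>\<^sup>+y. majorant t x y * sq (g y) \<partial>\<mu>) + schur_const * (2 * sq (g x))"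
      by (intro add_left_mono mult_right_mono majorant_row t) auto
    finally show ?thesis by (simp add: mult.assoc mult.left_commute)
  qed
  have "sq (theta \<mu> s t g x - theta \<mu> s t (\<lambda>_. 1) x * g x)
      = (ennreal (cmod (theta \<mu> s t g x - theta \<mu> s t (\<lambda>_. 1) x * g x)))\<^sup>2" by (simp add: ennreal_power)
  also have "\<dots> \<le> (ennreal C1 * (\<integral>\<^sup>+y. w y * a y \<partial>\<mu>))\<^sup>2" by (intro power_mono 1) auto
  also have "\<dots> \<le> (ennreal C1)\<^sup>2 * ((\<integral>\<^sup>+y. w y \<partial>\<mu>) * (\<integral>\<^sup>+y. w y * (a y)\<^sup>2 \<partial>\<mu>))"
    unfolding power_mult_distrib by (intro mult_left_mono weighted_Cauchy_Schwarz) auto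
  also have "\<dots> \<le> (ennreal C1)\<^sup>2 * ((ennreal (gain t d) * schur_const)
        * (2 * (\<integral>\<^sup>+y. majorant t x y * sq (g y) \<partial>\<mu>) + 2 * schur_const * sq (g x)))"
    unfolding w_def by (intro mult_left_mono mult_mono majorant_row_truncated t d 2[unfolded w_def]) auto
  finally show ?thesis .
qed

lemma theta_coarse_L2:
  assumes t: "t > 0" and d: "d > 0" and g: "g \<in> L2 \<mu>"
    and const: "\<And>x y. x \<in> G \<Longrightarrow> infnorm (x - y) < d \<Longrightarrow> g y = g x"
  shows "(\<integral>\<^sup>+x. sq (theta \<mu> s t g x - theta \<mu> s t (\<lambda>_. 1) x * g x) * indicator G x \<partial>\<mu>)
    \<le> 4 * (ennreal C1)\<^sup>2 * ennreal (gain t d) * schur_const\<^sup>2 * sqnorm \<mu> g"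
proof -
  note [measurable] = L2_borel[OF g]
  have [measurable]: "(\<lambda>(x, y). majorant t x y) \<in> borel_measurable (\<mu> \<Otimes>\<^sub>M \<mu>)"
    using majorant_measurable[of t] by (simp cong: measurable_cong_sets)
  define c where "c = (ennreal C1)\<^sup>2 * (ennreal (gain t d) * schur_const)"
  have "(\<integral>\<^sup>+x. sq (theta \<mu> s t g x - theta \<mu> s t (\<lambda>_. 1) x * g x) * indicator G x \<partial>\<mu>)
    \<le> (\<integral>\<^sup>+x. c * (2 * (\<integral>\<^sup>+y. majorant t x y * sq (g y) \<partial>\<mu>) + 2 * schur_const * sq (g x)) \<partial>\<mu>)"
    unfolding c_def using theta_coarse_pointwise[OF t d g const]
    by (intro nn_integral_mono) (auto simp: indicator_def mult.assoc)
  also have "\<dots> = c * (2 * (\<integral>\<^sup>+x. (\<integral>\<^sup>+y. majorant t x y * sq (g y) \<partial>\<mu>) \<partial>\<mu>) + 2 * schur_const * sqnorm \<mu> g)"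
    unfolding sqnorm_def
    by (subst nn_integral_cmult; (subst nn_integral_add)?; (subst nn_integral_cmult)?; (subst nn_integral_cmult)?) auto
  also have "\<dots> \<le> c * (2 * (schur_const * sqnorm \<mu> g) + 2 * schur_const * sqnorm \<mu> g)"
    unfolding sqnorm_def by (intro mult_left_mono add_right_mono Schur_majorant t) auto
  also have "\<dots> = c * (4 * schur_const * sqnorm \<mu> g)"
    by (simp add: mult.assoc flip: distrib_right)
  finally show ?thesis
    by (simp add: c_def power2_eq_square mult.assoc mult.left_commute)
qed

end

section \<open>Shifted dyadic cells\<close>

lemma infnorm_less_cart:
  fixes x :: "real ^ 'n"
  assumes "\<And>c. \<bar>x $ c\<bar> < r" shows "infnorm x < r"
proof -
  have "infnorm x \<in> (\<lambda>b. \<bar>x \<bullet> b\<bar>) ` Basis"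
    unfolding infnorm_Max by (rule Max_in) auto
  then obtain b where b: "b \<in> Basis" "infnorm x = \<bar>x \<bullet> b\<bar>" by auto
  then obtain c where "b = axis c 1" by (auto simp: Basis_vec_def)
  then have "infnorm x = \<bar>x $ c\<bar>" using b by (simp add: inner_axis)
  then show ?thesis using assms by simp
qed

text \<open>The index of the half-open cube of sidelength \<open>l\<close> containing \<open>x\<close>, in the grid translated by the same
amount \<open>w\<close> in every coordinate direction. A single shift parameter suffices, since the bad events are
estimated coordinate by coordinate.\<close>

definition cell_index :: "real \<Rightarrow> real \<Rightarrow> real ^ 'n \<Rightarrow> 'n \<Rightarrow> int"
  where "cell_index w l x = (\<lambda>c. \<lfloor>(x $ c - w) / l\<rfloor>)"

abbreviation (input) level :: "real \<Rightarrow> real \<Rightarrow> nat \<Rightarrow> real ^ 'n \<Rightarrow> 'n \<Rightarrow> int"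
  where "level w L i \<equiv> cell_index w (L / 2 ^ i)"

lemma cell_index_measurable:
  "cell_index w l \<in> measurable (borel :: (real ^ 'n) measure) (count_space UNIV)"
proof (subst measurable_count_space_eq2_countable, intro conjI ballI)
  fix z :: "'n \<Rightarrow> int"
  have "cell_index w l -` {z} \<inter> space borel = {x \<in> space (borel :: (real ^ 'n) measure). \<forall>c. \<lfloor>(x $ c - w) / l\<rfloor> = z c}"
    by (auto simp: cell_index_def)
  also have "\<dots> \<in> sets borel" by measurable
  finally show "cell_index w l -` {z} \<inter> space borel \<in> sets borel" .
qed auto

lemma same_cell_infnorm:
  assumes "l > 0" "cell_index w l x = cell_index w l y"
  shows "infnorm (x - y) < l"
proof (rule infnorm_less_cart)
  fix c
  have "\<lfloor>(x $ c - w) / l\<rfloor> = \<lfloor>(y $ c - w) / l\<rfloor>" using assms(2) by (auto simp: cell_index_def dest: fun_cong)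
  then have "\<bar>(x $ c - w) / l - (y $ c - w) / l\<bar> < 1" by linarith
  moreover have "(x $ c - w) / l - (y $ c - w) / l = (x - y) $ c / l"
    by (simp add: diff_divide_distrib)
  ultimately show "\<bar>(x - y) $ c\<bar> < l" using assms(1) by simp
qed

lemma cell_index_refine:
  assumes "level w L (Suc i) x = level w L (Suc i) y"
  shows "level w L i x = level w L i y"
proof
  fix c
  have half: "\<lfloor>v / 2\<rfloor> = \<lfloor>v\<rfloor> div 2" for v :: real
    using floor_divide_real_eq_div[of 2 v] by simp
  have "(v - w) / (L / 2 ^ i) = (v - w) / (L / 2 ^ Suc i) / 2" for v by simp
  moreover have "\<lfloor>(x $ c - w) / (L / 2 ^ Suc i)\<rfloor> = \<lfloor>(y $ c - w) / (L / 2 ^ Suc i)\<rfloor>"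
    using assms by (auto simp: cell_index_def dest: fun_cong)
  ultimately show "level w L i x c = level w L i y c"
    unfolding cell_index_def by (simp only: half)
qed

lemma (in upper_doubling) cell_index_partition:
  assumes l: "l > 0"
  shows "countable_partition \<mu> (cell_index w l)"
proof
  show "cell_index w l \<in> measurable \<mu> (count_space UNIV)"
    unfolding measurable_cong_sets[OF borel_measure refl] by (rule cell_index_measurable)
  fix z
  show "emeasure \<mu> {x \<in> space \<mu>. cell_index w l x = z} < \<infinity>"
  proof (cases "\<exists>x. cell_index w l x = z")
    case True
    then obtain x where "cell_index w l x = z" by auto
    then have "{y \<in> space \<mu>. cell_index w l y = z} \<subseteq> linf_ball x l"
      using same_cell_infnorm[OF l, of w x] by (auto simp: linf_ball_def)
    then have "emeasure \<mu> {y \<in> space \<mu>. cell_index w l y = z} \<le> emeasure \<mu> (linf_ball x l)"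
      by (intro emeasure_mono) auto
    then show ?thesis using emeasure_linf_ball_finite[of x l] by (rule order.strict_trans1)
  qed simp
qed

text \<open>The point lies in its cell at distance at least \<open>\<epsilon> * l\<close> from the complement, expressed by
coordinates.\<close>

definition deep :: "real \<Rightarrow> real \<Rightarrow> real \<Rightarrow> real ^ 'n \<Rightarrow> bool"
  where "deep w l \<epsilon> x \<longleftrightarrow> (\<forall>c. \<epsilon> \<le> frac ((x $ c - w) / l) \<and> frac ((x $ c - w) / l) \<le> 1 - \<epsilon>)"

lemma deep_cell_index:
  assumes l: "l > 0" and x: "deep w l \<epsilon> x" and y: "infnorm (x - y) < \<epsilon> * l"
  shows "cell_index w l y = cell_index w l x"
proof
  fix c
  define u v where "u = (x $ c - w) / l" and "v = (y $ c - w) / l"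
  have "\<bar>(x - y) $ c\<bar> < \<epsilon> * l" using component_le_infnorm_cart[of "x - y" c] y by linarith
  moreover have "\<bar>u - v\<bar> = \<bar>(x - y) $ c\<bar> / l"
    using l by (simp add: u_def v_def diff_divide_distrib[symmetric])
  ultimately have "\<bar>u - v\<bar> < \<epsilon>" using l by (simp add: pos_divide_less_eq)
  moreover have "\<epsilon> \<le> frac u" "frac u \<le> 1 - \<epsilon>" using x by (auto simp: deep_def u_def)
  ultimately have "\<lfloor>v\<rfloor> = \<lfloor>u\<rfloor>" unfolding frac_def by linarith
  then show "cell_index w l y c = cell_index w l x c" by (simp add: cell_index_def u_def v_def)
qed

text \<open>A bad shift lies within \<open>\<epsilon> * l\<close> of \<open>a - z * l\<close> for one of the at most \<open>2\<^sup>i + 4\<close> integers \<open>z\<close> that can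
occur for \<open>w \<in> [0, L]\<close>.\<close>

lemma shift_near_lattice_measure:
  fixes a :: real and i :: nat
  assumes L: "L > 0" and e: "0 \<le> \<epsilon>" "\<epsilon> \<le> 1"
  defines "l \<equiv> L / 2 ^ i"
  shows "emeasure lborel {w \<in> {0..L}. \<not> (\<epsilon> \<le> frac ((a - w) / l) \<and> frac ((a - w) / l) \<le> 1 - \<epsilon>)}
    \<le> ennreal (10 * \<epsilon> * L)"
proof -
  have l: "l > 0" using L by (simp add: l_def)
  define z0 where "z0 = \<lfloor>(a - L) / l\<rfloor>"
  \<comment> \<open>a margin of two at the ends covers the rounding and \<open>\<epsilon> \<le> 1\<close>\<close>
  define Z where "Z = {z0 - 1 .. z0 + 2 ^ i + 2}"
  have "{w \<in> {0..L}. \<not> (\<epsilon> \<le> frac ((a - w) / l) \<and> frac ((a - w) / l) \<le> 1 - \<epsilon>)}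
    \<subseteq> (\<Union>z\<in>Z. {a - of_int z * l - \<epsilon> * l .. a - of_int z * l + \<epsilon> * l})"
  proof
    fix w assume w: "w \<in> {w \<in> {0..L}. \<not> (\<epsilon> \<le> frac ((a - w) / l) \<and> frac ((a - w) / l) \<le> 1 - \<epsilon>)}"
    define u where "u = (a - w) / l"
    have "\<exists>z::int. \<bar>u - of_int z\<bar> \<le> \<epsilon>"
    proof (cases "frac u < \<epsilon>")
      case True
      then show ?thesis by (intro exI[of _ "\<lfloor>u\<rfloor>"]) (unfold frac_def, linarith)
    next
      case False
      then have "frac u > 1 - \<epsilon>" using w by (auto simp: u_def)
      then show ?thesis by (intro exI[of _ "\<lfloor>u\<rfloor> + 1"]) (unfold frac_def, linarith)
    qed
    then obtain z :: int where z: "\<bar>u - of_int z\<bar> \<le> \<epsilon>" by auto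
    have "\<bar>a - w - of_int z * l\<bar> = \<bar>u - of_int z\<bar> * l"
    proof -
      have "u * l = a - w" using l by (simp add: u_def)
      then have "a - w - of_int z * l = (u - of_int z) * l" by (simp add: left_diff_distrib)
      then show ?thesis using l by (simp add: abs_mult)
    qed
    also have "\<dots> \<le> \<epsilon> * l" using z l by (intro mult_right_mono) auto
    finally have in1: "w \<in> {a - of_int z * l - \<epsilon> * l .. a - of_int z * l + \<epsilon> * l}" by auto
    have "(a - L) / l \<le> u" "u \<le> (a - L) / l + 2 ^ i"
    proof -
      show "(a - L) / l \<le> u" using w l by (simp add: u_def divide_right_mono)
      have "u \<le> a / l" using w l by (simp add: u_def divide_right_mono)
      also have "a / l = (a - L) / l + 2 ^ i" using L by (simp add: l_def field_simps)
      finally show "u \<le> (a - L) / l + 2 ^ i" .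
    qed
    then have "real_of_int (z0 - 1) \<le> real_of_int z" "real_of_int z < real_of_int (z0 + 2 ^ i + 3)"
      using z e unfolding z0_def of_int_diff of_int_add of_int_power of_int_numeral of_int_1 by linarith+
    then have "z0 - 1 \<le> z" "z < z0 + 2 ^ i + 3" by (simp_all only: of_int_le_iff of_int_less_iff)
    then have "z \<in> Z" unfolding Z_def by auto
    then show "w \<in> (\<Union>z\<in>Z. {a - of_int z * l - \<epsilon> * l .. a - of_int z * l + \<epsilon> * l})" using in1 by blast
  qed
  then have "emeasure lborel {w \<in> {0..L}. \<not> (\<epsilon> \<le> frac ((a - w) / l) \<and> frac ((a - w) / l) \<le> 1 - \<epsilon>)}
    \<le> emeasure lborel (\<Union>z\<in>Z. {a - of_int z * l - \<epsilon> * l .. a - of_int z * l + \<epsilon> * l})"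
    by (intro emeasure_mono) auto
  also have "\<dots> \<le> (\<Sum>z\<in>Z. emeasure lborel {a - of_int z * l - \<epsilon> * l .. a - of_int z * l + \<epsilon> * l})"
    by (intro emeasure_subadditive_finite) (auto simp: Z_def)
  also have "\<dots> = (\<Sum>z\<in>Z. ennreal (2 * \<epsilon> * l))"
    using e l by (intro sum.cong refl) (auto simp: emeasure_lborel_Icc_eq)
  also have "\<dots> = ennreal (real (card Z) * (2 * \<epsilon> * l))"
    using e l by (simp add: ennreal_mult ennreal_of_nat_eq_real_of_nat)
  also have "\<dots> \<le> ennreal (10 * \<epsilon> * L)"
  proof (rule ennreal_leI)
    have "real (card Z) = 2 ^ i + 4" by (simp add: Z_def nat_add_distrib nat_power_eq)
    then have "real (card Z) * l = L + 4 * l" by (simp add: l_def algebra_simps)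
    also have "\<dots> \<le> 5 * L" using L by (simp add: l_def divide_le_eq)
    finally have "2 * \<epsilon> * (real (card Z) * l) \<le> 2 * \<epsilon> * (5 * L)" using e by (intro mult_left_mono) auto
    then show "real (card Z) * (2 * \<epsilon> * l) \<le> 10 * \<epsilon> * L" by (simp add: algebra_simps)
  qed
  finally show ?thesis .
qed

lemma geometric_partial_sum_le:
  fixes r :: real assumes "0 \<le> r" "r < 1"
  shows "(\<Sum>i\<le>k. r ^ i) \<le> 1 / (1 - r)"
proof -
  have "(1 - r) * (\<Sum>i\<le>k. r ^ i) = 1 - r ^ Suc k" by (rule sum_gp_basic)
  also have "\<dots> \<le> 1" using assms by simp
  finally show ?thesis using assms by (simp add: pos_le_divide_eq mult.commute)
qed

text \<open>Chosen such that the bad shifts make up at most half of \<open>[0, L]\<close>: summing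
\<open>10 * margin * (3/4)\<^bsup>k-i\<^esup>\<close> over the coordinates and over \<open>i \<le> k\<close> gives at most \<open>1/2\<close>.\<close>

definition margin :: "'n itself \<Rightarrow> real"
  where "margin _ = 1 / (80 * real CARD('n))"

text \<open>The factor \<open>3/4\<close> can be any number strictly between \<open>1/2\<close> and \<open>1\<close>: below \<open>1\<close>, the probabilities of
being bad are summable over the generations; above \<open>1/2\<close>, the scale \<open>L / 2\<^sup>k\<close> is still small
compared with the distance to the complement of a cell of generation \<open>i\<close>, when \<open>k - i\<close> is large.\<close>

definition good :: "real \<Rightarrow> real \<Rightarrow> nat \<Rightarrow> (real ^ 'n) \<Rightarrow> bool"
  where "good w L k x \<longleftrightarrow> (\<forall>i\<le>k. deep w (L / 2 ^ i) (margin TYPE('n) * (3 / 4) ^ (k - i)) x)"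

abbreviation (input) good_ind :: "real \<Rightarrow> real \<Rightarrow> nat \<Rightarrow> (real ^ 'n) \<Rightarrow> ennreal"
  where "good_ind w L k x \<equiv> indicator {x. good w L k x} x"

abbreviation (input) shift_ind :: "real \<Rightarrow> real \<Rightarrow> nat \<Rightarrow> (real ^ 'n) \<Rightarrow> ennreal"
  where "shift_ind w L k x \<equiv> (if w \<in> {0..L} \<and> good w L k x then 1 else 0)"

lemma frac_borel_measurable [measurable]: "(frac :: real \<Rightarrow> real) \<in> borel_measurable borel"
  unfolding frac_def[abs_def] by measurable

lemma deep_measurable:
  "Measurable.pred (borel \<Otimes>\<^sub>M borel) (\<lambda>z :: real \<times> (real ^ 'n). deep (fst z) l \<epsilon> (snd z))"
proof -
  have 1: "(\<lambda>z :: real \<times> (real ^ 'n). fst z) \<in> borel_measurable (borel \<Otimes>\<^sub>M borel)"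
    by (rule measurable_fst)
  have 2: "(\<lambda>z :: real \<times> (real ^ 'n). snd z $ c) \<in> borel_measurable (borel \<Otimes>\<^sub>M borel)" for c
    by (rule measurable_compose[OF measurable_snd borel_measurable_continuous_onI]) (intro continuous_intros)
  have [measurable]: "(\<lambda>z :: real \<times> (real ^ 'n). frac ((snd z $ c - fst z) / l)) \<in> borel_measurable (borel \<Otimes>\<^sub>M borel)" for c
    by (intro measurable_compose[OF _ frac_borel_measurable] borel_measurable_divide borel_measurable_diff 1 2 borel_measurable_const)
  show ?thesis unfolding deep_def by measurable
qed

lemma good_measurable:
  "Measurable.pred (borel \<Otimes>\<^sub>M borel) (\<lambda>z :: real \<times> (real ^ 'n). good (fst z) L k (snd z))"
proof -
  have eq: "good w L k x \<longleftrightarrow> (\<forall>i\<in>{..k}. deep w (L / 2 ^ i) (margin TYPE('n) * (3 / 4) ^ (k - i)) x)"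
    for w and x :: "real ^ 'n" unfolding good_def by blast
  show ?thesis
    unfolding eq by (rule pred_intros_finite(3)[OF finite_atMost deep_measurable])
qed

lemma good_slice_measurable [measurable]:
  "Measurable.pred borel (\<lambda>x :: real ^ 'n. good w L k x)"
  "Measurable.pred borel (\<lambda>w. good w L k (x :: real ^ 'n))"
proof -
  have "(\<lambda>x :: real ^ 'n. (w, x)) \<in> measurable borel (borel \<Otimes>\<^sub>M borel)" by measurable
  from measurable_compose[OF this good_measurable] show "Measurable.pred borel (\<lambda>x :: real ^ 'n. good w L k x)"
    unfolding fst_conv snd_conv .
  have "(\<lambda>w. (w, x)) \<in> measurable borel (borel \<Otimes>\<^sub>M borel)" by measurable
  from measurable_compose[OF this good_measurable] show "Measurable.pred borel (\<lambda>w. good w L k (x :: real ^ 'n))"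
    unfolding fst_conv snd_conv .
qed

lemma margin_pos: "margin TYPE('n::finite) > 0" and margin_le: "margin TYPE('n::finite) \<le> 1"
proof -
  have "real CARD('n) \<ge> 1" using zero_less_card_finite[where 'a='n] by linarith
  then have "80 * real CARD('n) \<ge> 1" by linarith
  then show "margin TYPE('n) > 0" "margin TYPE('n) \<le> 1"
    unfolding margin_def by (simp_all add: divide_le_eq)
qed

lemma bad_measure:
  fixes x :: "real ^ 'n"
  assumes L: "L > 0"
  shows "emeasure lborel {w \<in> {0..L}. \<not> good w L k x} \<le> ennreal (L / 2)"
proof -
  define \<epsilon> where "\<epsilon> i = margin TYPE('n) * (3 / 4) ^ (k - i)" for i
  have e: "0 \<le> \<epsilon> i" "\<epsilon> i \<le> 1" for i
  proof -
    show "0 \<le> \<epsilon> i" using margin_pos[where 'n='n] by (simp add: \<epsilon>_def)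
    have "\<epsilon> i \<le> 1 * 1" unfolding \<epsilon>_def
      using margin_le[where 'n='n] margin_pos[where 'n='n] by (intro mult_mono power_le_one) auto
    then show "\<epsilon> i \<le> 1" by simp
  qed
  define B where "B i c = {w \<in> {0..L}. \<not> (\<epsilon> i \<le> frac ((x $ c - w) / (L / 2 ^ i))
      \<and> frac ((x $ c - w) / (L / 2 ^ i)) \<le> 1 - \<epsilon> i)}" for i c
  have [measurable]: "B i c \<in> sets borel" for i c
    unfolding B_def frac_def by measurable
  have "{w \<in> {0..L}. \<not> good w L k x} \<subseteq> (\<Union>i\<in>{..k}. \<Union>c\<in>UNIV. B i c)"
    by (auto simp: good_def deep_def B_def \<epsilon>_def)
  then have "emeasure lborel {w \<in> {0..L}. \<not> good w L k x} \<le> emeasure lborel (\<Union>i\<in>{..k}. \<Union>c\<in>UNIV. B i c)"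
    by (intro emeasure_mono) auto
  also have "\<dots> \<le> (\<Sum>i\<le>k. emeasure lborel (\<Union>c\<in>UNIV. B i c))"
    by (intro emeasure_subadditive_finite) auto
  also have "\<dots> \<le> (\<Sum>i\<le>k. \<Sum>c\<in>UNIV. emeasure lborel (B i c))"
    by (intro sum_mono emeasure_subadditive_finite) auto
  also have "\<dots> \<le> (\<Sum>i\<le>k. \<Sum>c\<in>(UNIV::'n set). ennreal (10 * \<epsilon> i * L))"
    unfolding B_def using e L by (intro sum_mono shift_near_lattice_measure) auto
  also have "\<dots> = ennreal (\<Sum>i\<le>k. \<Sum>c\<in>(UNIV::'n set). 10 * \<epsilon> i * L)"
    using e L by (subst sum_ennreal[symmetric], simp)+ (simp add: sum_nonneg)
  also have "\<dots> \<le> ennreal (L / 2)"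
  proof (rule ennreal_leI)
    have "(\<Sum>i\<le>k. (3 / 4 :: real) ^ (k - i)) = (\<Sum>i\<le>k. (3 / 4) ^ i)"
      by (rule sum.nat_diff_reindex[of "\<lambda>i. (3/4::real) ^ i" "Suc k", unfolded lessThan_Suc_atMost, simplified])
    also have "\<dots> \<le> 1 / (1 - 3 / 4)" by (rule geometric_partial_sum_le) auto
    also have "\<dots> = 4" by simp
    finally have s: "(\<Sum>i\<le>k. (3 / 4 :: real) ^ (k - i)) \<le> 4" .
    have n: "real CARD('n) \<ge> 1" using zero_less_card_finite[where 'a='n] by linarith
    have "(\<Sum>i\<le>k. \<Sum>c\<in>(UNIV::'n set). 10 * \<epsilon> i * L)
      = real CARD('n) * 10 * L * margin TYPE('n) * (\<Sum>i\<le>k. (3 / 4) ^ (k - i))"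
      by (simp add: \<epsilon>_def sum_distrib_left mult_ac)
    also have "\<dots> \<le> real CARD('n) * 10 * L * margin TYPE('n) * 4"
      using s L margin_pos[where 'n='n] by (intro mult_left_mono) auto
    also have "\<dots> = L / 2" using n by (simp add: margin_def)
    finally show "(\<Sum>i\<le>k. \<Sum>c\<in>(UNIV::'n set). 10 * \<epsilon> i * L) \<le> L / 2" .
  qed
  finally show ?thesis .
qed

lemma good_measure:
  fixes x :: "real ^ 'n"
  assumes L: "L > 0"
  shows "ennreal (L / 2) \<le> (\<integral>\<^sup>+w. shift_ind w L k x \<partial>lborel)"
proof -
  let ?G = "{w \<in> {0..L}. good w L k x}" and ?B = "{w \<in> {0..L}. \<not> good w L k x}"
  have m: "?G \<in> sets lborel" "?B \<in> sets lborel" by measurable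
  have "ennreal L = emeasure lborel {0..L}" using L by simp
  also have "{0..L} = ?G \<union> ?B" by auto
  also have "emeasure lborel (?G \<union> ?B) \<le> emeasure lborel ?G + emeasure lborel ?B"
    by (rule emeasure_subadditive) (use m in auto)
  also have "\<dots> \<le> emeasure lborel ?G + ennreal (L / 2)" by (intro add_left_mono bad_measure L)
  finally have "ennreal (L / 2) + ennreal (L / 2) \<le> emeasure lborel ?G + ennreal (L / 2)"
    using L by (subst ennreal_plus[symmetric]) auto
  then have "ennreal (L / 2) \<le> emeasure lborel ?G"
    using ennreal_add_left_cancel_le[of "ennreal (L / 2)" "ennreal (L / 2)" "emeasure lborel ?G"]
    by (simp only: add.commute) simp
  also have "emeasure lborel ?G = (\<integral>\<^sup>+w. indicator ?G w \<partial>lborel)" using m by simp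
  also have "\<dots> = (\<integral>\<^sup>+w. shift_ind w L k x \<partial>lborel)"
    by (intro nn_integral_cong) (auto simp: indicator_def)
  finally show ?thesis .
qed

text \<open>The density of \<open>dt / t\<close> on \<open>[l/2, l)\<close>.\<close>

definition scale_weight :: "real \<Rightarrow> real \<Rightarrow> ennreal"
  where "scale_weight l t = (if l / 2 \<le> t \<and> t < l then ennreal (1 / t) else 0)"

lemma scale_weight_measurable [measurable]: "scale_weight l \<in> borel_measurable borel"
  unfolding scale_weight_def[abs_def] by measurable

lemma scale_weight_integral:
  assumes l: "l > 0" shows "(\<integral>\<^sup>+t. scale_weight l t \<partial>lborel) \<le> 1"
proof -
  have "(\<integral>\<^sup>+t. scale_weight l t \<partial>lborel) \<le> (\<integral>\<^sup>+t. ennreal (2 / l) * indicator {l/2..l} t \<partial>lborel)"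
  proof (rule nn_integral_mono)
    fix t
    show "scale_weight l t \<le> ennreal (2 / l) * indicator {l/2..l} t"
    proof (cases "l / 2 \<le> t \<and> t < l")
      case True
      then have "1 / t \<le> 1 / (l / 2)" using l by (intro divide_left_mono mult_pos_pos) auto
      then show ?thesis using True by (simp add: scale_weight_def ennreal_leI)
    next
      case False
      then have "scale_weight l t = 0" unfolding scale_weight_def by (rule if_not_P)
      then show ?thesis by simp
    qed
  qed
  also have "\<dots> = ennreal (2 / l) * ennreal (l / 2)"
    using l by (subst nn_integral_cmult_indicator) auto
  also have "\<dots> = 1" using l by (subst ennreal_mult[symmetric]) auto
  finally show ?thesis .
qed

section \<open>Packing of the paraproduct coefficients\<close>

lemma sum_scale_weight_le:
  assumes L: "L > 0"
  shows "(\<Sum>k=i..N. scale_weight (L / 2 ^ k) t) \<le> ennreal (1 / t) * indicator {0<..<L / 2 ^ i} t"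
proof (cases "i \<le> N")
  case True
  then show ?thesis
  proof (induction i rule: inc_induct)
    case base
    have "L / 2 ^ N > 0" using L by simp
    then show ?case by (auto simp: scale_weight_def)
  next
    case (step i)
    have p: "L / 2 ^ i > 0" and h: "L / 2 ^ Suc i = L / 2 ^ i / 2" using L by auto
    have "(\<Sum>k=i..N. scale_weight (L / 2 ^ k) t)
        = scale_weight (L / 2 ^ i) t + (\<Sum>k=Suc i..N. scale_weight (L / 2 ^ k) t)"
      using step(2) by (simp add: sum.atLeast_Suc_atMost)
    also have "\<dots> \<le> scale_weight (L / 2 ^ i) t + ennreal (1 / t) * indicator {0<..<L / 2 ^ Suc i} t"
      by (intro add_left_mono step.IH)
    also have "\<dots> \<le> ennreal (1 / t) * indicator {0<..<L / 2 ^ i} t"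
      unfolding h using p by (auto simp: scale_weight_def indicator_def)
    finally show ?case .
  qed
qed simp

lemma le_sum_scale_weight:
  assumes L: "L > 0"
  shows "ennreal (1 / t) * indicator {L / 2 ^ Suc N..<L} t \<le> (\<Sum>k\<le>N. scale_weight (L / 2 ^ k) t)"
proof (induction N)
  case 0
  then show ?case by (auto simp: scale_weight_def indicator_def)
next
  case (Suc N)
  have h: "L / 2 ^ Suc (Suc N) = L / 2 ^ Suc N / 2" by simp
  have "ennreal (1 / t) * indicator {L / 2 ^ Suc (Suc N)..<L} t
    \<le> ennreal (1 / t) * indicator {L / 2 ^ Suc N..<L} t + scale_weight (L / 2 ^ Suc N) t"
    unfolding h by (auto simp: scale_weight_def indicator_def)
  also have "\<dots> \<le> (\<Sum>k\<le>N. scale_weight (L / 2 ^ k) t) + scale_weight (L / 2 ^ Suc N) t"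
    by (intro add_right_mono Suc)
  finally show ?case by simp
qed

context square_function_kernel
begin

text \<open>The kernel is measurable only on \<open>t > 0\<close>. Replacing smaller \<open>t\<close> by \<open>1\<close> gives a function that is
measurable on the whole product space and agrees with \<open>theta\<close> wherever the measure \<open>dt / t\<close>
lives.\<close>

definition theta_ext :: "(real ^ 'n \<Rightarrow> complex) \<Rightarrow> real \<Rightarrow> real ^ 'n \<Rightarrow> complex"
  where "theta_ext g t x = theta \<mu> s (if t > 0 then t else 1) g x"

lemma theta_ext_eq: "t > 0 \<Longrightarrow> theta_ext g t x = theta \<mu> s t g x"
  by (simp add: theta_ext_def)

lemma theta_ext_measurable:
  assumes "g \<in> borel_measurable borel"
  shows "(\<lambda>(t, x). theta_ext g t x) \<in> borel_measurable (borel \<Otimes>\<^sub>M borel)"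
  using theta_joint_measurable[OF assms] by (simp add: theta_ext_def)

lemma sets_pair_mu: "sets (\<mu> \<Otimes>\<^sub>M lborel) = sets (borel \<Otimes>\<^sub>M borel)"
  by (intro sets_pair_measure_cong) auto

lemma square_integrand_measurable:
  assumes g: "g \<in> borel_measurable borel" and A: "A \<in> sets (borel \<Otimes>\<^sub>M borel)" "A \<subseteq> UNIV \<times> {0<..}"
  shows "(\<lambda>z. (case z of (x, t) \<Rightarrow> ennreal ((cmod (theta \<mu> s t g x))\<^sup>2 / t)) * indicator A z)
    \<in> borel_measurable (\<mu> \<Otimes>\<^sub>M lborel)"
proof -
  note [measurable] = A(1) theta_ext_measurable[OF g]
  have "(\<lambda>z. ennreal ((cmod (theta_ext g (snd z) (fst z)))\<^sup>2 / snd z) * indicator A z) \<in> borel_measurable (borel \<Otimes>\<^sub>M borel)"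
    by measurable
  moreover have "(case z of (x, t) \<Rightarrow> ennreal ((cmod (theta \<mu> s t g x))\<^sup>2 / t)) * indicator A z
      = ennreal ((cmod (theta_ext g (snd z) (fst z)))\<^sup>2 / snd z) * indicator A z" for z
    using A(2) by (cases z) (auto simp: indicator_def theta_ext_eq)
  ultimately show ?thesis
    unfolding measurable_cong_sets[OF sets_pair_mu refl] by simp
qed

lemma square_integral_iterated:
  assumes g: "g \<in> borel_measurable borel" and A: "A \<in> sets (borel \<Otimes>\<^sub>M borel)" "A \<subseteq> UNIV \<times> {0<..}"
  shows "square_integral \<mu> s g A
    = (\<integral>\<^sup>+x. (\<integral>\<^sup>+t. sq (theta_ext g t x) * ennreal (1 / t) * indicator A (x, t) \<partial>lborel) \<partial>\<mu>)"
proof -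
  interpret PP: pair_sigma_finite \<mu> lborel by unfold_locales
  have "square_integral \<mu> s g A = (\<integral>\<^sup>+x. (\<integral>\<^sup>+t. ennreal ((cmod (theta \<mu> s t g x))\<^sup>2 / t) * indicator A (x, t) \<partial>lborel) \<partial>\<mu>)"
    unfolding square_integral_def
    using lborel.nn_integral_fst[OF square_integrand_measurable[OF assms]] by simp
  also have "\<dots> = (\<integral>\<^sup>+x. (\<integral>\<^sup>+t. sq (theta_ext g t x) * ennreal (1 / t) * indicator A (x, t) \<partial>lborel) \<partial>\<mu>)"
  proof (intro nn_integral_cong)
    fix x t
    show "ennreal ((cmod (theta \<mu> s t g x))\<^sup>2 / t) * indicator A (x, t)
      = sq (theta_ext g t x) * ennreal (1 / t) * indicator A (x, t)"
      using A(2) by (cases "(x, t) \<in> A") (auto simp: theta_ext_eq ennreal_mult[symmetric])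
  qed
  finally show ?thesis .
qed

end

locale square_function_testing = square_function_kernel \<mu> lam \<alpha> C_lam s C1
  for \<mu> :: "(real ^ 'n) measure" and lam \<alpha> C_lam s C1 +
  fixes C0 :: ennreal
  assumes C0_finite: "C0 < \<infinity>"
    and testing: "\<And>a l. l > 0 \<Longrightarrow>
      square_integral \<mu> s (indicator (cube a l)) (carleson_box a l) \<le> C0 * emeasure \<mu> (cube a l)"
begin

lemma cell_measurable: "{y :: real ^ 'n. cell_index w l y = z} \<in> sets borel"
proof -
  have "{y :: real ^ 'n. cell_index w l y = z} = cell_index w l -` {z} \<inter> space (borel :: (real ^ 'n) measure)" by auto
  also have "\<dots> \<in> sets borel" by (rule measurable_sets[OF cell_index_measurable]) simp
  finally show ?thesis .
qed

text \<open>A half-open cube is the increasing union of closed cubes with the same lower corner; Fatou's lemma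
transfers the testing condition. The measure may charge the faces of a cube, so the two kinds of
cubes have to be distinguished.\<close>

lemma testing_half_open_cell:
  fixes w l :: real and z :: "'n \<Rightarrow> int"
  assumes l: "l > 0"
  defines "Q \<equiv> {y :: real ^ 'n. cell_index w l y = z}"
  shows "square_integral \<mu> s (indicator Q) (Q \<times> {0<..<l}) \<le> C0 * emeasure \<mu> Q"
proof -
  define a :: "real ^ 'n" where "a = (\<chi> c. w + l * of_int (z c))"
  define r where "r n = l * (1 - 1 / real (n + 2))" for n :: nat
  have r: "r n > 0" "r n < l" for n using l by (auto simp: r_def field_simps add_pos_nonneg)
  have r_lim: "r \<longlonglongrightarrow> l"
  proof -
    have "(\<lambda>n. l * (1 - inverse (real (n + 2)))) \<longlonglongrightarrow> l * (1 - 0)"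
      by (intro tendsto_intros LIMSEQ_ignore_initial_segment[OF lim_inverse_n])
    then show ?thesis by (simp add: r_def[abs_def] inverse_eq_divide)
  qed
  have Qm [measurable]: "Q \<in> sets borel" unfolding Q_def by (rule cell_measurable)
  have Q_iff: "x \<in> Q \<longleftrightarrow> (\<forall>c. a $ c \<le> x $ c \<and> x $ c < a $ c + l)" for x
  proof -
    have "\<lfloor>(x $ c - w) / l\<rfloor> = z c \<longleftrightarrow> a $ c \<le> x $ c \<and> x $ c < a $ c + l" for c
      unfolding floor_eq_iff using l by (auto simp: a_def field_simps)
    then show ?thesis by (simp add: Q_def cell_index_def fun_eq_iff)
  qed
  have cube_iff: "x \<in> cube a (r n) \<longleftrightarrow> (\<forall>c. a $ c \<le> x $ c \<and> x $ c \<le> a $ c + r n)" for x n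
    by (simp add: cube_def mem_box_cart)
  have cube_sub: "cube a (r n) \<subseteq> Q" for n
  proof
    fix x assume "x \<in> cube a (r n)"
    then have "a $ c \<le> x $ c" "x $ c \<le> a $ c + r n" for c by (auto simp: cube_iff)
    then show "x \<in> Q" unfolding Q_iff using r(2)[of n] by (meson add_strict_left_mono order_le_less_trans)
  qed
  have cubem [measurable]: "cube a (r n) \<in> sets borel" for n by (simp add: cube_def)
  have ev_cube: "\<forall>\<^sub>F n in sequentially. x \<in> cube a (r n)" if "x \<in> Q" for x
  proof -
    have "\<forall>\<^sub>F n in sequentially. x $ c - a $ c < r n" for c
      using that by (intro order_tendstoD(1)[OF r_lim]) (simp add: Q_iff algebra_simps)
    then have "\<forall>\<^sub>F n in sequentially. \<forall>c. x $ c - a $ c < r n" by (rule eventually_all_finite)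
    then show ?thesis
    proof (rule eventually_mono)
      fix n assume *: "\<forall>c. x $ c - a $ c < r n"
      show "x \<in> cube a (r n)"
        unfolding cube_iff
      proof (intro allI conjI)
        fix c
        show "a $ c \<le> x $ c" using that by (simp add: Q_iff)
        show "x $ c \<le> a $ c + r n" using *[rule_format, of c] by linarith
      qed
    qed
  qed
  define F where "F B A z = (case z of (x, t) \<Rightarrow> ennreal ((cmod (theta \<mu> s t (indicator B) x))\<^sup>2 / t)) * indicator A z"
    for B :: "(real ^ 'n) set" and A and z :: "(real ^ 'n) \<times> real"
  have conv: "(\<lambda>n. theta \<mu> s t (indicator (cube a (r n))) x) \<longlonglongrightarrow> theta \<mu> s t (indicator Q) x" if t: "t > 0" for t x
    unfolding theta_def
  proof (rule integral_dominated_convergence)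
    note [measurable] = kernel_section_measurable[OF t]
    show "(\<lambda>y. s t x y * indicator Q y) \<in> borel_measurable \<mu>" by measurable
    show "(\<lambda>y. s t x y * indicator (cube a (r n)) y) \<in> borel_measurable \<mu>" for n by measurable
    show "integrable \<mu> (\<lambda>y. cmod (s t x y))" using integrable_kernel[OF t, of x] by (rule integrable_norm)
    show "AE y in \<mu>. (\<lambda>n. s t x y * indicator (cube a (r n)) y) \<longlonglongrightarrow> s t x y * indicator Q y"
    proof (intro AE_I2 tendsto_mult_left)
      fix y
      show "(\<lambda>n. indicator (cube a (r n)) y :: complex) \<longlonglongrightarrow> indicator Q y"
      proof (cases "y \<in> Q")
        case True
        then show ?thesis
          by (intro tendsto_eventually eventually_mono[OF ev_cube[OF True]]) (simp add: indicator_def)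
      next
        case False
        then have "y \<notin> cube a (r n)" for n using cube_sub[of n] by auto
        then show ?thesis using False by simp
      qed
    qed
    show "AE y in \<mu>. cmod (s t x y * indicator (cube a (r n)) y) \<le> cmod (s t x y)" for n
      by (intro AE_I2) (auto simp: indicator_def)
  qed
  have limF: "F Q (Q \<times> {0<..<l}) v \<le> liminf (\<lambda>n. F (cube a (r n)) (carleson_box a (r n)) v)" for v
  proof (cases "v \<in> Q \<times> {0<..<l}")
    case True
    obtain x t where v: "v = (x, t)" by (cases v)
    have x: "x \<in> Q" and t: "0 < t" "t < l" using True v by auto
    have "\<forall>\<^sub>F n in sequentially. t < r n" using t by (intro order_tendstoD(1)[OF r_lim])
    then have ev: "\<forall>\<^sub>F n in sequentially. F (cube a (r n)) (carleson_box a (r n)) v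
        = ennreal ((cmod (theta \<mu> s t (indicator (cube a (r n))) x))\<^sup>2 / t)"
      using ev_cube[OF x]
      by eventually_elim (use t in \<open>auto simp: F_def v carleson_box_def\<close>)
    have "(\<lambda>n. ennreal ((cmod (theta \<mu> s t (indicator (cube a (r n))) x))\<^sup>2 / t))
        \<longlonglongrightarrow> ennreal ((cmod (theta \<mu> s t (indicator Q) x))\<^sup>2 / t)"
      using t by (intro tendsto_ennrealI tendsto_divide tendsto_power tendsto_norm conv tendsto_const) auto
    then have "(\<lambda>n. F (cube a (r n)) (carleson_box a (r n)) v)
        \<longlonglongrightarrow> ennreal ((cmod (theta \<mu> s t (indicator Q) x))\<^sup>2 / t)"
      by (rule Lim_transform_eventually) (use ev in \<open>auto elim: eventually_mono\<close>)
    then have "liminf (\<lambda>n. F (cube a (r n)) (carleson_box a (r n)) v)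
        = ennreal ((cmod (theta \<mu> s t (indicator Q) x))\<^sup>2 / t)"
      by (intro lim_imp_Liminf) auto
    then show ?thesis using True by (simp add: F_def v)
  qed (simp add: F_def)
  have box: "carleson_box a (r n) \<in> sets (borel \<Otimes>\<^sub>M borel)" for n
    unfolding carleson_box_def by (intro pair_measureI) auto
  have Fm: "F (cube a (r n)) (carleson_box a (r n)) \<in> borel_measurable (\<mu> \<Otimes>\<^sub>M lborel)" for n
    unfolding F_def by (rule square_integrand_measurable[OF _ box]) (auto simp: carleson_box_def)
  have "square_integral \<mu> s (indicator Q) (Q \<times> {0<..<l})
      = (\<integral>\<^sup>+v. F Q (Q \<times> {0<..<l}) v \<partial>(\<mu> \<Otimes>\<^sub>M lborel))"
    by (simp add: square_integral_def F_def)
  also have "\<dots> \<le> (\<integral>\<^sup>+v. liminf (\<lambda>n. F (cube a (r n)) (carleson_box a (r n)) v) \<partial>(\<mu> \<Otimes>\<^sub>M lborel))"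
    by (intro nn_integral_mono limF)
  also have "\<dots> \<le> liminf (\<lambda>n. \<integral>\<^sup>+v. F (cube a (r n)) (carleson_box a (r n)) v \<partial>(\<mu> \<Otimes>\<^sub>M lborel))"
    by (rule nn_integral_liminf[OF Fm])
  also have "\<dots> \<le> liminf (\<lambda>n. C0 * emeasure \<mu> Q)"
  proof (intro Liminf_mono always_eventually allI)
    fix n
    have "(\<integral>\<^sup>+v. F (cube a (r n)) (carleson_box a (r n)) v \<partial>(\<mu> \<Otimes>\<^sub>M lborel))
        = square_integral \<mu> s (indicator (cube a (r n))) (carleson_box a (r n))"
      by (simp add: square_integral_def F_def)
    also have "\<dots> \<le> C0 * emeasure \<mu> (cube a (r n))" by (rule testing[OF r(1)])
    also have "\<dots> \<le> C0 * emeasure \<mu> Q" by (intro mult_left_mono emeasure_mono cube_sub) auto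
    finally show "(\<integral>\<^sup>+v. F (cube a (r n)) (carleson_box a (r n)) v \<partial>(\<mu> \<Otimes>\<^sub>M lborel)) \<le> C0 * emeasure \<mu> Q" .
  qed
  also have "\<dots> = C0 * emeasure \<mu> Q" by (rule Liminf_const) simp
  finally show ?thesis .
qed

definition \<rho> :: real where "\<rho> = (2 / 3) powr (\<alpha> / 2)"
definition \<beta> :: real where "\<beta> = (2 / margin TYPE('n)) powr (\<alpha> / 2)"

lemma \<rho>_bounds: "0 < \<rho>" "\<rho> < 1"
  using alpha_pos powr_less_mono2[of "\<alpha> / 2" "2/3" 1] by (auto simp: \<rho>_def)

lemma \<beta>_nonneg: "\<beta> \<ge> 0" by (simp add: \<beta>_def)

text \<open>\<open>\<beta> * \<rho> ^ (k - i)\<close> is the gain of the truncated row integral when \<open>t\<close> is of scale \<open>k\<close> and the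
truncation radius is the distance guaranteed by goodness in generation \<open>i\<close>.\<close>

lemma scale_ratio:
  assumes L: "L > 0" and ik: "i \<le> k" and t: "0 < t" "t < L / 2 ^ k"
  shows "(2 * t / (margin TYPE('n) * (3 / 4) ^ (k - i) * (L / 2 ^ i))) powr (\<alpha> / 2) \<le> \<beta> * \<rho> ^ (k - i)"
proof -
  let ?m = "margin TYPE('n)"
  have m: "?m > 0" by (rule margin_pos)
  obtain j where k: "k = i + j" using ik by (auto simp: le_iff_add)
  have "2 * t / (?m * (3 / 4) ^ (k - i) * (L / 2 ^ i)) \<le> 2 * (L / 2 ^ k) / (?m * (3 / 4) ^ (k - i) * (L / 2 ^ i))"
    using t L m by (intro divide_right_mono mult_left_mono) auto
  also have "\<dots> = 2 / ?m * ((1 / 2) ^ j / (3 / 4) ^ j)"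
    using L m by (simp add: k power_add field_simps)
  also have "(1 / 2 :: real) ^ j / (3 / 4) ^ j = (2 / 3) ^ j"
    unfolding power_divide[symmetric] by simp
  finally have "(2 * t / (?m * (3 / 4) ^ (k - i) * (L / 2 ^ i))) powr (\<alpha> / 2) \<le> (2 / ?m * (2 / 3) ^ j) powr (\<alpha> / 2)"
    using t L m alpha_pos by (intro powr_mono2) auto
  also have "\<dots> = (2 / ?m) powr (\<alpha> / 2) * ((2 / 3) ^ j) powr (\<alpha> / 2)"
    by (rule powr_mult)
  also have "\<dots> = \<beta> * \<rho> ^ (k - i)"
    by (simp add: \<beta>_def \<rho>_def k power_powr_swap)
  finally show ?thesis .
qed

definition pack_const :: ennreal
  where "pack_const = 2 * C0 + 2 * ((ennreal C1)\<^sup>2 * (ennreal \<beta> * schur_const)\<^sup>2) * ennreal (1 / (1 - \<rho>))"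

lemma pack_const_finite: "pack_const < \<infinity>"
  using C0_finite schur_const_finite unfolding pack_const_def
  by (simp add: ennreal_mult_less_top power2_eq_square)

definition carleson_density :: "real \<Rightarrow> real \<Rightarrow> nat \<Rightarrow> real ^ 'n \<Rightarrow> ennreal"
  where "carleson_density w L k x = (\<integral>\<^sup>+t. scale_weight (L / 2 ^ k) t * sq (theta_ext (\<lambda>_. 1) t x)
     * good_ind w L k x \<partial>lborel)"

lemma carleson_density_measurable [measurable]: "carleson_density w L k \<in> borel_measurable borel"
proof -
  note [measurable] = theta_ext_measurable[of "\<lambda>_. 1", simplified]
  have [measurable]: "{x. good w L k x} \<in> sets (borel :: (real ^ 'n) measure)" by measurable
  show ?thesis unfolding carleson_density_def[abs_def] by measurable
qed

text \<open>On the cell \<open>Q\<close>, \<open>\<theta>\<^sub>t 1\<close> is split into \<open>\<theta>\<^sub>t \<chi>\<^sub>Q\<close> and \<open>\<theta>\<^sub>t\<close> of the indicator of the complement. The first is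
bounded by the testing condition, since the scales \<open>k \<ge> i\<close> fill the interval \<open>(0, L/2\<^sup>i)\<close> at most once;
the square of the second is at most a constant times \<open>\<rho> ^ (k - i)\<close> at good points.\<close>

lemma packing:
  assumes L: "L > 0" and iN: "i \<le> N"
  shows "(\<integral>\<^sup>+x. (\<Sum>k=i..N. carleson_density w L k x) * indicator {x. level w L i x = z} x \<partial>\<mu>)
    \<le> pack_const * emeasure \<mu> {x. level w L i x = z}"
proof -
  define Q where "Q = {x :: real ^ 'n. level w L i x = z}"
  have Qm [measurable]: "Q \<in> sets borel" unfolding Q_def by (rule cell_measurable)
  have li: "L / 2 ^ i > 0" using L by simp
  define gQ gC :: "real ^ 'n \<Rightarrow> complex" where "gQ = indicator Q" and "gC = indicator (- Q)"
  have gQm [measurable]: "gQ \<in> borel_measurable borel" "gC \<in> borel_measurable borel"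
    unfolding gQ_def gC_def by auto
  note [measurable] = theta_ext_measurable[OF gQm(1)]
  define v where "v = (ennreal C1)\<^sup>2 * (ennreal \<beta> * schur_const)\<^sup>2"
  let ?part = "\<lambda>k x. \<integral>\<^sup>+t. 2 * (scale_weight (L / 2 ^ k) t * (sq (theta_ext gQ t x) * indicator Q x)) \<partial>lborel"
  let ?box = "\<lambda>x. \<integral>\<^sup>+t. sq (theta_ext gQ t x) * ennreal (1 / t) * indicator (Q \<times> {0<..<L / 2 ^ i}) (x, t) \<partial>lborel"
  have point: "sq (theta_ext (\<lambda>_. 1) t x)
      \<le> 2 * sq (theta_ext gQ t x) + 2 * v * ennreal (\<rho> ^ (k - i))"
    if x: "x \<in> Q" "good w L k x" and k: "i \<le> k" and t: "0 < t" "t < L / 2 ^ k" for x k t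
  proof -
    define d where "d = margin TYPE('n) * (3 / 4) ^ (k - i) * (L / 2 ^ i)"
    have d: "d > 0" using L margin_pos[where 'n='n] by (simp add: d_def)
    have ik: "integrable \<mu> (\<lambda>y. s t x y * gQ y)" "integrable \<mu> (\<lambda>y. s t x y * gC y)"
    proof -
      note [measurable] = kernel_section_measurable[OF t(1)]
      show "integrable \<mu> (\<lambda>y. s t x y * gQ y)" "integrable \<mu> (\<lambda>y. s t x y * gC y)"
        by (rule Bochner_Integration.integrable_bound[OF integrable_kernel[OF t(1), of x]],
            measurable, simp add: gQ_def gC_def indicator_def)+
    qed
    have "theta_ext (\<lambda>_. 1) t x = theta_ext gQ t x + theta_ext gC t x"
    proof -
      have "(LINT y|\<mu>. s t x y * 1) = (LINT y|\<mu>. s t x y * gQ y + s t x y * gC y)"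
        by (intro Bochner_Integration.integral_cong) (auto simp: gQ_def gC_def indicator_def)
      then show ?thesis using ik t by (simp add: theta_ext_eq theta_def)
    qed
    then have "cmod (theta_ext (\<lambda>_. 1) t x) \<le> cmod (theta_ext gQ t x) + cmod (theta_ext gC t x)" by (simp add: norm_triangle_ineq)
    then have "(cmod (theta_ext (\<lambda>_. 1) t x))\<^sup>2 \<le> (cmod (theta_ext gQ t x) + cmod (theta_ext gC t x))\<^sup>2" by (intro power_mono) auto
    also have "\<dots> \<le> 2 * (cmod (theta_ext gQ t x))\<^sup>2 + 2 * (cmod (theta_ext gC t x))\<^sup>2"
      by (rule power2_sum_le)
    finally have "sq (theta_ext (\<lambda>_. 1) t x) \<le> ennreal (2 * (cmod (theta_ext gQ t x))\<^sup>2 + 2 * (cmod (theta_ext gC t x))\<^sup>2)"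
      by (rule ennreal_leI)
    also have "\<dots> = 2 * sq (theta_ext gQ t x) + 2 * (ennreal (cmod (theta_ext gC t x)))\<^sup>2"
      by (simp add: ennreal_mult ennreal_power)
    also have "(ennreal (cmod (theta_ext gC t x)))\<^sup>2 \<le> v * ennreal (\<rho> ^ (k - i))"
    proof -
      have "ennreal (cmod (theta_ext gC t x)) \<le> ennreal C1 * (ennreal (gain t d) * schur_const)"
        unfolding theta_ext_eq[OF t(1)]
      proof (rule theta_tail_bound[OF t(1) d gQm(2)])
        show "cmod (gC y) \<le> 1" for y by (simp add: gC_def indicator_def)
        fix y assume y: "infnorm (x - y) < d"
        have "deep w (L / 2 ^ i) (margin TYPE('n) * (3 / 4) ^ (k - i)) x"
          using x(2) k by (simp add: good_def)
        from deep_cell_index[OF li this y[unfolded d_def]] have "y \<in> Q" using x(1) by (simp add: Q_def)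
        then show "gC y = 0" by (simp add: gC_def)
      qed
      also have "\<dots> \<le> ennreal C1 * (ennreal (\<beta> * \<rho> ^ (k - i)) * schur_const)"
        unfolding d_def by (intro mult_left_mono mult_right_mono ennreal_leI scale_ratio L k t) auto
      finally have "(ennreal (cmod (theta_ext gC t x)))\<^sup>2 \<le> (ennreal C1 * (ennreal (\<beta> * \<rho> ^ (k - i)) * schur_const))\<^sup>2"
        by (intro power_mono) auto
      also have "\<dots> = v * ennreal (\<rho> ^ (k - i)) * ennreal (\<rho> ^ (k - i))"
        using \<beta>_nonneg \<rho>_bounds by (simp add: v_def ennreal_mult power2_eq_square mult.assoc mult.left_commute mult.commute)
      also have "\<dots> \<le> v * ennreal (\<rho> ^ (k - i)) * 1"
        using \<rho>_bounds by (intro mult_left_mono) (auto simp: power_le_one)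
      finally show ?thesis by simp
    qed
    finally show ?thesis by (simp add: mult.assoc add_left_mono mult_left_mono)
  qed
  have hk: "carleson_density w L k x * indicator Q x
      \<le> ?part k x
        + 2 * v * ennreal (\<rho> ^ (k - i)) * indicator Q x" if k: "i \<le> k" for k x
  proof (cases "x \<in> Q \<and> good w L k x")
    case True
    have lk: "L / 2 ^ k > 0" using L by simp
    have "carleson_density w L k x * indicator Q x = (\<integral>\<^sup>+t. scale_weight (L / 2 ^ k) t * sq (theta_ext (\<lambda>_. 1) t x) \<partial>lborel)"
      using True by (simp add: carleson_density_def)
    also have "\<dots> \<le> (\<integral>\<^sup>+t. 2 * (scale_weight (L / 2 ^ k) t * (sq (theta_ext gQ t x) * indicator Q x))
        + scale_weight (L / 2 ^ k) t * (2 * v * ennreal (\<rho> ^ (k - i))) \<partial>lborel)"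
    proof (rule nn_integral_mono)
      fix t
      show "scale_weight (L / 2 ^ k) t * sq (theta_ext (\<lambda>_. 1) t x)
        \<le> 2 * (scale_weight (L / 2 ^ k) t * (sq (theta_ext gQ t x) * indicator Q x))
        + scale_weight (L / 2 ^ k) t * (2 * v * ennreal (\<rho> ^ (k - i)))"
      proof (cases "L / 2 ^ k / 2 \<le> t \<and> t < L / 2 ^ k")
        case t: True
        have "0 < L / 2 ^ k / 2" using lk by simp
        with t have t': "0 < t" "t < L / 2 ^ k" by (auto intro: less_le_trans)
        have "scale_weight (L / 2 ^ k) t * sq (theta_ext (\<lambda>_. 1) t x)
          \<le> scale_weight (L / 2 ^ k) t * (2 * sq (theta_ext gQ t x) + 2 * v * ennreal (\<rho> ^ (k - i)))"
          using True by (intro mult_left_mono point k t') auto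
        then show ?thesis using True by (simp add: distrib_left mult.left_commute)
      next
        case False
        then have "scale_weight (L / 2 ^ k) t = 0" unfolding scale_weight_def by (rule if_not_P)
        then show ?thesis by simp
      qed
    qed
    also have "\<dots> = ?part k x
        + (\<integral>\<^sup>+t. scale_weight (L / 2 ^ k) t \<partial>lborel) * (2 * v * ennreal (\<rho> ^ (k - i)))"
      by (subst nn_integral_add; (subst nn_integral_multc)?) auto
    also have "\<dots> \<le> ?part k x
        + 1 * (2 * v * ennreal (\<rho> ^ (k - i)))"
      by (intro add_left_mono mult_right_mono scale_weight_integral lk) auto
    finally show ?thesis using True by simp
  next
    case False
    then show ?thesis by (auto simp: carleson_density_def indicator_def)
  qed
  have "(\<integral>\<^sup>+x. (\<Sum>k=i..N. carleson_density w L k x) * indicator Q x \<partial>\<mu>)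
    \<le> (\<integral>\<^sup>+x. (\<Sum>k=i..N. ?part k x
        + 2 * v * ennreal (\<rho> ^ (k - i)) * indicator Q x) \<partial>\<mu>)"
    unfolding sum_distrib_right by (intro nn_integral_mono sum_mono hk) auto
  also have "\<dots> \<le> (\<integral>\<^sup>+x. 2 * ?box x
        + 2 * v * ennreal (1 / (1 - \<rho>)) * indicator Q x \<partial>\<mu>)"
  proof (rule nn_integral_mono)
    fix x
    have "(\<Sum>k=i..N. ?part k x)
      = (\<integral>\<^sup>+t. (\<Sum>k=i..N. 2 * (scale_weight (L / 2 ^ k) t * (sq (theta_ext gQ t x) * indicator Q x))) \<partial>lborel)"
      by (rule nn_integral_sum[symmetric]) measurable
    also have "\<dots> = (\<integral>\<^sup>+t. 2 * ((\<Sum>k=i..N. scale_weight (L / 2 ^ k) t) * (sq (theta_ext gQ t x) * indicator Q x)) \<partial>lborel)"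
      by (simp add: sum_distrib_left sum_distrib_right)
    also have "\<dots> \<le> (\<integral>\<^sup>+t. 2 * ((ennreal (1 / t) * indicator {0<..<L / 2 ^ i} t) * (sq (theta_ext gQ t x) * indicator Q x)) \<partial>lborel)"
      by (intro nn_integral_mono mult_left_mono mult_right_mono sum_scale_weight_le L) auto
    also have "\<dots> = (\<integral>\<^sup>+t. 2 * (sq (theta_ext gQ t x) * ennreal (1 / t) * indicator (Q \<times> {0<..<L / 2 ^ i}) (x, t)) \<partial>lborel)"
      by (intro nn_integral_cong) (auto simp: indicator_def mult.commute)
    also have "\<dots> = 2 * ?box x"
    proof (rule nn_integral_cmult)
      have "(\<lambda>t. sq (theta_ext gQ t x) * ennreal (1 / t) * (indicator Q x * indicator {0<..<L / 2 ^ i} t)) \<in> borel_measurable lborel"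
        by measurable
      then show "(\<lambda>t. sq (theta_ext gQ t x) * ennreal (1 / t) * indicator (Q \<times> {0<..<L / 2 ^ i}) (x, t)) \<in> borel_measurable lborel"
        by (simp add: indicator_times)
    qed
    finally have 1: "(\<Sum>k=i..N. ?part k x)
      \<le> 2 * ?box x" .
    have "(\<Sum>k=i..N. 2 * v * ennreal (\<rho> ^ (k - i)) * indicator Q x) = 2 * v * (\<Sum>k=i..N. ennreal (\<rho> ^ (k - i))) * indicator Q x"
      by (simp add: sum_distrib_left sum_distrib_right)
    also have "(\<Sum>k=i..N. ennreal (\<rho> ^ (k - i))) = ennreal (\<Sum>k=i..N. \<rho> ^ (k - i))"
      using \<rho>_bounds by (intro sum_ennreal) auto
    also have "\<dots> \<le> ennreal (1 / (1 - \<rho>))"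
    proof (rule ennreal_leI)
      have "(\<Sum>k=i..N. \<rho> ^ (k - i)) = (\<Sum>j\<le>N - i. \<rho> ^ j)"
        using iN by (intro sum.reindex_bij_witness[of _ "\<lambda>j. j + i" "\<lambda>k. k - i"]) auto
      also have "\<dots> \<le> 1 / (1 - \<rho>)" using \<rho>_bounds by (intro geometric_partial_sum_le) auto
      finally show "(\<Sum>k=i..N. \<rho> ^ (k - i)) \<le> 1 / (1 - \<rho>)" .
    qed
    finally have 2: "(\<Sum>k=i..N. 2 * v * ennreal (\<rho> ^ (k - i)) * indicator Q x)
      \<le> 2 * v * ennreal (1 / (1 - \<rho>)) * indicator Q x"
      by (simp add: mult_left_mono mult_right_mono)
    show "(\<Sum>k=i..N. ?part k x
        + 2 * v * ennreal (\<rho> ^ (k - i)) * indicator Q x)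
      \<le> 2 * ?box x
        + 2 * v * ennreal (1 / (1 - \<rho>)) * indicator Q x"
      unfolding sum.distrib by (intro add_mono 1 2)
  qed
  also have "\<dots> = 2 * square_integral \<mu> s gQ (Q \<times> {0<..<L / 2 ^ i}) + 2 * v * ennreal (1 / (1 - \<rho>)) * emeasure \<mu> Q"
  proof -
    have QA: "Q \<times> {0<..<L / 2 ^ i} \<in> sets (borel \<Otimes>\<^sub>M borel)" by (intro pair_measureI) auto
    note [measurable] = QA
    have [measurable]: "(\<lambda>x. \<integral>\<^sup>+t. sq (theta_ext gQ t x) * ennreal (1 / t) * indicator (Q \<times> {0<..<L / 2 ^ i}) (x, t) \<partial>lborel) \<in> borel_measurable \<mu>"
      by measurable
    show ?thesis
      by (subst square_integral_iterated[OF gQm(1) QA])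
        (auto simp: nn_integral_add nn_integral_cmult nn_integral_cmult_indicator)
  qed
  also have "\<dots> \<le> 2 * (C0 * emeasure \<mu> Q) + 2 * v * ennreal (1 / (1 - \<rho>)) * emeasure \<mu> Q"
    unfolding gQ_def Q_def by (intro add_right_mono mult_left_mono testing_half_open_cell li) auto
  also have "\<dots> = pack_const * emeasure \<mu> Q"
    by (simp add: pack_const_def v_def distrib_right mult.assoc)
  finally show ?thesis unfolding Q_def .
qed

end

section \<open>The martingale expansion at good points\<close>

definition gap :: "nat \<Rightarrow> nat \<Rightarrow> nat" where "gap k i = (k - i) + (i - k)"

lemma gap_commute: "gap k i = gap i k" by (simp add: gap_def)

lemma sum_power_gap_le:
  fixes r :: real assumes r: "0 \<le> r" "r < 1"
  shows "(\<Sum>i\<le>n. r ^ gap k i) \<le> 2 / (1 - r)"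
proof -
  have "(\<Sum>i\<le>n. r ^ gap k i) \<le> (\<Sum>i\<in>{..k} \<union> {k..k + n}. r ^ gap k i)"
    using r by (intro sum_mono2) auto
  also have "\<dots> \<le> (\<Sum>i\<le>k. r ^ gap k i) + (\<Sum>i=k..k + n. r ^ gap k i)"
  proof -
    have "0 \<le> (\<Sum>i\<in>{..k} \<inter> {k..k + n}. r ^ gap k i)" using r by (intro sum_nonneg) auto
    moreover have "(\<Sum>i\<in>{..k} \<union> {k..k + n}. r ^ gap k i) + (\<Sum>i\<in>{..k} \<inter> {k..k + n}. r ^ gap k i)
        = (\<Sum>i\<le>k. r ^ gap k i) + (\<Sum>i=k..k + n. r ^ gap k i)"
      by (rule sum.union_inter) auto
    ultimately show ?thesis by linarith
  qed
  also have "(\<Sum>i\<le>k. r ^ gap k i) = (\<Sum>j\<le>k. r ^ j)"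
    by (intro sum.reindex_bij_witness[of _ "\<lambda>j. k - j" "\<lambda>i. k - i"]) (auto simp: gap_def)
  also have "(\<Sum>i=k..k + n. r ^ gap k i) = (\<Sum>j\<le>n. r ^ j)"
    by (intro sum.reindex_bij_witness[of _ "\<lambda>j. k + j" "\<lambda>i. i - k"]) (auto simp: gap_def)
  also have "(\<Sum>j\<le>k. r ^ j) + (\<Sum>j\<le>n. r ^ j) \<le> 1 / (1 - r) + 1 / (1 - r)"
    using r by (intro add_mono geometric_partial_sum_le)
  finally show ?thesis by simp
qed

text \<open>The Cauchy--Schwarz inequality with weights, which keeps geometric decay of the summands visible
in a sum of squares.\<close>

lemma norm_sum_squared_weighted:
  fixes U :: "nat \<Rightarrow> complex" and b :: "nat \<Rightarrow> real"
  assumes fin: "finite I" and b: "\<And>i. i \<in> I \<Longrightarrow> b i > 0" and B: "(\<Sum>i\<in>I. b i) \<le> B"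
  shows "(cmod (\<Sum>i\<in>I. U i))\<^sup>2 \<le> B * (\<Sum>i\<in>I. (cmod (U i))\<^sup>2 / b i)"
proof -
  have "(cmod (\<Sum>i\<in>I. U i))\<^sup>2 \<le> (\<Sum>i\<in>I. cmod (U i))\<^sup>2"
    by (intro power_mono norm_sum) auto
  also have "(\<Sum>i\<in>I. cmod (U i)) = (\<Sum>i\<in>I. sqrt (b i) * (cmod (U i) / sqrt (b i)))"
    using b by (intro sum.cong refl) (auto simp: less_imp_neq[symmetric])
  also have "(\<Sum>i\<in>I. sqrt (b i) * (cmod (U i) / sqrt (b i)))\<^sup>2
      \<le> (\<Sum>i\<in>I. (sqrt (b i))\<^sup>2) * (\<Sum>i\<in>I. (cmod (U i) / sqrt (b i))\<^sup>2)"
    by (rule Cauchy_Schwarz_ineq_sum)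
  also have "\<dots> = (\<Sum>i\<in>I. b i) * (\<Sum>i\<in>I. (cmod (U i))\<^sup>2 / b i)"
    using b by (auto simp: power_divide less_imp_le intro!: arg_cong2[where f="(*)"] sum.cong)
  also have "\<dots> \<le> B * (\<Sum>i\<in>I. (cmod (U i))\<^sup>2 / b i)"
    using b by (intro mult_right_mono B sum_nonneg divide_nonneg_nonneg) (auto intro: less_imp_le)
  finally show ?thesis .
qed

lemma L2I: "f \<in> borel_measurable M \<Longrightarrow> integrable M (\<lambda>x. (cmod (f x))\<^sup>2) \<Longrightarrow> f \<in> L2 M"
  by (simp add: L2_def)

lemma L2_diff:
  assumes f: "f \<in> L2 M" and g: "g \<in> L2 M" shows "(\<lambda>x. f x - g x) \<in> L2 M"
proof (rule L2I)
  note [measurable] = L2D(1)[OF f] L2D(1)[OF g]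
  show "(\<lambda>x. f x - g x) \<in> borel_measurable M" by measurable
  show "integrable M (\<lambda>x. (cmod (f x - g x))\<^sup>2)"
  proof (rule Bochner_Integration.integrable_bound)
    show "integrable M (\<lambda>x. 2 * (cmod (f x))\<^sup>2 + 2 * (cmod (g x))\<^sup>2)"
      using L2D(2)[OF f] L2D(2)[OF g] by auto
    have "(cmod (f x - g x))\<^sup>2 \<le> 2 * (cmod (f x))\<^sup>2 + 2 * (cmod (g x))\<^sup>2" for x
    proof -
      have "(cmod (f x - g x))\<^sup>2 \<le> (cmod (f x) + cmod (g x))\<^sup>2"
        by (intro power_mono norm_triangle_ineq4) auto
      also have "\<dots> \<le> 2 * (cmod (f x))\<^sup>2 + 2 * (cmod (g x))\<^sup>2"
        by (rule power2_sum_le)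
      finally show ?thesis .
    qed
    then show "AE x in M. norm ((cmod (f x - g x))\<^sup>2) \<le> norm (2 * (cmod (f x))\<^sup>2 + 2 * (cmod (g x))\<^sup>2)"
      by (intro AE_I2) simp
  qed measurable
qed

context upper_doubling
begin

definition level_avg :: "real \<Rightarrow> real \<Rightarrow> nat \<Rightarrow> (real ^ 'n \<Rightarrow> complex) \<Rightarrow> nat \<Rightarrow> real ^ 'n \<Rightarrow> complex"
  where "level_avg w L N f i = (if i \<le> N then cell_avg \<mu> (level w L i) f else f)"

text \<open>The martingale differences of \<open>f\<close>, completed to a finite decomposition of \<open>f\<close>: the first piece is
the coarsest average and the piece of index \<open>N + 1\<close> is what the finest average misses.\<close>

definition piece :: "real \<Rightarrow> real \<Rightarrow> nat \<Rightarrow> (real ^ 'n \<Rightarrow> complex) \<Rightarrow> nat \<Rightarrow> real ^ 'n \<Rightarrow> complex"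
  where "piece w L N f i x = (case i of 0 \<Rightarrow> level_avg w L N f 0 x
    | Suc j \<Rightarrow> level_avg w L N f (Suc j) x - level_avg w L N f j x)"

lemma sum_piece: "(\<Sum>i\<le>k. piece w L N f i x) = level_avg w L N f k x"
  by (induction k) (auto simp: piece_def)

context
  fixes w L :: real and N :: nat and f :: "real ^ 'n \<Rightarrow> complex"
  assumes L: "L > 0" and f: "f \<in> L2 \<mu>"
begin

lemma level_partition: "countable_partition \<mu> (level w L i)"
  by (rule cell_index_partition) (use L in simp)

lemma level_avg_L2: "level_avg w L N f i \<in> L2 \<mu>"
proof (cases "i \<le> N")
  case True
  interpret countable_partition \<mu> "level w L i" by (rule level_partition)
  show ?thesis
    using True integrable_cell_avg[OF L2D[OF f]] by (auto simp: level_avg_def intro!: L2I)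
qed (simp add: level_avg_def f)

lemma piece_L2: "piece w L N f i \<in> L2 \<mu>"
  using level_avg_L2 L2_diff[OF level_avg_L2 level_avg_L2]
  by (cases i) (simp_all add: piece_def[abs_def])

lemma level_avg_cell_integral:
  assumes ij: "j \<le> i"
  shows "(LINT y|\<mu>. indicator {y. level w L j y = z} y *\<^sub>R level_avg w L N f i y)
    = (LINT y|\<mu>. indicator {y. level w L j y = z} y *\<^sub>R f y)"
proof (cases "i \<le> N")
  case True
  interpret P: countable_partition \<mu> "level w L i" by (rule level_partition)
  interpret Q: countable_partition \<mu> "level w L j" by (rule level_partition)
  have coarse: "level w L j x = level w L j y"
    if "level w L i x = level w L i y" for x y :: "real ^ 'n"
    using ij that
  proof (induction i rule: dec_induct)
    case (step n)
    show ?case by (rule step.IH[OF cell_index_refine[OF step.prems]])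
  qed
  have "(LINT y|\<mu>. indicator {y. level w L j y = z} y *\<^sub>R cell_avg \<mu> (level w L i) f y)
    = (LINT y|\<mu>. indicator {y. level w L j y = z} y *\<^sub>R f y)"
  proof (rule P.integral_cell_avg_saturated[OF L2D[OF f]])
    show "Measurable.pred \<mu> (\<lambda>x. x \<in> {y. level w L j y = z})"
      using Q.p_measurable by simp
    show "emeasure \<mu> {x \<in> space \<mu>. x \<in> {y. level w L j y = z}} < \<infinity>"
      using Q.cell_finite[of z] by simp
  qed (auto dest: coarse)
  then show ?thesis using True by (simp add: level_avg_def)
qed (simp add: level_avg_def)

lemma level_avg_tower:
  assumes "j < i" "j \<le> N"
  shows "cell_avg \<mu> (level w L j) (level_avg w L N f i) = level_avg w L N f j"
  using level_avg_cell_integral[of j i] assms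
  by (intro ext) (simp add: cell_avg_def level_avg_def[of w L N f j])

lemma piece_mean_zero:
  assumes j: "j \<le> N"
  shows "(LINT y|\<mu>. indicator {y. level w L j y = z} y *\<^sub>R piece w L N f (Suc j) y) = 0"
proof -
  interpret Q: countable_partition \<mu> "level w L j" by (rule level_partition)
  have "(LINT y|\<mu>. indicator {y. level w L j y = z} y *\<^sub>R piece w L N f (Suc j) y)
    = (LINT y|\<mu>. indicator {y. level w L j y = z} y *\<^sub>R level_avg w L N f (Suc j) y)
      - (LINT y|\<mu>. indicator {y. level w L j y = z} y *\<^sub>R level_avg w L N f j y)"
    unfolding piece_def nat.case scaleR_diff_right
    by (rule Bochner_Integration.integral_diff; rule Q.square_integrable_cell(1)[OF L2D[OF level_avg_L2]])
  also have "\<dots> = 0" using level_avg_cell_integral[of j "Suc j"] level_avg_cell_integral[of j j] by simp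
  finally show ?thesis .
qed

text \<open>Each step is the orthogonal decomposition of the average of generation \<open>j + 1\<close>, whose average over
the coarser cells is that of generation \<open>j\<close> by the tower property.\<close>

lemma sum_sqnorm_piece: "(\<Sum>i\<le>Suc N. sqnorm \<mu> (piece w L N f i)) = sqnorm \<mu> f"
proof -
  have "(\<Sum>i\<le>j. sqnorm \<mu> (piece w L N f i)) = sqnorm \<mu> (level_avg w L N f j)" if "j \<le> Suc N" for j
    using that
  proof (induction j)
    case 0
    then show ?case by (simp add: piece_def[abs_def])
  next
    case (Suc j)
    interpret countable_partition \<mu> "level w L j" by (rule level_partition)
    have t: "cell_avg \<mu> (level w L j) (level_avg w L N f (Suc j)) = level_avg w L N f j"
      using Suc.prems by (intro level_avg_tower) auto
    show ?case
      using Suc cell_avg_pythagoras[OF L2D[OF level_avg_L2[of "Suc j"]]] unfolding t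
      by (simp add: sqnorm_def piece_def)
  qed
  from this[of "Suc N"] show ?thesis by (simp add: level_avg_def)
qed

lemma piece_constant:
  assumes i: "i \<le> N" and xy: "level w L i y = level w L i x"
  shows "piece w L N f i y = piece w L N f i x"
proof -
  have avg: "level_avg w L N f j y = level_avg w L N f j x"
    if "j \<le> N" "level w L j y = level w L j x" for j
    using that(1) by (simp only: level_avg_def if_True cell_avg_def that(2))
  show ?thesis
  proof (cases i)
    case 0
    then show ?thesis using avg[of 0] i xy by (simp only: piece_def nat.case)
  next
    case (Suc j)
    have "level w L j y = level w L j x"
      using xy unfolding Suc by (rule cell_index_refine)
    then have "level_avg w L N f j y = level_avg w L N f j x" using i Suc by (intro avg) auto
    then show ?thesis using avg[OF i xy] unfolding Suc by (simp only: piece_def nat.case)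
  qed
qed

end

end

context square_function_testing
begin

definition \<sigma> :: real where "\<sigma> = sqrt \<rho>"

lemma \<sigma>_bounds: "0 < \<sigma>" "\<sigma> < 1" and \<rho>_eq: "\<rho> = \<sigma> * \<sigma>"
  using \<rho>_bounds by (auto simp: \<sigma>_def)

definition remainder_const :: ennreal
  where "remainder_const = (ennreal C1)\<^sup>2 * schur_const\<^sup>2 * (4 * ennreal \<beta> + ennreal (16 powr \<alpha>))"

abbreviation (input) remainder_term :: "real \<Rightarrow> real \<Rightarrow> nat \<Rightarrow> (real ^ 'n \<Rightarrow> complex) \<Rightarrow> nat \<Rightarrow> nat \<Rightarrow> ennreal"
  where "remainder_term w L N f k i \<equiv>
    ennreal (2 / (1 - \<sigma>)) * remainder_const * ennreal (\<sigma> ^ gap k i) * sqnorm \<mu> (piece w L N f i)"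

lemma remainder_const_finite: "remainder_const < \<infinity>"
  using schur_const_finite unfolding remainder_const_def
  by (simp add: ennreal_mult_less_top power2_eq_square)

context
  fixes w L :: real and N :: nat and f :: "real ^ 'n \<Rightarrow> complex"
  assumes L: "L > 0" and f: "f \<in> L2 \<mu>"
begin

text \<open>The contribution of one piece to \<open>\<theta>\<^sub>t f - \<theta>\<^sub>t 1 \<cdot> E\<^sub>k f\<close>: averaging over cells of generation \<open>k\<close>
keeps the pieces with \<open>i \<le> k\<close> and annihilates the others.\<close>

definition term_at :: "nat \<Rightarrow> nat \<Rightarrow> real \<Rightarrow> real ^ 'n \<Rightarrow> complex"
  where "term_at k i t x = theta \<mu> s t (piece w L N f i) x
    - (if i \<le> k then theta \<mu> s t (\<lambda>_. 1) x * piece w L N f i x else 0)"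

lemma sum_term_at:
  assumes k: "k \<le> N" and t: "t > 0"
  shows "(\<Sum>i\<le>Suc N. term_at k i t x)
    = theta \<mu> s t f x - theta \<mu> s t (\<lambda>_. 1) x * cell_avg \<mu> (level w L k) f x"
proof -
  have "(\<Sum>i\<le>Suc N. theta \<mu> s t (piece w L N f i) x) = (LINT y|\<mu>. (\<Sum>i\<le>Suc N. s t x y * piece w L N f i y))"
    unfolding theta_def
    by (intro Bochner_Integration.integral_sum[symmetric] integrable_kernel_L2[OF t] piece_L2[OF L f])
  also have "\<dots> = theta \<mu> s t f x"
    unfolding theta_def sum_distrib_left[symmetric] sum_piece by (simp add: level_avg_def)
  finally have 1: "(\<Sum>i\<le>Suc N. theta \<mu> s t (piece w L N f i) x) = theta \<mu> s t f x" .
  have "(\<Sum>i\<le>Suc N. if i \<le> k then theta \<mu> s t (\<lambda>_. 1) x * piece w L N f i x else 0)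
      = (\<Sum>i\<le>k. theta \<mu> s t (\<lambda>_. 1) x * piece w L N f i x)"
    using k by (intro sum.mono_neutral_cong_right) auto
  also have "\<dots> = theta \<mu> s t (\<lambda>_. 1) x * cell_avg \<mu> (level w L k) f x"
    unfolding sum_distrib_left[symmetric] sum_piece using k by (simp add: level_avg_def)
  finally show ?thesis unfolding term_at_def sum_subtractf 1 by simp
qed

text \<open>For \<open>i \<le> k\<close> the piece is constant near every good point. For \<open>i > k\<close> it has mean zero on cells of
sidelength \<open>L / 2\<^bsup>i-1\<^esup>\<close>; this is small enough compared with \<open>t\<close> for the regularity of the kernel if
\<open>i - k > 2\<close>, and for the remaining \<open>i\<close> no gain is needed, so the size estimate suffices.\<close>

lemma term_at_L2_bound:
  assumes k: "k \<le> N" and i: "i \<le> Suc N" and t: "L / 2 ^ k / 2 \<le> t" "t < L / 2 ^ k"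
  shows "(\<integral>\<^sup>+x. sq (term_at k i t x) * good_ind w L k x \<partial>\<mu>)
    \<le> remainder_const * ennreal (\<rho> ^ gap k i) * sqnorm \<mu> (piece w L N f i)"
proof -
  have lk: "L / 2 ^ k / 2 > 0" using L by simp
  have t0: "t > 0" using t(1) lk by (rule less_le_trans[rotated])
  show ?thesis
  proof (cases "i \<le> k")
    case True
    define d where "d = margin TYPE('n) * (3 / 4) ^ (k - i) * (L / 2 ^ i)"
    have d: "d > 0" using L margin_pos[where 'n='n] by (simp add: d_def)
    have "(\<integral>\<^sup>+x. sq (term_at k i t x) * good_ind w L k x \<partial>\<mu>)
      \<le> 4 * (ennreal C1)\<^sup>2 * ennreal (gain t d) * schur_const\<^sup>2 * sqnorm \<mu> (piece w L N f i)"
      unfolding term_at_def using True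
    proof (simp only: if_True, intro theta_coarse_L2[OF t0 d piece_L2[OF L f]])
      fix x y :: "real ^ 'n" assume x: "x \<in> {x. good w L k x}" and xy: "infnorm (x - y) < d"
      have "deep w (L / 2 ^ i) (margin TYPE('n) * (3 / 4) ^ (k - i)) x"
        using x True by (simp add: good_def)
      from deep_cell_index[OF _ this xy[unfolded d_def]] L
      have "level w L i y = level w L i x" by simp
      then show "piece w L N f i y = piece w L N f i x"
        using True k by (intro piece_constant[OF L f]) auto
    qed
    also have "\<dots> \<le> 4 * (ennreal C1)\<^sup>2 * ennreal (\<beta> * \<rho> ^ (k - i)) * schur_const\<^sup>2 * sqnorm \<mu> (piece w L N f i)"
      unfolding d_def using True t0 t(2)
      by (intro mult_right_mono mult_left_mono ennreal_leI scale_ratio L) auto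
    also have "\<dots> = ((ennreal C1)\<^sup>2 * schur_const\<^sup>2 * (4 * ennreal \<beta> + 0)) * ennreal (\<rho> ^ gap k i) * sqnorm \<mu> (piece w L N f i)"
      using \<rho>_bounds \<beta>_nonneg True by (simp add: gap_def ennreal_mult mult_ac)
    also have "\<dots> \<le> remainder_const * ennreal (\<rho> ^ gap k i) * sqnorm \<mu> (piece w L N f i)"
      unfolding remainder_const_def by (intro mult_right_mono mult_left_mono add_left_mono) auto
    finally show ?thesis .
  next
    case False
    then obtain j where ij: "i = Suc j" and kj: "k \<le> j" by (cases i) auto
    define m where "m = i - k"
    define \<eta> where "\<eta> = C1 * (4 * (1 / 2) ^ m) powr \<alpha>"
    have g: "piece w L N f i \<in> L2 \<mu>" by (rule piece_L2[OF L f])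
    have lj: "L / 2 ^ j = 2 * (1 / 2) ^ m * (L / 2 ^ k)"
    proof -
      have "j = k + (m - 1)" "m > 0" using ij kj by (auto simp: m_def)
      then obtain m' where "m = Suc m'" "j = k + m'" by (cases m) auto
      then show ?thesis by (simp add: power_add power_divide)
    qed
    have pw: "ennreal (cmod (term_at k i t x)) \<le> ennreal \<eta> * (\<integral>\<^sup>+y. majorant t x y * ennreal (cmod (piece w L N f i y)) \<partial>\<mu>)" for x
    proof (cases "m \<le> 2")
      case True
      have "(1 / 2 :: real) ^ 2 \<le> (1 / 2) ^ m" using True by (intro power_decreasing) auto
      then have "1 \<le> 4 * (1 / 2 :: real) ^ m" by (simp add: power2_eq_square)
      then have "1 \<le> (4 * (1 / 2) ^ m) powr \<alpha>" using alpha_pos by (intro ge_one_powr_ge_zero) auto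
      then have "C1 * 1 \<le> \<eta>" unfolding \<eta>_def by (intro mult_left_mono C1_nonneg)
      then have "ennreal C1 \<le> ennreal \<eta>" by (intro ennreal_leI) simp
      have "ennreal (cmod (term_at k i t x)) \<le> ennreal C1 * (\<integral>\<^sup>+y. majorant t x y * ennreal (cmod (piece w L N f i y)) \<partial>\<mu>)"
        using False theta_pointwise[OF t0 g] by (simp add: term_at_def)
      also have "\<dots> \<le> ennreal \<eta> * (\<integral>\<^sup>+y. majorant t x y * ennreal (cmod (piece w L N f i y)) \<partial>\<mu>)"
        by (intro mult_right_mono \<open>ennreal C1 \<le> ennreal \<eta>\<close>) auto
      finally show ?thesis .
    next
      case m: False
      have "(1 / 2 :: real) ^ m \<le> (1 / 2) ^ 3" using m by (intro power_decreasing) auto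
      then have "2 * (1 / 2) ^ m * (L / 2 ^ k) \<le> 2 * (1 / 2) ^ 3 * (L / 2 ^ k)"
        using L by (intro mult_right_mono mult_left_mono) auto
      also have "\<dots> \<le> t / 2" using t(1) by (simp add: power3_eq_cube)
      finally have small: "L / 2 ^ j \<le> t / 2" unfolding lj .
      have "ennreal (cmod (term_at k i t x)) \<le> ennreal (C1 * (L / 2 ^ j / t) powr \<alpha>)
          * (\<integral>\<^sup>+y. majorant t x y * ennreal (cmod (piece w L N f i y)) \<partial>\<mu>)"
      proof -
        have "ennreal (cmod (theta \<mu> s t (piece w L N f i) x)) \<le> ennreal (C1 * (L / 2 ^ j / t) powr \<alpha>)
          * (\<integral>\<^sup>+y. majorant t x y * ennreal (cmod (piece w L N f i y)) \<partial>\<mu>)"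
        proof (rule theta_mean_zero_pointwise[OF t0 g level_partition[OF L f, of w j] _ small])
          show "infnorm (y - z) < L / 2 ^ j" if "level w L j y = level w L j z"
            for y z :: "real ^ 'n" using L by (intro same_cell_infnorm[OF _ that]) simp
          show "(LINT y|\<mu>. indicator {y. level w L j y = z} y *\<^sub>R piece w L N f i y) = 0" for z
            unfolding ij using i ij by (intro piece_mean_zero[OF L f]) simp
        qed
        then show ?thesis using False by (simp add: term_at_def)
      qed
      also have "\<dots> \<le> ennreal \<eta> * (\<integral>\<^sup>+y. majorant t x y * ennreal (cmod (piece w L N f i y)) \<partial>\<mu>)"
      proof (intro mult_right_mono ennreal_leI)
        have "L / 2 ^ j / t \<le> L / 2 ^ j / (L / 2 ^ k / 2)"
          using t(1) t0 lk L by (intro divide_left_mono mult_pos_pos) auto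
        also have "\<dots> = 4 * (1 / 2) ^ m" unfolding lj using L by simp
        finally show "C1 * (L / 2 ^ j / t) powr \<alpha> \<le> \<eta>"
          unfolding \<eta>_def using L t0 alpha_pos by (intro mult_left_mono powr_mono2 C1_nonneg) auto
      qed auto
      finally show ?thesis .
    qed
    have "(\<integral>\<^sup>+x. sq (term_at k i t x) * good_ind w L k x \<partial>\<mu>)
      \<le> (\<integral>\<^sup>+x. sq (term_at k i t x) \<partial>\<mu>)"
      by (intro nn_integral_mono) (auto simp: indicator_def)
    also have "\<dots> \<le> (ennreal \<eta>)\<^sup>2 * schur_const\<^sup>2 * sqnorm \<mu> (piece w L N f i)"
      by (rule smoothing_L2_bound[OF t0 g pw])
    also have "(ennreal \<eta>)\<^sup>2 \<le> (ennreal C1)\<^sup>2 * (ennreal (16 powr \<alpha>) * ennreal (\<rho> ^ gap k i))"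
    proof -
      have "\<eta>\<^sup>2 = C1\<^sup>2 * (16 powr \<alpha> * (((1 / 2) powr \<alpha>)\<^sup>2) ^ m)"
      proof -
        have "(4 * (1 / 2) ^ m) powr \<alpha> = 4 powr \<alpha> * ((1 / 2) powr \<alpha>) ^ m"
          by (subst powr_mult) (simp_all add: power_powr_swap)
        moreover have "(4 powr \<alpha>)\<^sup>2 = 16 powr \<alpha>" by (simp add: power2_eq_square flip: powr_mult)
        ultimately show ?thesis
          by (simp add: \<eta>_def power_mult_distrib power_mult[symmetric] mult.commute)
      qed
      also have "\<dots> \<le> C1\<^sup>2 * (16 powr \<alpha> * \<rho> ^ m)"
      proof (intro mult_left_mono power_mono)
        have "((1 / 2) powr \<alpha>)\<^sup>2 \<le> (1 / 2) powr \<alpha> * 1"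
          unfolding power2_eq_square using alpha_pos powr_mono2[of \<alpha> "1/2" 1] by (intro mult_left_mono) auto
        also have "\<dots> \<le> (1 / 2) powr (\<alpha> / 2)" using alpha_pos by (simp add: powr_mono')
        also have "\<dots> \<le> \<rho>" unfolding \<rho>_def using alpha_pos by (intro powr_mono2) auto
        finally show "((1 / 2) powr \<alpha>)\<^sup>2 \<le> \<rho>" .
      qed auto
      finally have "ennreal (\<eta>\<^sup>2) \<le> ennreal (C1\<^sup>2 * (16 powr \<alpha> * \<rho> ^ m))" by (rule ennreal_leI)
      moreover have "ennreal (\<eta>\<^sup>2) = (ennreal \<eta>)\<^sup>2" using C1_nonneg by (simp add: \<eta>_def ennreal_power)
      moreover have "ennreal (C1\<^sup>2 * (16 powr \<alpha> * \<rho> ^ m)) = (ennreal C1)\<^sup>2 * (ennreal (16 powr \<alpha>) * ennreal (\<rho> ^ m))"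
        using C1_nonneg \<rho>_bounds by (simp add: ennreal_mult ennreal_power)
      moreover have "gap k i = m" using False by (simp add: gap_def m_def)
      ultimately show ?thesis by simp
    qed
    also have "(ennreal C1)\<^sup>2 * (ennreal (16 powr \<alpha>) * ennreal (\<rho> ^ gap k i)) * schur_const\<^sup>2 * sqnorm \<mu> (piece w L N f i)
       = ((ennreal C1)\<^sup>2 * schur_const\<^sup>2 * (0 + ennreal (16 powr \<alpha>))) * ennreal (\<rho> ^ gap k i) * sqnorm \<mu> (piece w L N f i)"
      by (simp add: mult_ac)
    also have "\<dots> \<le> remainder_const * ennreal (\<rho> ^ gap k i) * sqnorm \<mu> (piece w L N f i)"
      unfolding remainder_const_def by (intro mult_right_mono mult_left_mono add_right_mono) auto
    finally show ?thesis by (simp add: mult_right_mono)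
  qed
qed

lemma term_at_measurable: "t > 0 \<Longrightarrow> term_at k i t \<in> borel_measurable borel"
proof -
  assume t: "t > 0"
  note [measurable] = L2_borel[OF piece_L2[OF L f]]
  note [measurable] = theta_slice_measurable[OF L2_borel[OF piece_L2[OF L f]] t]
    theta_slice_measurable[OF borel_measurable_const t]
  show ?thesis unfolding term_at_def[abs_def] by measurable
qed

text \<open>The available decay \<open>\<rho> = \<sigma> * \<sigma>\<close> is split evenly between the weights in Cauchy--Schwarz and the decay
that is left for the summation over \<open>k\<close>.\<close>

lemma remainder_at_scale:
  assumes k: "k \<le> N" and t: "L / 2 ^ k / 2 \<le> t" "t < L / 2 ^ k"
  shows "(\<integral>\<^sup>+x. sq (theta \<mu> s t f x
        - theta \<mu> s t (\<lambda>_. 1) x * cell_avg \<mu> (level w L k) f x)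
        * good_ind w L k x \<partial>\<mu>)
    \<le> (\<Sum>i\<le>Suc N. remainder_term w L N f k i)"
proof -
  have lk: "L / 2 ^ k / 2 > 0" using L by simp
  have t0: "t > 0" using t(1) lk by (rule less_le_trans[rotated])
  note [measurable] = term_at_measurable[OF t0]
  have Gm [measurable]: "{x. good w L k x} \<in> sets (borel :: (real ^ 'n) measure)" by measurable
  have "(\<integral>\<^sup>+x. sq (theta \<mu> s t f x
        - theta \<mu> s t (\<lambda>_. 1) x * cell_avg \<mu> (level w L k) f x)
        * good_ind w L k x \<partial>\<mu>)
    \<le> (\<integral>\<^sup>+x. (\<Sum>i\<le>Suc N. ennreal (2 / (1 - \<sigma>)) * ennreal (1 / \<sigma> ^ gap k i)
        * (sq (term_at k i t x) * good_ind w L k x)) \<partial>\<mu>)"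
  proof (rule nn_integral_mono)
    fix x
    have "(cmod (\<Sum>i\<le>Suc N. term_at k i t x))\<^sup>2
        \<le> 2 / (1 - \<sigma>) * (\<Sum>i\<le>Suc N. (cmod (term_at k i t x))\<^sup>2 / \<sigma> ^ gap k i)"
      using \<sigma>_bounds by (intro norm_sum_squared_weighted sum_power_gap_le) auto
    also have "\<dots> = (\<Sum>i\<le>Suc N. 2 / (1 - \<sigma>) * ((1 / \<sigma> ^ gap k i) * (cmod (term_at k i t x))\<^sup>2))"
      unfolding sum_distrib_left by (intro sum.cong refl) simp
    finally have "sq (\<Sum>i\<le>Suc N. term_at k i t x)
        \<le> ennreal (\<Sum>i\<le>Suc N. 2 / (1 - \<sigma>) * ((1 / \<sigma> ^ gap k i) * (cmod (term_at k i t x))\<^sup>2))"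
      by (rule ennreal_leI)
    also have "\<dots> = (\<Sum>i\<le>Suc N. ennreal (2 / (1 - \<sigma>)) * ennreal (1 / \<sigma> ^ gap k i) * sq (term_at k i t x))"
      using \<sigma>_bounds by (subst sum_ennreal[symmetric]) (auto simp: ennreal_mult[symmetric] mult.assoc)
    finally have "sq (\<Sum>i\<le>Suc N. term_at k i t x) * good_ind w L k x
      \<le> (\<Sum>i\<le>Suc N. ennreal (2 / (1 - \<sigma>)) * ennreal (1 / \<sigma> ^ gap k i) * sq (term_at k i t x)) * good_ind w L k x"
      by (rule mult_right_mono) simp
    then show "sq (theta \<mu> s t f x
        - theta \<mu> s t (\<lambda>_. 1) x * cell_avg \<mu> (level w L k) f x)
        * good_ind w L k x
      \<le> (\<Sum>i\<le>Suc N. ennreal (2 / (1 - \<sigma>)) * ennreal (1 / \<sigma> ^ gap k i)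
        * (sq (term_at k i t x) * good_ind w L k x))"
      unfolding sum_term_at[OF k t0] sum_distrib_right by (simp only: mult.assoc)
  qed
  also have "\<dots> = (\<Sum>i\<le>Suc N. ennreal (2 / (1 - \<sigma>)) * ennreal (1 / \<sigma> ^ gap k i)
        * (\<integral>\<^sup>+x. sq (term_at k i t x) * good_ind w L k x \<partial>\<mu>))"
    by (subst nn_integral_sum) (auto simp: nn_integral_cmult)
  also have "\<dots> \<le> (\<Sum>i\<le>Suc N. ennreal (2 / (1 - \<sigma>)) * ennreal (1 / \<sigma> ^ gap k i)
        * (remainder_const * ennreal (\<rho> ^ gap k i) * sqnorm \<mu> (piece w L N f i)))"
    by (intro sum_mono mult_left_mono term_at_L2_bound k t) auto
  also have "\<dots> = (\<Sum>i\<le>Suc N. remainder_term w L N f k i)"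
  proof (rule sum.cong[OF refl])
    fix i
    have "ennreal (1 / \<sigma> ^ gap k i) * ennreal (\<rho> ^ gap k i) = ennreal (\<sigma> ^ gap k i)"
      using \<sigma>_bounds by (subst ennreal_mult[symmetric]) (auto simp: \<rho>_eq power_mult_distrib)
    moreover have "q * a * (remainder_const * b * v) = q * remainder_const * (a * b) * v" for q a b v :: ennreal
      by (simp only: mult_ac)
    ultimately show "ennreal (2 / (1 - \<sigma>)) * ennreal (1 / \<sigma> ^ gap k i) * (remainder_const * ennreal (\<rho> ^ gap k i) * sqnorm \<mu> (piece w L N f i))
      = remainder_term w L N f k i"
      by (simp only:)
  qed
  finally show ?thesis .
qed

text \<open>The embedding theorem applied to \<open>\<bar>f\<bar>\<close>, after division of the coefficients by \<open>1 + pack_const\<close>; the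
summand \<open>1\<close> keeps this divisor away from \<open>0\<close>.\<close>

lemma paraproduct:
  "(\<Sum>k\<le>N. \<integral>\<^sup>+x. carleson_density w L k x * sq (cell_avg \<mu> (level w L k) f x) \<partial>\<mu>)
    \<le> 4 * (1 + pack_const) * sqnorm \<mu> f"
proof -
  let ?avg = "\<lambda>k. nn_cell_avg \<mu> (level w L k) (\<lambda>y. ennreal (cmod (f y)))"
  note [measurable] = L2_borel[OF f]
  define C where "C = 1 + pack_const"
  have C: "C \<noteq> 0" "C \<noteq> top" "C \<ge> pack_const" using pack_const_finite by (auto simp: C_def less_top)
  have cancel: "C * (v / C) = v" for v
  proof -
    have "C * (v / C) = v * (C / C)" by (simp add: mult.commute[of C] ennreal_divide_times)
    also have "C / C = 1" using C by (intro ennreal_divide_self) (auto simp: less_top)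
    finally show ?thesis by simp
  qed
  have fin: "(\<integral>\<^sup>+x. (ennreal (cmod (f x)))\<^sup>2 \<partial>\<mu>) = sqnorm \<mu> f"
    by (simp add: sqnorm_def ennreal_power)
  have "(\<Sum>k\<le>N. \<integral>\<^sup>+x. carleson_density w L k x / C * (?avg k x)\<^sup>2 \<partial>\<mu>)
    \<le> 4 * (\<integral>\<^sup>+x. (ennreal (cmod (f x)))\<^sup>2 \<partial>\<mu>)"
  proof (rule carleson_embedding[where p="\<lambda>k. level w L k"])
    show "countable_partition \<mu> (level w L i)" for i by (rule level_partition[OF L f])
    show "level w L i x = level w L i y"
      if "level w L (Suc i) x = level w L (Suc i) y" for i and x y :: "real ^ 'n"
      using that by (rule cell_index_refine)
    show "(\<lambda>x. carleson_density w L i x / C) \<in> borel_measurable \<mu>" for i by measurable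
    show "(\<lambda>x. ennreal (cmod (f x))) \<in> borel_measurable \<mu>" by measurable
    show "(\<integral>\<^sup>+x. (ennreal (cmod (f x)))\<^sup>2 \<partial>\<mu>) < \<infinity>"
      unfolding fin sqnorm_eq_L2norm[OF f] by simp
    fix i z assume i: "i \<le> N"
    have [measurable]: "{x :: real ^ 'n. level w L i x = z} \<in> sets borel" by (rule cell_measurable)
    have "(\<integral>\<^sup>+x. (\<Sum>k=i..N. carleson_density w L k x / C) * indicator {x. level w L i x = z} x \<partial>\<mu>)
      = (\<integral>\<^sup>+x. (\<Sum>k=i..N. carleson_density w L k x) * indicator {x. level w L i x = z} x * inverse C \<partial>\<mu>)"
      unfolding divide_ennreal_def sum_distrib_right[symmetric]
      by (intro nn_integral_cong) (simp only: mult_ac)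
    also have "\<dots> = (\<integral>\<^sup>+x. (\<Sum>k=i..N. carleson_density w L k x) * indicator {x. level w L i x = z} x \<partial>\<mu>) / C"
      by (subst nn_integral_multc) (auto simp: divide_ennreal_def)
    also have "\<dots> \<le> C * emeasure \<mu> {x. level w L i x = z} / C"
      by (intro divide_right_mono_ennreal order_trans[OF packing[OF L i]] mult_right_mono C) auto
    also have "\<dots> = emeasure \<mu> {x \<in> space \<mu>. level w L i x = z}"
      unfolding ennreal_times_divide[symmetric] cancel by simp
    finally show "(\<integral>\<^sup>+x. (\<Sum>k=i..N. carleson_density w L k x / C) * indicator {x. level w L i x = z} x \<partial>\<mu>)
      \<le> emeasure \<mu> {x \<in> space \<mu>. level w L i x = z}" .
  qed
  then have emb: "(\<Sum>k\<le>N. \<integral>\<^sup>+x. carleson_density w L k x / C * (?avg k x)\<^sup>2 \<partial>\<mu>)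
    \<le> 4 * sqnorm \<mu> f" unfolding fin .
  have "(\<Sum>k\<le>N. \<integral>\<^sup>+x. carleson_density w L k x * sq (cell_avg \<mu> (level w L k) f x) \<partial>\<mu>)
    \<le> (\<Sum>k\<le>N. C * (\<integral>\<^sup>+x. carleson_density w L k x / C * (?avg k x)\<^sup>2 \<partial>\<mu>))"
  proof (rule sum_mono)
    fix k
    interpret countable_partition \<mu> "level w L k" by (rule level_partition[OF L f])
    have "(\<integral>\<^sup>+x. carleson_density w L k x * sq (cell_avg \<mu> (level w L k) f x) \<partial>\<mu>)
      \<le> (\<integral>\<^sup>+x. C * (carleson_density w L k x / C * (?avg k x)\<^sup>2) \<partial>\<mu>)"
    proof (rule nn_integral_mono)
      fix x
      have "sq (cell_avg \<mu> (level w L k) f x)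
          = (ennreal (cmod (cell_avg \<mu> (level w L k) f x)))\<^sup>2" by (simp add: ennreal_power)
      also have "\<dots> \<le> (?avg k x)\<^sup>2"
        by (intro power_mono cmod_cell_avg_le L2D[OF f]) auto
      finally show "carleson_density w L k x * sq (cell_avg \<mu> (level w L k) f x)
        \<le> C * (carleson_density w L k x / C * (?avg k x)\<^sup>2)"
        unfolding mult.assoc[symmetric] cancel by (rule mult_left_mono) simp
    qed
    also have "\<dots> = C * (\<integral>\<^sup>+x. carleson_density w L k x / C * (?avg k x)\<^sup>2 \<partial>\<mu>)"
      by (rule nn_integral_cmult) measurable
    finally show "(\<integral>\<^sup>+x. carleson_density w L k x * sq (cell_avg \<mu> (level w L k) f x) \<partial>\<mu>)
      \<le> C * (\<integral>\<^sup>+x. carleson_density w L k x / C * (?avg k x)\<^sup>2 \<partial>\<mu>)" .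
  qed
  also have "\<dots> \<le> C * (4 * sqnorm \<mu> f)"
    unfolding sum_distrib_left[symmetric] by (intro mult_left_mono emb) auto
  finally show ?thesis by (simp add: C_def mult_ac)
qed

end

end

section \<open>Averaging over the shifts\<close>

context square_function_testing
begin

definition total_const :: ennreal
  where "total_const = 8 * (1 + pack_const) + 2 * ((ennreal (2 / (1 - \<sigma>)))\<^sup>2 * remainder_const)"

lemma total_const_finite: "total_const < \<infinity>"
  using pack_const_finite remainder_const_finite unfolding total_const_def
  by (simp add: ennreal_mult_less_top power2_eq_square)

lemma theta_ext_slices_measurable:
  assumes g: "g \<in> borel_measurable borel"
  shows "(\<lambda>t. theta_ext g t x) \<in> borel_measurable borel" "theta_ext g t \<in> borel_measurable borel"
  using measurable_Pair1[OF theta_ext_measurable[OF g], of x] measurable_Pair2[OF theta_ext_measurable[OF g], of t] by simp_all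

lemma good_set_measurable: "{x :: real ^ 'n. good w L k x} \<in> sets borel"
  by measurable

lemma remainder_bound:
  assumes L: "L > 0" and f: "f \<in> L2 \<mu>" and k: "k \<le> N"
  shows "(\<integral>\<^sup>+x. (\<integral>\<^sup>+t. scale_weight (L / 2 ^ k) t
        * sq (theta_ext f t x - theta_ext (\<lambda>_. 1) t x * cell_avg \<mu> (level w L k) f x)
        * good_ind w L k x \<partial>lborel) \<partial>\<mu>)
    \<le> (\<Sum>i\<le>Suc N. remainder_term w L N f k i)"
    (is "?lhs \<le> ?S")
proof -
  interpret PP: pair_sigma_finite \<mu> lborel by unfold_locales
  interpret countable_partition \<mu> "level w L k" by (rule level_partition[OF L f])
  define E where "E = cell_avg \<mu> (level w L k) f"
  define R where "R t x = theta_ext f t x - theta_ext (\<lambda>_. 1) t x * E x" for t x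
  have [measurable]: "E \<in> borel_measurable borel"
    using cell_avg_measurable[of f] unfolding E_def measurable_cong_sets[OF borel_measure refl] .
  note [measurable] = good_set_measurable[of w L k] theta_ext_measurable[OF L2_borel[OF f]] theta_ext_measurable[OF borel_measurable_const, of 1]
  have "(\<lambda>z. scale_weight (L / 2 ^ k) (snd z) * sq (R (snd z) (fst z))
      * indicator {x. good w L k x} (fst z)) \<in> borel_measurable (borel \<Otimes>\<^sub>M borel)"
    unfolding R_def by measurable
  then have m: "(\<lambda>(x, t). scale_weight (L / 2 ^ k) t * sq (R t x)
      * good_ind w L k x) \<in> borel_measurable (\<mu> \<Otimes>\<^sub>M lborel)"
    unfolding measurable_cong_sets[OF sets_pair_mu refl] by (simp add: case_prod_beta')
  have Rm [measurable]: "R t \<in> borel_measurable borel" for t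
    using theta_ext_slices_measurable(2)[OF L2_borel[OF f], of t] theta_ext_slices_measurable(2)[OF borel_measurable_const, of 1 t]
    unfolding R_def[abs_def] by measurable
  have "?lhs = (\<integral>\<^sup>+t. (\<integral>\<^sup>+x. scale_weight (L / 2 ^ k) t * sq (R t x)
      * good_ind w L k x \<partial>\<mu>) \<partial>lborel)"
    unfolding R_def[symmetric] E_def[symmetric] using PP.Fubini'[OF m] by simp
  also have "\<dots> = (\<integral>\<^sup>+t. scale_weight (L / 2 ^ k) t * (\<integral>\<^sup>+x. sq (R t x)
      * good_ind w L k x \<partial>\<mu>) \<partial>lborel)"
    by (intro nn_integral_cong) (simp add: mult.assoc nn_integral_cmult)
  also have "\<dots> \<le> (\<integral>\<^sup>+t. scale_weight (L / 2 ^ k) t * ?S \<partial>lborel)"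
  proof (rule nn_integral_mono)
    fix t
    show "scale_weight (L / 2 ^ k) t * (\<integral>\<^sup>+x. sq (R t x) * good_ind w L k x \<partial>\<mu>)
      \<le> scale_weight (L / 2 ^ k) t * ?S"
    proof (cases "L / 2 ^ k / 2 \<le> t \<and> t < L / 2 ^ k")
      case True
      have "0 < L / 2 ^ k / 2" using L by simp
      with True have t0: "t > 0" by (auto intro: less_le_trans)
      have "(\<integral>\<^sup>+x. sq (R t x) * good_ind w L k x \<partial>\<mu>) \<le> ?S"
        unfolding R_def theta_ext_eq[OF t0] E_def using True by (intro remainder_at_scale[OF L f k]) auto
      then show ?thesis by (rule mult_left_mono) simp
    next
      case False
      then have "scale_weight (L / 2 ^ k) t = 0" unfolding scale_weight_def by (rule if_not_P)
      then show ?thesis by simp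
    qed
  qed
  also have "\<dots> = (\<integral>\<^sup>+t. scale_weight (L / 2 ^ k) t \<partial>lborel) * ?S"
    by (rule nn_integral_multc) measurable
  also have "\<dots> \<le> 1 * ?S"
    using L by (intro mult_right_mono scale_weight_integral) auto
  finally show ?thesis by simp
qed

lemma sum_remainder_bound:
  assumes L: "L > 0" and f: "f \<in> L2 \<mu>"
  shows "(\<Sum>k\<le>N. \<Sum>i\<le>Suc N. remainder_term w L N f k i)
    \<le> (ennreal (2 / (1 - \<sigma>)))\<^sup>2 * remainder_const * sqnorm \<mu> f"
proof -
  define q where "q = ennreal (2 / (1 - \<sigma>))"
  have "(\<Sum>k\<le>N. \<Sum>i\<le>Suc N. q * remainder_const * ennreal (\<sigma> ^ gap k i) * sqnorm \<mu> (piece w L N f i))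
    = (\<Sum>i\<le>Suc N. \<Sum>k\<le>N. q * remainder_const * ennreal (\<sigma> ^ gap k i) * sqnorm \<mu> (piece w L N f i))"
    by (rule sum.swap)
  also have "\<dots> = (\<Sum>i\<le>Suc N. q * remainder_const * (\<Sum>k\<le>N. ennreal (\<sigma> ^ gap k i)) * sqnorm \<mu> (piece w L N f i))"
    unfolding sum_distrib_left sum_distrib_right ..
  also have "\<dots> \<le> (\<Sum>i\<le>Suc N. q * remainder_const * q * sqnorm \<mu> (piece w L N f i))"
  proof (intro sum_mono mult_right_mono mult_left_mono)
    fix i
    have "(\<Sum>k\<le>N. ennreal (\<sigma> ^ gap k i)) = ennreal (\<Sum>k\<le>N. \<sigma> ^ gap i k)"
      using \<sigma>_bounds by (subst sum_ennreal) (auto simp: gap_commute[of _ i])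
    also have "\<dots> \<le> q"
      unfolding q_def using \<sigma>_bounds by (intro ennreal_leI sum_power_gap_le) auto
    finally show "(\<Sum>k\<le>N. ennreal (\<sigma> ^ gap k i)) \<le> q" .
  qed auto
  also have "\<dots> = q\<^sup>2 * remainder_const * sqnorm \<mu> f"
    unfolding sum_distrib_left[symmetric] sum_sqnorm_piece[OF L f] by (simp add: power2_eq_square mult_ac)
  finally show ?thesis unfolding q_def .
qed

text \<open>The bound for a single grid, with a constant independent of the grid and of the number of
generations.\<close>

lemma good_part_bound:
  assumes L: "L > 0" and f: "f \<in> L2 \<mu>"
  shows "(\<Sum>k\<le>N. \<integral>\<^sup>+x. (\<integral>\<^sup>+t. scale_weight (L / 2 ^ k) t * sq (theta_ext f t x) \<partial>lborel)
      * good_ind w L k x \<partial>\<mu>) \<le> total_const * sqnorm \<mu> f"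
proof -
  define E where "E k = cell_avg \<mu> (level w L k) f" for k
  have Em [measurable]: "E k \<in> borel_measurable borel" for k
  proof -
    interpret countable_partition \<mu> "level w L k" by (rule level_partition[OF L f])
    show ?thesis using cell_avg_measurable[of f] unfolding E_def measurable_cong_sets[OF borel_measure refl] .
  qed
  note [measurable] = good_set_measurable theta_ext_measurable[OF L2_borel[OF f]] theta_ext_measurable[OF borel_measurable_const, of 1]
    theta_ext_slices_measurable[OF L2_borel[OF f]] theta_ext_slices_measurable[OF borel_measurable_const, of 1]
  define R where "R k x = (\<integral>\<^sup>+t. scale_weight (L / 2 ^ k) t
      * sq (theta_ext f t x - theta_ext (\<lambda>_. 1) t x * E k x) * good_ind w L k x \<partial>lborel)" for k x
  have Rm [measurable]: "R k \<in> borel_measurable borel" for k unfolding R_def[abs_def] by measurable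
  have pw: "(\<integral>\<^sup>+t. scale_weight (L / 2 ^ k) t * sq (theta_ext f t x) \<partial>lborel) * good_ind w L k x
      \<le> 2 * (carleson_density w L k x * sq (E k x)) + 2 * R k x" for k x
  proof -
    let ?G = "good_ind w L k x :: ennreal"
    define X Y where "X t = scale_weight (L / 2 ^ k) t * sq (theta_ext (\<lambda>_. 1) t x) * ?G"
      and "Y t = scale_weight (L / 2 ^ k) t * sq (theta_ext f t x - theta_ext (\<lambda>_. 1) t x * E k x) * ?G" for t
    have XY: "X \<in> borel_measurable lborel" "Y \<in> borel_measurable lborel"
      unfolding X_def[abs_def] Y_def[abs_def] by measurable
    have "(\<integral>\<^sup>+t. scale_weight (L / 2 ^ k) t * sq (theta_ext f t x) \<partial>lborel) * ?G
      = (\<integral>\<^sup>+t. scale_weight (L / 2 ^ k) t * sq (theta_ext f t x) * ?G \<partial>lborel)"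
      by (rule nn_integral_multc[symmetric]) measurable
    also have "\<dots> \<le> (\<integral>\<^sup>+t. 2 * (X t * sq (E k x)) + 2 * Y t \<partial>lborel)"
    proof (rule nn_integral_mono)
      fix t
      define a b where "a = theta_ext (\<lambda>_. 1) t x * E k x" and "b = theta_ext f t x - a"
      have "(cmod (theta_ext f t x))\<^sup>2 \<le> (cmod a + cmod b)\<^sup>2"
        unfolding b_def using norm_triangle_ineq[of a "theta_ext f t x - a"] by (intro power_mono) auto
      also have "\<dots> \<le> 2 * (cmod a)\<^sup>2 + 2 * (cmod b)\<^sup>2"
        by (rule power2_sum_le)
      finally have "sq (theta_ext f t x) \<le> ennreal (2 * (cmod a)\<^sup>2 + 2 * (cmod b)\<^sup>2)" by (rule ennreal_leI)
      also have "\<dots> = 2 * (sq (theta_ext (\<lambda>_. 1) t x) * sq (E k x)) + 2 * sq b"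
        by (simp add: a_def ennreal_mult norm_mult power_mult_distrib)
      finally have "scale_weight (L / 2 ^ k) t * sq (theta_ext f t x) * ?G
        \<le> scale_weight (L / 2 ^ k) t * (2 * (sq (theta_ext (\<lambda>_. 1) t x) * sq (E k x)) + 2 * sq b) * ?G"
        by (intro mult_right_mono mult_left_mono) auto
      also have "\<dots> = 2 * ((scale_weight (L / 2 ^ k) t * sq (theta_ext (\<lambda>_. 1) t x) * ?G) * sq (E k x))
        + 2 * (scale_weight (L / 2 ^ k) t * sq b * ?G)"
        by (simp only: distrib_left distrib_right mult_ac)
      finally show "scale_weight (L / 2 ^ k) t * sq (theta_ext f t x) * ?G
        \<le> 2 * (X t * sq (E k x)) + 2 * Y t"
        by (simp only: a_def b_def X_def Y_def)
    qed
    also have "\<dots> = 2 * (carleson_density w L k x * sq (E k x)) + 2 * R k x"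
      unfolding carleson_density_def R_def X_def[symmetric] Y_def[symmetric]
      using XY by (simp add: nn_integral_add nn_integral_cmult nn_integral_multc)
    finally show ?thesis .
  qed
  have "(\<Sum>k\<le>N. \<integral>\<^sup>+x. (\<integral>\<^sup>+t. scale_weight (L / 2 ^ k) t * sq (theta_ext f t x) \<partial>lborel)
      * good_ind w L k x \<partial>\<mu>)
    \<le> (\<Sum>k\<le>N. \<integral>\<^sup>+x. 2 * (carleson_density w L k x * sq (E k x)) + 2 * R k x \<partial>\<mu>)"
    by (intro sum_mono nn_integral_mono pw)
  also have "\<dots> = (\<Sum>k\<le>N. 2 * (\<integral>\<^sup>+x. carleson_density w L k x * sq (E k x) \<partial>\<mu>) + 2 * (\<integral>\<^sup>+x. R k x \<partial>\<mu>))"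
    by (intro sum.cong refl) (simp add: nn_integral_add nn_integral_cmult)
  also have "\<dots> = 2 * (\<Sum>k\<le>N. \<integral>\<^sup>+x. carleson_density w L k x * sq (E k x) \<partial>\<mu>) + 2 * (\<Sum>k\<le>N. \<integral>\<^sup>+x. R k x \<partial>\<mu>)"
    by (simp add: sum.distrib sum_distrib_left)
  also have "\<dots> \<le> 2 * (4 * (1 + pack_const) * sqnorm \<mu> f) + 2 * ((ennreal (2 / (1 - \<sigma>)))\<^sup>2 * remainder_const * sqnorm \<mu> f)"
  proof (intro add_mono mult_left_mono)
    show "(\<Sum>k\<le>N. \<integral>\<^sup>+x. carleson_density w L k x * sq (E k x) \<partial>\<mu>) \<le> 4 * (1 + pack_const) * sqnorm \<mu> f"
      unfolding E_def by (rule paraproduct[OF L f])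
    have "(\<Sum>k\<le>N. \<integral>\<^sup>+x. R k x \<partial>\<mu>)
      \<le> (\<Sum>k\<le>N. \<Sum>i\<le>Suc N. remainder_term w L N f k i)"
      unfolding R_def E_def by (intro sum_mono remainder_bound L f) auto
    also have "\<dots> \<le> (ennreal (2 / (1 - \<sigma>)))\<^sup>2 * remainder_const * sqnorm \<mu> f" by (rule sum_remainder_bound[OF L f])
    finally show "(\<Sum>k\<le>N. \<integral>\<^sup>+x. R k x \<partial>\<mu>) \<le> (ennreal (2 / (1 - \<sigma>)))\<^sup>2 * remainder_const * sqnorm \<mu> f" .
  qed auto
  also have "\<dots> = total_const * sqnorm \<mu> f"
  proof -
    have "2 * (4 * u * v) = 8 * u * v" for u v :: ennreal by (simp add: mult.assoc[symmetric])
    then show ?thesis by (simp add: total_const_def distrib_right mult.assoc)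
  qed
  finally show ?thesis .
qed

text \<open>Every \<open>x\<close> is good at scale \<open>k\<close> for a set of shifts of measure at least \<open>L / 2\<close>, so \<open>L / 2\<close> times the
left-hand side is at most the integral over \<open>w \<in> [0, L]\<close> of its good parts.\<close>

lemma all_scales_bound:
  assumes L: "L > 0" and f: "f \<in> L2 \<mu>"
  shows "(\<Sum>k\<le>N. \<integral>\<^sup>+x. (\<integral>\<^sup>+t. scale_weight (L / 2 ^ k) t * sq (theta_ext f t x) \<partial>lborel) \<partial>\<mu>)
    \<le> 2 * total_const * sqnorm \<mu> f"
proof -
  interpret PP: pair_sigma_finite \<mu> lborel by unfold_locales
  note [measurable] = theta_ext_measurable[OF L2_borel[OF f]]
  define m where "m k x = (\<integral>\<^sup>+t. scale_weight (L / 2 ^ k) t * sq (theta_ext f t x) \<partial>lborel)" for k x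
  have mm [measurable]: "m k \<in> borel_measurable borel" for k unfolding m_def[abs_def] by measurable
  have gm: "(\<lambda>(x, w). m k x * shift_ind w L k x) \<in> borel_measurable (\<mu> \<Otimes>\<^sub>M lborel)" for k
  proof -
    have "(\<lambda>z. (snd z, fst z)) \<in> measurable ((borel :: (real ^ 'n) measure) \<Otimes>\<^sub>M (borel :: real measure)) (borel \<Otimes>\<^sub>M borel)"
      by measurable
    from measurable_compose[OF this good_measurable[of L k]]
    have [measurable]: "Measurable.pred ((borel :: (real ^ 'n) measure) \<Otimes>\<^sub>M borel) (\<lambda>z. good (snd z) L k (fst z))"
      unfolding fst_conv snd_conv .
    have "(\<lambda>z. m k (fst z) * (if snd z \<in> {0..L} \<and> good (snd z) L k (fst z) then 1 else 0))
        \<in> borel_measurable ((borel :: (real ^ 'n) measure) \<Otimes>\<^sub>M borel)" by measurable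
    then show ?thesis
      unfolding measurable_cong_sets[OF sets_pair_mu refl] by (simp only: case_prod_beta')
  qed
  have "ennreal (L / 2) * (\<Sum>k\<le>N. \<integral>\<^sup>+x. m k x \<partial>\<mu>) = (\<Sum>k\<le>N. \<integral>\<^sup>+x. m k x * ennreal (L / 2) \<partial>\<mu>)"
    by (simp add: sum_distrib_left nn_integral_multc mult.commute)
  also have "\<dots> \<le> (\<Sum>k\<le>N. \<integral>\<^sup>+x. m k x * (\<integral>\<^sup>+w. shift_ind w L k x \<partial>lborel) \<partial>\<mu>)"
    by (intro sum_mono nn_integral_mono mult_left_mono good_measure L) auto
  also have "\<dots> = (\<Sum>k\<le>N. \<integral>\<^sup>+x. (\<integral>\<^sup>+w. m k x * shift_ind w L k x \<partial>lborel) \<partial>\<mu>)"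
    by (intro sum.cong refl nn_integral_cong nn_integral_cmult[symmetric]) measurable
  also have "\<dots> = (\<Sum>k\<le>N. \<integral>\<^sup>+w. (\<integral>\<^sup>+x. m k x * shift_ind w L k x \<partial>\<mu>) \<partial>lborel)"
    by (intro sum.cong refl PP.Fubini'[symmetric] gm)
  also have "\<dots> = (\<integral>\<^sup>+w. (\<Sum>k\<le>N. \<integral>\<^sup>+x. m k x * shift_ind w L k x \<partial>\<mu>) \<partial>lborel)"
  proof (rule nn_integral_sum[symmetric])
    fix k
    have "(\<lambda>(w, x). m k x * shift_ind w L k x) \<in> borel_measurable (lborel \<Otimes>\<^sub>M \<mu>)"
      using measurable_compose[OF measurable_pair_swap' gm[of k]] by (simp only: case_prod_beta' fst_conv snd_conv)
    then show "(\<lambda>w. \<integral>\<^sup>+x. m k x * shift_ind w L k x \<partial>\<mu>) \<in> borel_measurable lborel"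
      by (rule mu.borel_measurable_nn_integral)
  qed
  also have "\<dots> \<le> (\<integral>\<^sup>+w. total_const * sqnorm \<mu> f * indicator {0..L} w \<partial>lborel)"
  proof (rule nn_integral_mono)
    fix w
    show "(\<Sum>k\<le>N. \<integral>\<^sup>+x. m k x * shift_ind w L k x \<partial>\<mu>)
      \<le> total_const * sqnorm \<mu> f * indicator {0..L} w"
    proof (cases "w \<in> {0..L}")
      case True
      have "(\<Sum>k\<le>N. \<integral>\<^sup>+x. m k x * shift_ind w L k x \<partial>\<mu>)
        = (\<Sum>k\<le>N. \<integral>\<^sup>+x. m k x * good_ind w L k x \<partial>\<mu>)"
        using True by (intro sum.cong refl nn_integral_cong) (auto simp: indicator_def)
      also have "\<dots> \<le> total_const * sqnorm \<mu> f" unfolding m_def by (rule good_part_bound[OF L f])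
      finally show ?thesis using True by simp
    next
      case False
      have "shift_ind w L k x = (0::ennreal)" for k and x :: "real ^ 'n"
        by (rule if_not_P) (use False in blast)
      then show ?thesis by (simp only: mult_zero_right nn_integral_const mult_zero_left sum.neutral_const zero_le)
    qed
  qed
  also have "\<dots> = total_const * sqnorm \<mu> f * ennreal L"
    using L by (subst nn_integral_cmult_indicator) auto
  also have "\<dots> = ennreal (L / 2) * (2 * total_const * sqnorm \<mu> f)"
  proof -
    have "ennreal L = ennreal (L / 2) * 2"
      using L ennreal_mult[of "L / 2" 2] by simp
    then show ?thesis by (simp only: mult_ac)
  qed
  finally have "ennreal (L / 2) * (\<Sum>k\<le>N. \<integral>\<^sup>+x. m k x \<partial>\<mu>) \<le> ennreal (L / 2) * (2 * total_const * sqnorm \<mu> f)" .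
  then have "(\<Sum>k\<le>N. \<integral>\<^sup>+x. m k x \<partial>\<mu>) \<le> 2 * total_const * sqnorm \<mu> f"
    using L by (subst (asm) ennreal_mult_le_mult_iff) auto
  then show ?thesis unfolding m_def .
qed

text \<open>With \<open>L = 2\<^sup>n\<close> and \<open>2 n + 1\<close> generations the scales cover \<open>[2\<^bsup>-n-1\<^esup>, 2\<^sup>n)\<close>, which exhausts the half
line.\<close>

lemma square_function_bound:
  assumes f: "f \<in> L2 \<mu>"
  shows "square_integral \<mu> s f upper_half_space \<le> 2 * total_const * sqnorm \<mu> f"
proof -
  note fm = L2_borel[OF f]
  note [measurable] = theta_ext_measurable[OF fm]
  define a b :: "nat \<Rightarrow> real" where "a n = 2 ^ n / 2 ^ Suc (2 * n)" and "b n = 2 ^ n" for n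
  define S :: "nat \<Rightarrow> ((real ^ 'n) \<times> real) set" where "S n = UNIV \<times> {a n..<b n}" for n
  have an: "a n = 1 / 2 * (1 / 2) ^ n" for n
  proof -
    have "(2::real) ^ Suc (2 * n) = 2 * (2 ^ n * 2 ^ n)"
      by (simp only: power_Suc power_even_eq power2_eq_square)
    then show ?thesis unfolding a_def by (simp only: power_one_over) simp
  qed
  have a_pos: "a n > 0" for n by (simp add: a_def)
  have Sm: "S n \<in> sets (borel \<Otimes>\<^sub>M borel)" for n unfolding S_def by (intro pair_measureI) auto
  have Ssub: "S n \<subseteq> UNIV \<times> {0<..}" for n using a_pos[of n] by (auto simp: S_def)
  define F where "F A v = (case v of (x, t) \<Rightarrow> ennreal ((cmod (theta \<mu> s t f x))\<^sup>2 / t)) * indicator A v"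
    for A and v :: "(real ^ 'n) \<times> real"
  have bound: "(\<integral>\<^sup>+v. F (S n) v \<partial>(\<mu> \<Otimes>\<^sub>M lborel)) \<le> 2 * total_const * sqnorm \<mu> f" for n
  proof -
    have b: "b n > 0" by (simp add: b_def)
    have "(\<integral>\<^sup>+v. F (S n) v \<partial>(\<mu> \<Otimes>\<^sub>M lborel)) = square_integral \<mu> s f (S n)"
      by (simp add: square_integral_def F_def)
    also have "\<dots> = (\<integral>\<^sup>+x. (\<integral>\<^sup>+t. sq (theta_ext f t x) * ennreal (1 / t) * indicator (S n) (x, t) \<partial>lborel) \<partial>\<mu>)"
      by (rule square_integral_iterated[OF fm Sm Ssub])
    also have "\<dots> \<le> (\<integral>\<^sup>+x. (\<integral>\<^sup>+t. (\<Sum>k\<le>2 * n. scale_weight (b n / 2 ^ k) t * sq (theta_ext f t x)) \<partial>lborel) \<partial>\<mu>)"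
    proof (intro nn_integral_mono)
      fix x t
      have "sq (theta_ext f t x) * ennreal (1 / t) * indicator (S n) (x, t)
        = (ennreal (1 / t) * indicator {b n / 2 ^ Suc (2 * n)..<b n} t) * sq (theta_ext f t x)"
        by (auto simp: S_def a_def b_def indicator_def mult.commute)
      also have "\<dots> \<le> (\<Sum>k\<le>2 * n. scale_weight (b n / 2 ^ k) t) * sq (theta_ext f t x)"
        by (intro mult_right_mono le_sum_scale_weight b) auto
      finally show "sq (theta_ext f t x) * ennreal (1 / t) * indicator (S n) (x, t)
        \<le> (\<Sum>k\<le>2 * n. scale_weight (b n / 2 ^ k) t * sq (theta_ext f t x))"
        unfolding sum_distrib_right .
    qed
    also have "\<dots> = (\<Sum>k\<le>2 * n. \<integral>\<^sup>+x. (\<integral>\<^sup>+t. scale_weight (b n / 2 ^ k) t * sq (theta_ext f t x) \<partial>lborel) \<partial>\<mu>)"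
      by (simp add: nn_integral_sum)
    also have "\<dots> \<le> 2 * total_const * sqnorm \<mu> f" by (rule all_scales_bound[OF b f])
    finally show ?thesis .
  qed
  have "square_integral \<mu> s f upper_half_space = (\<integral>\<^sup>+v. F upper_half_space v \<partial>(\<mu> \<Otimes>\<^sub>M lborel))"
    by (simp add: square_integral_def F_def)
  also have "\<dots> \<le> (\<integral>\<^sup>+v. liminf (\<lambda>n. F (S n) v) \<partial>(\<mu> \<Otimes>\<^sub>M lborel))"
  proof (rule nn_integral_mono)
    fix v :: "(real ^ 'n) \<times> real"
    obtain x t where v: "v = (x, t)" by (cases v)
    show "F upper_half_space v \<le> liminf (\<lambda>n. F (S n) v)"
    proof (cases "t > 0")
      case True
      have "(\<lambda>n. 1 / 2 * (1 / 2 :: real) ^ n) \<longlonglongrightarrow> 1 / 2 * 0"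
        by (intro tendsto_intros LIMSEQ_power_zero) auto
      then have "\<forall>\<^sub>F n in sequentially. a n < t"
        unfolding an using True by (intro order_tendstoD(2)) auto
      moreover have "\<forall>\<^sub>F n in sequentially. t < b n"
      proof -
        obtain n0 where n0: "t < 2 ^ n0" using real_arch_pow[of 2 t] by auto
        have "t < b n" if "n \<ge> n0" for n
          unfolding b_def by (rule less_le_trans[OF n0]) (use that in \<open>auto intro: power_increasing\<close>)
        then show ?thesis by (auto simp: eventually_sequentially)
      qed
      ultimately have "\<forall>\<^sub>F n in sequentially. F (S n) v = F upper_half_space v"
        by eventually_elim (use True in \<open>auto simp: F_def v S_def upper_half_space_def\<close>)
      then have "(\<lambda>n. F (S n) v) \<longlonglongrightarrow> F upper_half_space v" by (rule tendsto_eventually)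
      then have "liminf (\<lambda>n. F (S n) v) = F upper_half_space v" by (intro lim_imp_Liminf) auto
      then show ?thesis by simp
    qed (simp add: F_def v upper_half_space_def)
  qed
  also have "\<dots> \<le> liminf (\<lambda>n. \<integral>\<^sup>+v. F (S n) v \<partial>(\<mu> \<Otimes>\<^sub>M lborel))"
    unfolding F_def by (rule nn_integral_liminf[OF square_integrand_measurable[OF fm Sm Ssub]])
  also have "\<dots> \<le> liminf (\<lambda>n. 2 * total_const * sqnorm \<mu> f)"
    by (intro Liminf_mono always_eventually allI bound)
  also have "\<dots> = 2 * total_const * sqnorm \<mu> f" by (rule Liminf_const) simp
  finally show ?thesis .
qed

end

theorem corollary1p4:
  fixes \<mu> :: "(real ^ 'n) measure"
    and lam :: "real ^ 'n \<Rightarrow> real \<Rightarrow> real"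
    and s :: "real \<Rightarrow> real ^ 'n \<Rightarrow> real ^ 'n \<Rightarrow> complex"
    and \<alpha> C_lam C\<^sub>1 :: real
    and C\<^sub>0 :: ennreal
  assumes borel_measure: "sets \<mu> = sets borel"
    and lam_pos: "\<And>x r. r > 0 \<Longrightarrow> lam x r > 0"
    and lam_mono: "\<And>x r r'. 0 < r \<Longrightarrow> r \<le> r' \<Longrightarrow> lam x r \<le> lam x r'"
    and lam_doubling: "\<And>x r. r > 0 \<Longrightarrow> lam x (2 * r) \<le> C_lam * lam x r"
    and upper_doubling: "\<And>x r. r > 0 \<Longrightarrow> emeasure \<mu> (linf_ball x r) \<le> ennreal (lam x r)"
    and alpha_pos: "\<alpha> > 0"
    and kernel_measurable:
      "(\<lambda>(x, y, t). s t x y) \<in> borel_measurable (borel \<Otimes>\<^sub>M borel \<Otimes>\<^sub>M restrict_space borel {0<..})"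
    and kernel_size: "\<And>x y t. t > 0 \<Longrightarrow>
      cmod (s t x y) \<le> C\<^sub>1 * (t powr \<alpha> / kernel_denom lam \<alpha> t x y)"
    and kernel_holder: "\<And>x y z t. t > 0 \<Longrightarrow> infnorm (y - z) < t / 2 \<Longrightarrow>
      cmod (s t x y - s t x z) \<le> C\<^sub>1 * (infnorm (y - z) powr \<alpha> / kernel_denom lam \<alpha> t x y)"
    and C0_finite: "C\<^sub>0 < \<infinity>"
    and testing: "\<And>a l. l > 0 \<Longrightarrow>
      square_integral \<mu> s (indicator (cube a l)) (carleson_box a l) \<le> C\<^sub>0 * emeasure \<mu> (cube a l)"
  shows "\<exists>C::ennreal. C < \<infinity> \<and>
    (\<forall>f \<in> L2 \<mu>. square_integral \<mu> s f upper_half_space \<le> C * ennreal ((L2norm \<mu> f)\<^sup>2))"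
proof -
  interpret square_function_testing \<mu> lam \<alpha> C_lam s C\<^sub>1 C\<^sub>0
    by unfold_locales (fact assms)+
  show ?thesis
  proof (intro exI conjI ballI)
    show "2 * total_const < \<infinity>" using total_const_finite by (simp add: ennreal_mult_less_top)
    show "square_integral \<mu> s f upper_half_space \<le> 2 * total_const * ennreal ((L2norm \<mu> f)\<^sup>2)"
      if "f \<in> L2 \<mu>" for f
      using square_function_bound[OF that] unfolding sqnorm_eq_L2norm[OF that] .
  qed
qed

end
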